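(* Suppose that $W$ is a Brownian motion on $(\Omega,\mathcal{F},P)$ and let $\mathbb{H}$ be its natural filtration augmented by the $P$-null sets. An $\mathbb{H}$-adapted continuous process $D$ with finite quadratic variation is an $\mathbb{H}$-weak Dirichlet process if and only if it is the sum of a continuous $\mathbb{H}$-local martingale $M$ and a finite quadratic variation process $Q$ which is continuous, $\mathbb{H}$-adapted and such that $[Q,W]=0$.
   Context: Processes are indexed by $t\in[0,1]$ with $X_t=X_{(t\vee0)\wedge1}$ for $t\in\mathbb{R}$. For continuous processes $X,Y$, $[X,Y]$ is the limit, if it exists, of $\frac1\varepsilon\int_0^t(X_{s+\varepsilon}-X_s)(Y_{s+\varepsilon}-Y_s)\,ds$ as $\varepsilon\to0$, in probability uniformly in $t\in[0,1]$. $X$ is a finite quadratic variation process if $[X,X]$ exists. An $\mathbb{H}$-weak Dirichlet process is the sum of a continuous $\mathbb{H}$-local martingale $M$ and a continuous process $Q$ such that $[Q,N]=0$ for every (continuous) $\mathbb{H}$-local martingale $N$. *)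

theory Defs
  imports "HOL-Probability.Probability"
begin

text \<open>
  A process is a function \<open>X :: real \<Rightarrow> 'a \<Rightarrow> real\<close> of which only the values
  \<open>X t \<omega>\<close> with \<open>t \<in> {0..1}\<close> and \<open>\<omega> \<in> space M\<close> are ever used.  Paths of continuous processes
  are continuous for every \<open>\<omega>\<close>, not just almost every one; this also keeps the events in
  \<open>ucp_limit\<close> below measurable when \<open>M\<close> is not complete.
\<close>

definition continuous_process :: "'a measure \<Rightarrow> (real \<Rightarrow> 'a \<Rightarrow> real) \<Rightarrow> bool" where
  "continuous_process M X \<longleftrightarrow>
     (\<forall>t\<in>{0..1}. X t \<in> borel_measurable M) \<and>
     (\<forall>\<omega>\<in>space M. continuous_on {0..1} (\<lambda>t. X t \<omega>))"

definition adapted :: "(real \<Rightarrow> 'a measure) \<Rightarrow> (real \<Rightarrow> 'a \<Rightarrow> real) \<Rightarrow> bool" where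
  "adapted F X \<longleftrightarrow> (\<forall>t\<in>{0..1}. X t \<in> borel_measurable (F t))"

definition process_sum ::
    "'a measure \<Rightarrow> (real \<Rightarrow> 'a \<Rightarrow> real) \<Rightarrow> (real \<Rightarrow> 'a \<Rightarrow> real) \<Rightarrow> (real \<Rightarrow> 'a \<Rightarrow> real) \<Rightarrow> bool" where
  "process_sum M X Y Z \<longleftrightarrow> (\<forall>t\<in>{0..1}. \<forall>\<omega>\<in>space M. X t \<omega> = Y t \<omega> + Z t \<omega>)"

definition brownian_motion :: "'a measure \<Rightarrow> (real \<Rightarrow> 'a \<Rightarrow> real) \<Rightarrow> bool" where
  "brownian_motion M W \<longleftrightarrow>
     continuous_process M W \<and>
     (AE \<omega> in M. W 0 \<omega> = 0) \<and>
     (\<forall>s t. 0 \<le> s \<longrightarrow> s < t \<longrightarrow> t \<le> 1 \<longrightarrow>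
        distributed M lborel (\<lambda>\<omega>. W t \<omega> - W s \<omega>) (normal_density 0 (sqrt (t - s)))) \<and>
     (\<forall>(n::nat) (u::nat \<Rightarrow> real). 0 \<le> u 0 \<longrightarrow> u n \<le> 1 \<longrightarrow> (\<forall>i<n. u i \<le> u (Suc i)) \<longrightarrow>
        prob_space.indep_vars M (\<lambda>_. borel) (\<lambda>i \<omega>. W (u (Suc i)) \<omega> - W (u i) \<omega>) {..<n})"

text \<open>
  Filtrations are indexed by all reals so as to fit the library notions \<open>filtration\<close> and
  \<open>stopping_time\<close>.  The one below is constant on \<open>{1..}\<close>, and before time 0 it is
  generated by the null sets alone.
\<close>

definition augmented_filtration ::
    "'a measure \<Rightarrow> (real \<Rightarrow> 'a \<Rightarrow> real) \<Rightarrow> real \<Rightarrow> 'a measure" where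
  "augmented_filtration M W t =
     sigma (space M)
       ({W s -` B \<inter> space M | s B. s \<in> {0..1} \<and> s \<le> t \<and> B \<in> sets borel} \<union> null_sets M)"

lemma augmented_filtration_generators:
  "{W s -` B \<inter> space M | s B. s \<in> {0..1} \<and> s \<le> t \<and> B \<in> sets borel} \<union> null_sets M \<subseteq> Pow (space M)"
  using sets.sets_into_space by (fastforce simp: null_sets_def)

lemma filtration_augmented_filtration: "filtration (space M) (augmented_filtration M W)"
proof
  show "space (augmented_filtration M W i) = space M" for i
    unfolding augmented_filtration_def
    by (rule space_measure_of[OF augmented_filtration_generators])
  show "sets (augmented_filtration M W i) \<subseteq> sets (augmented_filtration M W j)" if "i \<le> j" for i j
    unfolding augmented_filtration_def sets_measure_of[OF augmented_filtration_generators]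
    by (rule sigma_sets_mono') (use that in fastforce)
qed

lemma subalgebra_augmented_filtration:
  assumes "\<And>s. s \<in> {0..1} \<Longrightarrow> W s \<in> borel_measurable M"
  shows "subalgebra M (augmented_filtration M W t)"
  unfolding subalgebra_def
proof
  show "space (augmented_filtration M W t) = space M"
    by (rule filtration.space_F[OF filtration_augmented_filtration])
  show "sets (augmented_filtration M W t) \<subseteq> sets M"
    unfolding augmented_filtration_def sets_measure_of[OF augmented_filtration_generators]
    by (rule sets.sigma_sets_subset) (use assms in \<open>auto intro: measurable_sets\<close>)
qed

definition martingale ::
    "'a measure \<Rightarrow> (real \<Rightarrow> 'a measure) \<Rightarrow> (real \<Rightarrow> 'a \<Rightarrow> real) \<Rightarrow> bool" where
  "martingale M F X \<longleftrightarrow>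
     adapted F X \<and>
     (\<forall>t\<in>{0..1}. integrable M (X t)) \<and>
     (\<forall>s t. 0 \<le> s \<longrightarrow> s \<le> t \<longrightarrow> t \<le> 1 \<longrightarrow> (AE \<omega> in M. real_cond_exp M (F s) (X t) \<omega> = X s \<omega>))"

text \<open>
  On the compact time interval, a localizing sequence of stopping times must reach the
  terminal time 1 (almost surely, for all large \<open>n\<close>).  Subtracting the initial value means
  that it need not be integrable.
\<close>

definition continuous_local_martingale ::
    "'a measure \<Rightarrow> (real \<Rightarrow> 'a measure) \<Rightarrow> (real \<Rightarrow> 'a \<Rightarrow> real) \<Rightarrow> bool" where
  "continuous_local_martingale M F X \<longleftrightarrow>
     continuous_process M X \<and> adapted F X \<and>
     (\<exists>\<tau> :: nat \<Rightarrow> 'a \<Rightarrow> real.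
        (\<forall>n. stopping_time F (\<tau> n)) \<and>
        (\<forall>n. \<forall>\<omega>\<in>space M. 0 \<le> \<tau> n \<omega> \<and> \<tau> n \<omega> \<le> \<tau> (Suc n) \<omega>) \<and>
        (AE \<omega> in M. \<forall>\<^sub>F n in sequentially. 1 \<le> \<tau> n \<omega>) \<and>
        (\<forall>n. martingale M F (\<lambda>t \<omega>. X (min t (\<tau> n \<omega>)) \<omega> - X 0 \<omega>)))"

text \<open>The extension \<open>X\<^sub>t = X\<^bsub>(t \<or> 0) \<and> 1\<^esub>\<close> of a process to all real times.\<close>

definition extend :: "(real \<Rightarrow> 'a \<Rightarrow> real) \<Rightarrow> real \<Rightarrow> 'a \<Rightarrow> real" where
  "extend X t = X (min (max t 0) 1)"

definition covariation_approx ::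
    "(real \<Rightarrow> 'a \<Rightarrow> real) \<Rightarrow> (real \<Rightarrow> 'a \<Rightarrow> real) \<Rightarrow> real \<Rightarrow> real \<Rightarrow> 'a \<Rightarrow> real" where
  "covariation_approx X Y \<epsilon> t \<omega> =
     1 / \<epsilon> * (LINT s:{0..t}|lborel.
       (extend X (s + \<epsilon>) \<omega> - extend X s \<omega>) * (extend Y (s + \<epsilon>) \<omega> - extend Y s \<omega>))"

text \<open>
  Convergence in probability, uniformly in \<open>t \<in> {0..1}\<close>, as \<open>\<epsilon>\<close> decreases to 0.  The event
  says that the supremum over \<open>t\<close> of \<open>\<bar>Z \<epsilon> t \<omega> - A t \<omega>\<bar>\<close> exceeds \<open>\<delta>\<close>.  The limit has to be
  one-sided: replacing \<open>\<epsilon>\<close> by \<open>-\<epsilon>\<close> in \<open>covariation_approx\<close> changes the sign of the limit,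
  so that a two-sided limit could only be 0.
\<close>

definition ucp_limit ::
    "'a measure \<Rightarrow> (real \<Rightarrow> real \<Rightarrow> 'a \<Rightarrow> real) \<Rightarrow> (real \<Rightarrow> 'a \<Rightarrow> real) \<Rightarrow> bool" where
  "ucp_limit M Z A \<longleftrightarrow>
     (\<forall>\<delta>>0. ((\<lambda>\<epsilon>. measure M {\<omega>\<in>space M. \<exists>t\<in>{0..1}. \<bar>Z \<epsilon> t \<omega> - A t \<omega>\<bar> > \<delta>}) \<longlongrightarrow> 0) (at_right 0))"

text \<open>
  \<open>has_covariation M X Y A\<close> says that \<open>[X,Y]\<close> exists and equals \<open>A\<close>.  A ucp limit of continuous
  processes has a continuous version, so requiring \<open>A\<close> to be continuous loses nothing.
\<close>

definition has_covariation ::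
    "'a measure \<Rightarrow> (real \<Rightarrow> 'a \<Rightarrow> real) \<Rightarrow> (real \<Rightarrow> 'a \<Rightarrow> real) \<Rightarrow> (real \<Rightarrow> 'a \<Rightarrow> real) \<Rightarrow> bool" where
  "has_covariation M X Y A \<longleftrightarrow>
     continuous_process M X \<and> continuous_process M Y \<and> continuous_process M A \<and>
     ucp_limit M (covariation_approx X Y) A"

definition finite_quadratic_variation :: "'a measure \<Rightarrow> (real \<Rightarrow> 'a \<Rightarrow> real) \<Rightarrow> bool" where
  "finite_quadratic_variation M X \<longleftrightarrow> (\<exists>A. has_covariation M X X A)"

definition weak_dirichlet ::
    "'a measure \<Rightarrow> (real \<Rightarrow> 'a measure) \<Rightarrow> (real \<Rightarrow> 'a \<Rightarrow> real) \<Rightarrow> bool" where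
  "weak_dirichlet M F D \<longleftrightarrow>
     (\<exists>L Q. continuous_local_martingale M F L \<and> continuous_process M Q \<and>
        (\<forall>N. continuous_local_martingale M F N \<longrightarrow> has_covariation M Q N (\<lambda>_ _. 0)) \<and>
        process_sum M D L Q)"

end

theory Submission
  imports Defs
begin

text \<open>
Write \<open>[X,Y]\<close> for the covariation by regularization and \<open>QV\<^sub>\<epsilon>(X)\<close> for the approximation of \<open>[X,X]\<close> at
time 1. The two directions rest on one principle: with respect to the Brownian filtration, every
continuous local martingale \<open>L\<close> can be replaced by a stochastic integral \<open>N\<close> of a step process
against \<open>W\<close>, a \<^emph>\<open>simple process\<close>, in such a way that \<open>QV\<^sub>\<epsilon>(L - N)\<close> is small in probability,
uniformly in \<open>\<epsilon>\<close> (\<open>local_martingale_approximation\<close>). By a Cauchy--Schwarz type inequality,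
\<open>[X,L]\<close> is then close to \<open>[X,N]\<close> for every \<open>X\<close> whose \<open>QV\<^sub>\<epsilon>(X)\<close> is bounded in probability as
\<open>\<epsilon>\<close> tends to 0, and covariations with simple processes are read off from \<open>[X,W]\<close>.

If \<open>D = L + Q\<close> with \<open>[Q,W] = 0\<close> and \<open>Q\<close> of finite quadratic variation, then \<open>[Q,N] = 0\<close> for simple
\<open>N\<close>, hence \<open>[Q,L'] = 0\<close> for every local martingale \<open>L'\<close>, so \<open>D\<close> is weak Dirichlet. Conversely, if
\<open>D = L + Q\<close> with \<open>Q\<close> orthogonal to all local martingales, then \<open>[Q,W] = 0\<close> because \<open>W\<close> is one of
them, \<open>Q = D - L\<close> is adapted, and \<open>[Q,Q] = [D,D] - [L,L]\<close> exists as soon as \<open>[L,L]\<close> does. The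
existence of \<open>[L,L]\<close> follows from the principle too: \<open>[W,W]\<^sub>t = t\<close> gives \<open>[N,N']\<close> for simple \<open>N\<close> and
\<open>N'\<close>, and passing to the limit first in one and then in the other argument gives \<open>[L,L]\<close>.

The approximation has two ingredients.

\<^item> An estimate for a continuous martingale \<open>X\<close> that is merely integrable: the probability that
  \<open>QV\<^sub>\<epsilon>(X)\<close> exceeds \<open>\<delta>\<close> is at most \<open>(1 + 4 / \<delta>) E\<bar>X\<^sub>1\<bar>\<close>, for all \<open>\<epsilon>\<close>
  (\<open>martingale_quadratic_variation_tail\<close>). On the event that \<open>\<bar>X\<bar>\<close> stays below 1, squared
  increments are dominated by the increments of the submartingale \<open>\<phi>(X)\<close> minus a martingale part,
  where \<open>\<phi>\<close> is quadratic near 0 and of linear growth; the complementary event is handled by Doob's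
  maximal inequality.

\<^item> A weak form of the martingale representation theorem: the terminal values of simple processes
  are dense in \<open>L\<^sup>1\<close> of the Brownian sigma-algebra (\<open>approximable_H1\<close>). It suffices to obtain
  bounded functions of finitely many values of \<open>W\<close>, and these come from cosines, for which the
  martingale \<open>exp(\<theta>\<^sup>2 t / 2) cos(\<theta> W\<^sub>t + \<alpha>)\<close> is explicitly a limit of simple processes
  (\<open>cosine_martingale_step\<close>).

Together they bound \<open>QV\<^sub>\<epsilon>(L\<^sup>\<tau> - L\<^sub>0 - N)\<close> by the \<open>L\<^sup>1\<close> distance of the terminal values, where \<open>\<tau>\<close> is
one of the localizing times, taken so late that it reaches 1 with probability near 1.
\<close>

section \<open>Paths: increments, Riemann sums and stopping\<close>

definition path_cov :: "(real \<Rightarrow> real) \<Rightarrow> (real \<Rightarrow> real) \<Rightarrow> real \<Rightarrow> real \<Rightarrow> real" where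
  "path_cov f g \<epsilon> t = 1 / \<epsilon> * integral {0..t} (\<lambda>s. (f (s + \<epsilon>) - f s) * (g (s + \<epsilon>) - g s))"

lemma continuous_increment:
  fixes f :: "real \<Rightarrow> real"
  assumes "continuous_on UNIV f"
  shows "continuous_on S (\<lambda>s. f (s + \<epsilon>) - f s)"
proof -
  have "continuous_on S (\<lambda>s. f (s + \<epsilon>))"
    by (rule continuous_on_compose2[OF assms]) (auto intro!: continuous_intros)
  moreover have "continuous_on S f" using assms continuous_on_subset by blast
  ultimately show ?thesis by (intro continuous_on_diff)
qed

lemma integrable_increments:
  fixes f g :: "real \<Rightarrow> real"
  assumes "continuous_on UNIV f" "continuous_on UNIV g"
  shows "(\<lambda>s. (f (s + \<epsilon>) - f s) * (g (s + \<epsilon>) - g s)) integrable_on {a..b}"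
  by (intro integrable_continuous_real continuous_on_mult continuous_increment assms)

lemma path_cov_commute: "path_cov f g \<epsilon> t = path_cov g f \<epsilon> t"
  by (simp add: path_cov_def mult.commute)

lemma path_cov_add:
  assumes "continuous_on UNIV f" "continuous_on UNIV f'" "continuous_on UNIV g"
  shows "path_cov f g \<epsilon> t + path_cov f' g \<epsilon> t = path_cov (\<lambda>t. f t + f' t) g \<epsilon> t"
proof -
  have "integral {0..t} (\<lambda>s. ((f (s + \<epsilon>) + f' (s+\<epsilon>)) - (f s + f' s)) * (g (s + \<epsilon>) - g s))
     = integral {0..t} (\<lambda>s. (f (s + \<epsilon>) - f s) * (g (s + \<epsilon>) - g s) + (f' (s + \<epsilon>) - f' s) * (g (s + \<epsilon>) - g s))"
    by (simp add: algebra_simps)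
  also have "\<dots> = integral {0..t} (\<lambda>s. (f (s + \<epsilon>) - f s) * (g (s + \<epsilon>) - g s)) +
      integral {0..t} (\<lambda>s. (f' (s + \<epsilon>) - f' s) * (g (s + \<epsilon>) - g s))"
    by (intro Henstock_Kurzweil_Integration.integral_add integrable_increments assms)
  finally show ?thesis by (simp add: path_cov_def algebra_simps add_divide_distrib)
qed

lemma path_cov_cmult: "path_cov (\<lambda>t. c * f t) g \<epsilon> t = c * path_cov f g \<epsilon> t"
proof -
  have "(\<lambda>s. (c * f (s + \<epsilon>) - c * f s) * (g (s + \<epsilon>) - g s)) =
    (\<lambda>s. c * ((f (s + \<epsilon>) - f s) * (g (s + \<epsilon>) - g s)))"
    by (auto simp: algebra_simps)
  then show ?thesis by (simp add: path_cov_def)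
qed

lemma path_cov_diff:
  assumes "continuous_on UNIV f" "continuous_on UNIV f'" "continuous_on UNIV g"
  shows "path_cov (\<lambda>t. f t - f' t) g \<epsilon> t = path_cov f g \<epsilon> t - path_cov f' g \<epsilon> t"
  using path_cov_add[of f "\<lambda>t. (-1) * f' t" g \<epsilon> t] path_cov_cmult[of "-1" f' g \<epsilon> t] assms
  by (simp add: continuous_on_minus)

lemma path_cov_mono:
  assumes "continuous_on UNIV f" "0 < \<epsilon>" "s \<le> t"
  shows "path_cov f f \<epsilon> s \<le> path_cov f f \<epsilon> t"
  unfolding path_cov_def
proof (rule mult_left_mono)
  show "integral {0..s} (\<lambda>s. (f (s + \<epsilon>) - f s) * (f (s + \<epsilon>) - f s))
    \<le> integral {0..t} (\<lambda>s. (f (s + \<epsilon>) - f s) * (f (s + \<epsilon>) - f s))"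
    by (rule integral_subset_le[OF _ integrable_increments integrable_increments])
      (simp_all add: assms)
qed (use assms in auto)

lemma path_cov_nonneg:
  assumes "continuous_on UNIV f" "0 < \<epsilon>"
  shows "0 \<le> path_cov f f \<epsilon> t"
  unfolding path_cov_def
  by (intro mult_nonneg_nonneg integral_nonneg integrable_increments assms zero_le_square) (simp add: less_imp_le assms)

text \<open>
The inequality \<open>\<bar>x y\<bar> \<le> \<kappa> x\<^sup>2 + y\<^sup>2 / \<kappa>\<close> under the integral plays the role of the Cauchy--Schwarz
inequality. It is used with the quadratic variation of \<open>f\<close> bounded and that of \<open>g\<close> small: a small
\<open>\<kappa>\<close> takes care of the first term, and then the second is small as well.
\<close>

lemma abs_path_cov_le:
  assumes f: "continuous_on UNIV f" and g: "continuous_on UNIV g" and "0 < \<epsilon>" "t \<le> 1" "0 < \<kappa>"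
  shows "\<bar>path_cov f g \<epsilon> t\<bar> \<le> \<kappa> * path_cov f f \<epsilon> 1 + path_cov g g \<epsilon> 1 / \<kappa>"
proof -
  have q: "\<bar>x * y\<bar> \<le> \<kappa> * (x * x) + (1 / \<kappa>) * (y * y)" for x y :: real
  proof -
    have "0 \<le> (\<kappa> * \<bar>x\<bar> - \<bar>y\<bar>)\<^sup>2 / \<kappa>" using assms by simp
    also have "\<dots> = \<kappa> * (x * x) + (1 / \<kappa>) * (y * y) - 2 * \<bar>x * y\<bar>"
      using assms by (simp add: power2_eq_square field_simps abs_mult)
    finally show ?thesis using abs_ge_zero[of "x * y"] by linarith
  qed
  define F where "F = (\<lambda>s. (f (s + \<epsilon>) - f s) * (f (s + \<epsilon>) - f s))"
  define G where "G = (\<lambda>s. (g (s + \<epsilon>) - g s) * (g (s + \<epsilon>) - g s))"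
  have i: "F integrable_on {0..t}" "G integrable_on {0..t}"
    unfolding F_def G_def by (intro integrable_increments f g)+
  have ic: "(\<lambda>s. c * F s) integrable_on {0..t}" "(\<lambda>s. c * G s) integrable_on {0..t}" for c
    using integrable_cmul[OF i(1), of c] integrable_cmul[OF i(2), of c] by simp_all
  have "\<bar>integral {0..t} (\<lambda>s. (f (s + \<epsilon>) - f s) * (g (s + \<epsilon>) - g s))\<bar>
    \<le> integral {0..t} (\<lambda>s. \<kappa> * F s + (1 / \<kappa>) * G s)"
    unfolding real_norm_def[symmetric]
    apply (rule integral_norm_bound_integral)
    subgoal by (intro integrable_increments f g)
    subgoal by (intro integrable_add ic)
    subgoal using q by (simp add: F_def G_def)
    done
  also have "\<dots> = \<kappa> * integral {0..t} F + (1 / \<kappa>) * integral {0..t} G"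
    by (subst Henstock_Kurzweil_Integration.integral_add) (rule ic, rule ic, simp)
  finally have "\<bar>path_cov f g \<epsilon> t\<bar> \<le> 1 / \<epsilon> * (\<kappa> * integral {0..t} F + (1 / \<kappa>) * integral {0..t} G)"
    using assms by (simp add: path_cov_def abs_mult divide_right_mono)
  also have "\<dots> = \<kappa> * path_cov f f \<epsilon> t + path_cov g g \<epsilon> t / \<kappa>"
    using assms by (simp add: path_cov_def F_def G_def field_simps)
  also have "\<dots> \<le> \<kappa> * path_cov f f \<epsilon> 1 + path_cov g g \<epsilon> 1 / \<kappa>"
    using assms by (intro add_mono mult_left_mono divide_right_mono path_cov_mono) auto
  finally show ?thesis .
qed

text \<open>
By the parallelogram identity, both sides differ by the quadratic variation of \<open>f - g\<close>.
\<close>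

lemma path_cov_add_square_le:
  assumes f: "continuous_on UNIV f" and g: "continuous_on UNIV g" and "0 < \<epsilon>" "t \<le> 1"
  shows "path_cov (\<lambda>s. f s + g s) (\<lambda>s. f s + g s) \<epsilon> t \<le> 2 * path_cov f f \<epsilon> t + 2 * path_cov g g \<epsilon> t"
proof -
  have fg: "continuous_on UNIV (\<lambda>s. f s - g s)" "continuous_on UNIV (\<lambda>s. f s + g s)" 
    by (intro continuous_intros f g)+
  have "path_cov (\<lambda>s. f s + g s) (\<lambda>s. f s + g s) \<epsilon> t = path_cov f f \<epsilon> t + 2 * path_cov f g \<epsilon> t + path_cov g g \<epsilon> t"
    using path_cov_add[OF f g fg(2), of \<epsilon> t] path_cov_add[OF f g f, of \<epsilon> t] path_cov_add[OF f g g, of \<epsilon> t]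
    by (simp add: path_cov_commute)
  moreover have "path_cov (\<lambda>s. f s - g s) (\<lambda>s. f s - g s) \<epsilon> t = path_cov f f \<epsilon> t - 2 * path_cov f g \<epsilon> t + path_cov g g \<epsilon> t"
    using path_cov_diff[OF f g fg(1), of \<epsilon> t] path_cov_diff[OF f g f, of \<epsilon> t] path_cov_diff[OF f g g, of \<epsilon> t]
    by (simp add: path_cov_commute)
  ultimately show ?thesis using path_cov_nonneg[OF fg(1), of \<epsilon> t] assms by linarith
qed

lemma continuous_on_path_cov:
  assumes "continuous_on UNIV f" "continuous_on UNIV g"
  shows "continuous_on {0..1} (path_cov f g \<epsilon>)"
  unfolding path_cov_def[abs_def]
  by (intro continuous_on_mult continuous_on_const indefinite_integral_continuous_1 integrable_increments assms)

text \<open>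
Time integrals are estimated in probability through their Riemann sums, which turns statements
about them into statements about finite sums of random variables.
\<close>

lemma riemann_sums_tendsto_integral:
  fixes f :: "real \<Rightarrow> real"
  assumes f: "continuous_on UNIV f" and t: "0 \<le> t"
  shows "(\<lambda>n. t / real n * (\<Sum>k<n. f (real k * (t / real n)))) \<longlonglongrightarrow> integral {0..t} f"
proof (rule LIMSEQ_I)
  fix r :: real assume r: "0 < r"
  have fi: "f integrable_on {a..b}" for a b
    by (intro integrable_continuous_real continuous_on_subset[OF f]) auto
  define e where "e = r / (2 * (t + 1))"
  have e: "0 < e" using r t by (simp add: e_def)
  have "e * t = r * (t / (2 * (t + 1)))" by (simp add: e_def)
  also have "\<dots> < r * 1" using r t by (intro mult_strict_left_mono) auto
  finally have et: "e * t < r" by simp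
  have "uniformly_continuous_on {0..t} f"
    by (intro compact_uniformly_continuous continuous_on_subset[OF f]) auto
  then obtain d where d: "0 < d" "\<And>x y. x \<in> {0..t} \<Longrightarrow> y \<in> {0..t} \<Longrightarrow> dist x y < d \<Longrightarrow> dist (f x) (f y) < e"
    unfolding uniformly_continuous_on_def using e by metis
  obtain N :: nat where N: "t / d < real N" using reals_Archimedean2 by blast
  show "\<exists>no. \<forall>n\<ge>no. norm (t / real n * (\<Sum>k<n. f (real k * (t / real n))) - integral {0..t} f) < r"
  proof (intro exI[of _ "Suc N"] allI impI)
    fix n assume n: "Suc N \<le> n"
    define h where "h = t / real n"
    have ic: "integral {a..b} (\<lambda>x. c) = (b - a) * c" if "a \<le> b" for a b c :: real using that by simp
    have n0: "0 < n" "real N < real n" using n by auto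
    have "t < real N * d" using N d by (simp add: pos_divide_less_eq)
    also have "\<dots> \<le> real n * d" using n0 d by (intro mult_right_mono) auto
    finally have h: "0 \<le> h" "h < d" "real n * h = t"
      using n0 t by (auto simp: h_def pos_divide_less_eq mult.commute)
    have split: "integral {0..real m * h} f = (\<Sum>k<m. integral {real k * h..real (Suc k) * h} f)" for m
    proof (induction m)
      case (Suc m)
      have "integral {0..real m * h} f + integral {real m * h..real (Suc m) * h} f = integral {0..real (Suc m) * h} f"
        using h by (intro Henstock_Kurzweil_Integration.integral_combine fi) (auto simp: algebra_simps)
      then show ?case using Suc by simp
    qed simp
    have "h * (\<Sum>k<n. f (real k * h)) - integral {0..t} f = (\<Sum>k<n. h * f (real k * h) - integral {real k * h..real (Suc k) * h} f)"
      using split[of n] h by (simp add: sum_subtractf sum_distrib_left)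
    also have "norm \<dots> \<le> (\<Sum>k<n. e * h)"
    proof (rule sum_norm_le)
      fix k assume "k \<in> {..<n}"
      then have k: "real (Suc k) * h \<le> t" using h by (metis lessThan_iff Suc_leI of_nat_le_iff mult_right_mono)
      have hk: "real (Suc k) * h = real k * h + h" by (simp add: algebra_simps)
      have "h * f (real k * h) - integral {real k * h..real (Suc k) * h} f
        = integral {real k * h..real (Suc k) * h} (\<lambda>x. f (real k * h) - f x)"
        using ic[of "real k * h" "real (Suc k) * h" "f (real k * h)"] h hk
        by (subst Henstock_Kurzweil_Integration.integral_diff) (auto intro!: fi simp del: of_nat_Suc integral_const_real)
      also have "norm \<dots> \<le> e * (real (Suc k) * h - real k * h)"
      proof (rule integral_bound)
        show "continuous_on {real k * h..real (Suc k) * h} (\<lambda>x. f (real k * h) - f x)"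
          by (intro continuous_on_diff continuous_on_const continuous_on_subset[OF f]) auto
        fix x assume x: "x \<in> {real k * h..real (Suc k) * h}"
        have "dist (f (real k * h)) (f x) < e"
          using x h k hk by (intro d(2)) (auto simp: dist_real_def intro: order_trans[of 0 "real k * h"])
        then show "norm (f (real k * h) - f x) \<le> e" by (simp add: dist_norm)
      qed (use h in \<open>auto simp: algebra_simps\<close>)
      finally show "norm (h * f (real k * h) - integral {real k * h..real (Suc k) * h} f) \<le> e * h"
        unfolding hk by simp
    qed
    also have "\<dots> = e * t" using h by (simp add: algebra_simps)
    also have "\<dots> < r" by (rule et)
    finally show "norm (t / real n * (\<Sum>k<n. f (real k * (t / real n))) - integral {0..t} f) < r"
      by (simp add: h_def)
  qed
qed

definition riemann_cov :: "(real \<Rightarrow> real) \<Rightarrow> (real \<Rightarrow> real) \<Rightarrow> real \<Rightarrow> real \<Rightarrow> nat \<Rightarrow> real" where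
  "riemann_cov f g \<epsilon> t n = 1 / \<epsilon> * (t / real n *
     (\<Sum>k<n. (f (real k * (t / real n) + \<epsilon>) - f (real k * (t / real n))) *
        (g (real k * (t / real n) + \<epsilon>) - g (real k * (t / real n)))))"

lemma path_cov_riemann:
  assumes "continuous_on UNIV f" "continuous_on UNIV g" "0 \<le> t"
  shows "(\<lambda>n. riemann_cov f g \<epsilon> t n) \<longlonglongrightarrow> path_cov f g \<epsilon> t"
  unfolding path_cov_def riemann_cov_def
  by (intro tendsto_mult_left
    riemann_sums_tendsto_integral[where f="\<lambda>s. (f (s + \<epsilon>) - f s) * (g (s + \<epsilon>) - g s)"]
    continuous_on_mult continuous_increment assms)

text \<open>
After time \<open>b\<close> the stopped path has no increments, and for \<open>s \<le> b - \<epsilon>\<close> its increments are those of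
\<open>g\<close>. The two integrals differ only over \<open>b - \<epsilon> \<le> s \<le> b\<close>, an interval whose length cancels the
factor \<open>1 / \<epsilon>\<close>.
\<close>

lemma path_cov_stopped:
  assumes f: "continuous_on UNIV f" and g: "continuous_on UNIV g"
    and e: "0 < \<epsilon>" and b: "0 \<le> b" and t: "0 \<le> t"
    and of: "\<And>s. s \<in> {b - \<epsilon>..b} \<Longrightarrow> \<bar>f (s + \<epsilon>) - f s\<bar> \<le> \<eta>"
    and og: "\<And>s. s \<in> {b..b + \<epsilon>} \<Longrightarrow> \<bar>g s - g b\<bar> \<le> \<eta>"
  shows "\<bar>path_cov f (\<lambda>s. g (min s b)) \<epsilon> t - path_cov f g \<epsilon> (min t b)\<bar> \<le> \<eta> * \<eta>"
proof -
  define gb where "gb = (\<lambda>s. g (min s b))"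
  have gb: "continuous_on UNIV gb" unfolding gb_def
    by (rule continuous_on_compose2[OF g]) (auto intro!: continuous_intros)
  define c where "c = min t b"
  define F where "F = (\<lambda>s. (f (s + \<epsilon>) - f s) * (gb (s + \<epsilon>) - gb s))"
  define G where "G = (\<lambda>s. (f (s + \<epsilon>) - f s) * (g (s + \<epsilon>) - g s))"
  have eta: "0 \<le> \<eta>" using og[of b] e by auto
  have c: "0 \<le> c" "c \<le> t" "c \<le> b" using b t by (auto simp: c_def)
  have I: "F integrable_on {x..y}" "G integrable_on {x..y}" for x y
    unfolding F_def G_def by (intro integrable_increments f g gb)+
  have "integral {c..t} F = 0"
  proof (cases "c = t")
    case False
    then have "c = b" by (auto simp: c_def)
    then have "integral {c..t} F = integral {c..t} (\<lambda>s. 0)"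
      by (intro integral_cong) (use e in \<open>auto simp: F_def gb_def min_def\<close>)
    then show ?thesis by simp
  qed simp
  with Henstock_Kurzweil_Integration.integral_combine[OF c(1,2) I(1)]
  have 1: "integral {0..t} F = integral {0..c} F" by simp
  define a where "a = min c (max 0 (b - \<epsilon>))"
  have a: "0 \<le> a" "a \<le> c" "c - a \<le> \<epsilon>" using c e by (auto simp: a_def)
  have 2: "integral {0..a} F = integral {0..a} G"
  proof (cases "a = 0")
    case False
    then have "s + \<epsilon> \<le> b" if "s \<le> a" for s using that c by (auto simp: a_def)
    then show ?thesis using e a c
      by (intro integral_cong) (auto simp: F_def G_def gb_def min_def)
  qed simp
  have "integral {0..t} F - integral {0..c} G = integral {a..c} F - integral {a..c} G"
    using 1 2 Henstock_Kurzweil_Integration.integral_combine[OF a(1,2) I(1)]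
       Henstock_Kurzweil_Integration.integral_combine[OF a(1,2) I(2)] by simp
  also have "\<dots> = integral {a..c} (\<lambda>s. F s - G s)"
    by (intro Henstock_Kurzweil_Integration.integral_diff[symmetric] I)
  also have "norm \<dots> \<le> \<eta> * \<eta> * (c - a)"
  proof (rule integral_bound)
    show "continuous_on {a..c} (\<lambda>s. F s - G s)" unfolding F_def G_def
      by (intro continuous_on_diff continuous_on_mult continuous_increment f g gb)
    fix s assume s: "s \<in> {a..c}"
    show "norm (F s - G s) \<le> \<eta> * \<eta>"
    proof (cases "s + \<epsilon> \<le> b")
      case True
      then show ?thesis using e eta by (simp add: F_def G_def gb_def min_def)
    next
      case False
      have sb: "s \<le> b" using s c by auto
      have "F s - G s = (f (s + \<epsilon>) - f s) * (g b - g (s + \<epsilon>))"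
        using False sb by (simp add: F_def G_def gb_def min_def algebra_simps)
      moreover have "\<bar>f (s + \<epsilon>) - f s\<bar> \<le> \<eta>" "\<bar>g b - g (s + \<epsilon>)\<bar> \<le> \<eta>"
        using of[of s] og[of "s + \<epsilon>"] False sb by (auto simp: abs_minus_commute)
      ultimately show ?thesis by (simp add: abs_mult mult_mono' eta)
    qed
  qed (use a in auto)
  also have "\<dots> \<le> \<eta> * \<eta> * \<epsilon>" using a eta by (intro mult_left_mono) auto
  finally have "\<bar>integral {0..t} F - integral {0..c} G\<bar> \<le> \<eta> * \<eta> * \<epsilon>" by simp
  then have "\<bar>1 / \<epsilon> * (integral {0..t} F - integral {0..c} G)\<bar> \<le> \<eta> * \<eta>"
    using e by (simp add: abs_mult pos_divide_le_eq)
  then show ?thesis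
    by (simp add: path_cov_def F_def G_def gb_def c_def right_diff_distrib)
qed

section \<open>Convergence uniformly on compacts in probability\<close>

text \<open>
The event whose probability is required to vanish in \<open>ucp_limit\<close>.
\<close>

definition exceed :: "'a measure \<Rightarrow> (real \<Rightarrow> 'a \<Rightarrow> real) \<Rightarrow> real \<Rightarrow> 'a set" where
  "exceed M U \<delta> = {\<omega>\<in>space M. \<exists>t\<in>{0..1}. \<bar>U t \<omega>\<bar> > \<delta>}"

lemma continuous_processD:
  assumes "continuous_process M X"
  shows "t \<in> {0..1} \<Longrightarrow> X t \<in> borel_measurable M"
    and "\<omega> \<in> space M \<Longrightarrow> continuous_on {0..1} (\<lambda>t. X t \<omega>)"
  using assms by (auto simp: continuous_process_def)

lemma continuous_process_const: "c \<in> borel_measurable M \<Longrightarrow> continuous_process M (\<lambda>_. c)"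
  by (auto simp: continuous_process_def)

lemma continuous_process_add:
  "continuous_process M X \<Longrightarrow> continuous_process M Y \<Longrightarrow> continuous_process M (\<lambda>t \<omega>. X t \<omega> + Y t \<omega>)"
  by (auto simp: continuous_process_def intro!: borel_measurable_add continuous_on_add)

lemma continuous_process_diff:
  "continuous_process M X \<Longrightarrow> continuous_process M Y \<Longrightarrow> continuous_process M (\<lambda>t \<omega>. X t \<omega> - Y t \<omega>)"
  by (auto simp: continuous_process_def intro!: borel_measurable_diff continuous_on_diff)

lemma continuous_process_cmult:
  "\<xi> \<in> borel_measurable M \<Longrightarrow> continuous_process M X \<Longrightarrow> continuous_process M (\<lambda>t \<omega>. \<xi> \<omega> * X t \<omega>)"
  by (auto simp: continuous_process_def intro!: borel_measurable_times continuous_on_mult)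

lemma continuous_process_stop:
  assumes X: "continuous_process M X" and b: "b \<in> {0..1}"
  shows "continuous_process M (\<lambda>t. X (min t b))"
  unfolding continuous_process_def
proof (intro conjI ballI)
  show "X (min t b) \<in> borel_measurable M" if "t \<in> {0..1}" for t
    using that b by (intro continuous_processD[OF X]) (auto simp: min_def)
  show "continuous_on {0..1} (\<lambda>t. X (min t b) \<omega>)" if "\<omega> \<in> space M" for \<omega>
    by (rule continuous_on_compose2[OF continuous_processD(2)[OF X that]])
      (use b in \<open>auto intro!: continuous_intros\<close>)
qed

lemma continuous_on_extend:
  assumes "continuous_process M X" "\<omega> \<in> space M"
  shows "continuous_on UNIV (\<lambda>t. extend X t \<omega>)"
  unfolding extend_def
  by (rule continuous_on_compose2[OF continuous_processD(2)[OF assms]]) (auto intro!: continuous_intros)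

lemma measurable_extend:
  assumes "continuous_process M X"
  shows "extend X t \<in> borel_measurable M"
  unfolding extend_def by (rule continuous_processD[OF assms]) auto

lemma covariation_approx_eq_path_cov:
  assumes "continuous_process M X" "continuous_process M Y" "\<omega> \<in> space M"
  shows "covariation_approx X Y \<epsilon> t \<omega> = path_cov (\<lambda>s. extend X s \<omega>) (\<lambda>s. extend Y s \<omega>) \<epsilon> t"
  unfolding covariation_approx_def path_cov_def
  by (subst set_borel_integral_eq_integral)
    (auto intro!: borel_integrable_atLeastAtMost' continuous_on_mult continuous_increment
       continuous_on_extend[OF assms(1,3)] continuous_on_extend[OF assms(2,3)])

lemma measurable_riemann_cov:
  assumes X: "continuous_process M X" and Y: "continuous_process M Y"
  shows "(\<lambda>\<omega>. riemann_cov (\<lambda>s. extend X s \<omega>) (\<lambda>s. extend Y s \<omega>) \<epsilon> t n) \<in> borel_measurable M"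
  unfolding riemann_cov_def using measurable_extend[OF X] measurable_extend[OF Y]
  by (intro borel_measurable_times borel_measurable_const borel_measurable_sum borel_measurable_diff)

lemma continuous_process_covariation_approx:
  assumes X: "continuous_process M X" and Y: "continuous_process M Y"
  shows "continuous_process M (covariation_approx X Y \<epsilon>)"
  unfolding continuous_process_def
proof (intro conjI ballI)
  fix t :: real assume t: "t \<in> {0..1}"
  show "covariation_approx X Y \<epsilon> t \<in> borel_measurable M"
  proof (rule borel_measurable_LIMSEQ_real[OF _ measurable_riemann_cov[OF X Y]])
    fix \<omega> assume w: "\<omega> \<in> space M"
    show "(\<lambda>n. riemann_cov (\<lambda>s. extend X s \<omega>) (\<lambda>s. extend Y s \<omega>) \<epsilon> t n) \<longlonglongrightarrow> covariation_approx X Y \<epsilon> t \<omega>"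
      unfolding covariation_approx_eq_path_cov[OF X Y w] using t
      by (intro path_cov_riemann continuous_on_extend[OF X w] continuous_on_extend[OF Y w]) auto
  qed
next
  fix \<omega> assume w: "\<omega> \<in> space M"
  show "continuous_on {0..1} (\<lambda>t. covariation_approx X Y \<epsilon> t \<omega>)"
    unfolding covariation_approx_eq_path_cov[OF X Y w]
    by (rule continuous_on_path_cov[OF continuous_on_extend[OF X w] continuous_on_extend[OF Y w]])
qed

text \<open>
For continuous paths it is enough to look at rational times.
\<close>

lemma exceed_sets:
  assumes U: "continuous_process M U"
  shows "exceed M U \<delta> \<in> sets M"
proof -
  have "exceed M U \<delta> = (\<Union>q\<in>\<rat> \<inter> {0..1}. {\<omega>\<in>space M. \<bar>U q \<omega>\<bar> > \<delta>})"
  proof (intro equalityI subsetI)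
    fix \<omega> assume "\<omega> \<in> exceed M U \<delta>"
    then obtain t where w: "\<omega> \<in> space M" and t: "t \<in> {0..1}" "\<bar>U t \<omega>\<bar> > \<delta>"
      by (auto simp: exceed_def)
    have c: "continuous_on {0..1} (\<lambda>t. \<bar>U t \<omega>\<bar>)"
      using continuous_processD(2)[OF U w] by (intro continuous_intros)
    \<comment> \<open>the clipped path is continuous on the whole line, so the exceedance persists on an open set\<close>
    have c': "continuous_on UNIV (\<lambda>t. \<bar>U (min (max t 0) 1) \<omega>\<bar>)"
      by (rule continuous_on_compose2[OF c]) (auto intro!: continuous_intros)
    then have "open ((\<lambda>t. \<bar>U (min (max t 0) 1) \<omega>\<bar>) -` {\<delta><..})"
      by (intro open_vimage) auto
    moreover have "t \<in> (\<lambda>t. \<bar>U (min (max t 0) 1) \<omega>\<bar>) -` {\<delta><..}" using t by (auto simp: max_absorb1 min_absorb1)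
    ultimately obtain e where e: "0 < e" "ball t e \<subseteq> (\<lambda>t. \<bar>U (min (max t 0) 1) \<omega>\<bar>) -` {\<delta><..}"
      using open_contains_ball by blast
    have "max 0 (t - e) < min 1 (t + e)" using t e by auto
    then obtain q where q: "q \<in> \<rat>" "max 0 (t - e) < q" "q < min 1 (t + e)"
      using Rats_dense_in_real by blast
    then have "q \<in> ball t e" by (auto simp: dist_real_def)
    with e have "\<bar>U (min (max q 0) 1) \<omega>\<bar> > \<delta>" by blast
    moreover have "min (max q 0) 1 = q" using q by auto
    ultimately show "\<omega> \<in> (\<Union>q\<in>\<rat> \<inter> {0..1}. {\<omega>\<in>space M. \<bar>U q \<omega>\<bar> > \<delta>})" using q w by auto
  qed (auto simp: exceed_def)
  also have "\<dots> \<in> sets M"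
  proof (rule sets.countable_UN'')
    show "countable (\<rat> \<inter> {0..1} :: real set)" using countable_rat by blast
    fix q :: real assume "q \<in> \<rat> \<inter> {0..1}"
    then have [measurable]: "U q \<in> borel_measurable M" using continuous_processD[OF U] by auto
    show "{\<omega>\<in>space M. \<bar>U q \<omega>\<bar> > \<delta>} \<in> sets M" by measurable
  qed
  finally show ?thesis .
qed

lemma exceed_antimono: "\<delta> \<le> \<delta>' \<Longrightarrow> exceed M U \<delta>' \<subseteq> exceed M U \<delta>"
  unfolding exceed_def by (auto intro: order.strict_trans1)

lemma exceed_triangle:
  assumes "\<And>t \<omega>. t \<in> {0..1} \<Longrightarrow> \<omega> \<in> space M \<Longrightarrow> \<bar>U t \<omega>\<bar> \<le> \<bar>V t \<omega>\<bar> + \<bar>V' t \<omega>\<bar>"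
  shows "exceed M U (\<delta> + \<delta>') \<subseteq> exceed M V \<delta> \<union> exceed M V' \<delta>'"
proof
  fix \<omega> assume "\<omega> \<in> exceed M U (\<delta> + \<delta>')"
  then obtain t where t: "\<omega> \<in> space M" "t \<in> {0..1}" "\<bar>U t \<omega>\<bar> > \<delta> + \<delta>'" by (auto simp: exceed_def)
  with assms[of t \<omega>] have "\<bar>V t \<omega>\<bar> > \<delta> \<or> \<bar>V' t \<omega>\<bar> > \<delta>'" by linarith
  with t show "\<omega> \<in> exceed M V \<delta> \<union> exceed M V' \<delta>'" by (auto simp: exceed_def)
qed

lemma eventually_at_right_0_01: "eventually (\<lambda>\<epsilon>::real. 0 < \<epsilon> \<and> \<epsilon> < 1) (at_right 0)"
  using eventually_at_right_real[of 0 1] by (simp add: greaterThanLessThan_iff)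

context prob_space
begin

lemma prob_exceed_triangle:
  assumes "continuous_process M V" "continuous_process M V'"
    and "\<And>t \<omega>. t \<in> {0..1} \<Longrightarrow> \<omega> \<in> space M \<Longrightarrow> \<bar>U t \<omega>\<bar> \<le> \<bar>V t \<omega>\<bar> + \<bar>V' t \<omega>\<bar>"
  shows "prob (exceed M U (\<delta> + \<delta>')) \<le> prob (exceed M V \<delta>) + prob (exceed M V' \<delta>')"
proof -
  have "exceed M U (\<delta> + \<delta>') \<subseteq> exceed M V \<delta> \<union> exceed M V' \<delta>'"
    by (rule exceed_triangle) (rule assms(3))
  then have "prob (exceed M U (\<delta> + \<delta>')) \<le> prob (exceed M V \<delta> \<union> exceed M V' \<delta>')"
    by (rule finite_measure_mono) (intro sets.Un exceed_sets assms)
  also have "\<dots> \<le> prob (exceed M V \<delta>) + prob (exceed M V' \<delta>')"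
    by (intro measure_Un_le exceed_sets assms)
  finally show ?thesis .
qed

lemma ucp_limit_iff_exceed:
  "ucp_limit M Z A \<longleftrightarrow>
    (\<forall>\<delta>>0. ((\<lambda>\<epsilon>. prob (exceed M (\<lambda>t \<omega>. Z \<epsilon> t \<omega> - A t \<omega>) \<delta>)) \<longlongrightarrow> 0) (at_right 0))"
  by (simp add: ucp_limit_def exceed_def)

lemma ucp_limitD:
  assumes "ucp_limit M Z A" "0 < \<delta>" "0 < \<eta>"
  shows "\<forall>\<^sub>F \<epsilon> in at_right 0. prob (exceed M (\<lambda>t \<omega>. Z \<epsilon> t \<omega> - A t \<omega>) \<delta>) < \<eta>"
  using assms order_tendstoD(2) unfolding ucp_limit_iff_exceed by blast

text \<open>
The events increase as \<open>\<delta>\<close> decreases, so a single small number can bound both the distance and the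
probability.
\<close>

lemma ucp_limitI:
  assumes "\<And>\<delta>. 0 < \<delta> \<Longrightarrow> \<forall>\<^sub>F \<epsilon> in at_right 0. prob (exceed M (\<lambda>t \<omega>. Z \<epsilon> t \<omega> - A t \<omega>) \<delta>) < \<delta>"
    and Z: "\<And>\<epsilon>. 0 < \<epsilon> \<Longrightarrow> continuous_process M (Z \<epsilon>)" and A: "continuous_process M A"
  shows "ucp_limit M Z A"
  unfolding ucp_limit_iff_exceed
proof (intro allI impI tendstoI)
  fix \<delta> r :: real assume "0 < \<delta>" "0 < r"
  then have "0 < min \<delta> r" by simp
  with assms(1) have "\<forall>\<^sub>F \<epsilon> in at_right 0. prob (exceed M (\<lambda>t \<omega>. Z \<epsilon> t \<omega> - A t \<omega>) (min \<delta> r)) < min \<delta> r"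
    by blast
  then show "\<forall>\<^sub>F \<epsilon> in at_right 0. dist (prob (exceed M (\<lambda>t \<omega>. Z \<epsilon> t \<omega> - A t \<omega>) \<delta>)) 0 < r"
    using eventually_at_right_0_01
  proof eventually_elim
    case (elim \<epsilon>)
    have "prob (exceed M (\<lambda>t \<omega>. Z \<epsilon> t \<omega> - A t \<omega>) \<delta>) \<le> prob (exceed M (\<lambda>t \<omega>. Z \<epsilon> t \<omega> - A t \<omega>) (min \<delta> r))"
      using elim by (intro finite_measure_mono exceed_antimono exceed_sets continuous_process_diff Z A) auto
    with elim show ?case by simp
  qed
qed

lemma ucp_limit_cong:
  assumes "\<And>\<epsilon> t \<omega>. 0 < \<epsilon> \<Longrightarrow> t \<in> {0..1} \<Longrightarrow> \<omega> \<in> space M \<Longrightarrow> Z \<epsilon> t \<omega> = Z' \<epsilon> t \<omega>"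
    and "\<And>t \<omega>. t \<in> {0..1} \<Longrightarrow> \<omega> \<in> space M \<Longrightarrow> A t \<omega> = A' t \<omega>"
    and "ucp_limit M Z A"
  shows "ucp_limit M Z' A'"
  unfolding ucp_limit_iff_exceed
proof (intro allI impI)
  fix \<delta> :: real assume "0 < \<delta>"
  with assms(3) have "((\<lambda>\<epsilon>. prob (exceed M (\<lambda>t \<omega>. Z \<epsilon> t \<omega> - A t \<omega>) \<delta>)) \<longlongrightarrow> 0) (at_right 0)"
    by (simp add: ucp_limit_iff_exceed)
  moreover have "\<forall>\<^sub>F \<epsilon> in at_right 0. prob (exceed M (\<lambda>t \<omega>. Z \<epsilon> t \<omega> - A t \<omega>) \<delta>) = prob (exceed M (\<lambda>t \<omega>. Z' \<epsilon> t \<omega> - A' t \<omega>) \<delta>)"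
    using eventually_at_right_0_01
  proof eventually_elim
    case (elim \<epsilon>)
    have "exceed M (\<lambda>t \<omega>. Z \<epsilon> t \<omega> - A t \<omega>) \<delta> = exceed M (\<lambda>t \<omega>. Z' \<epsilon> t \<omega> - A' t \<omega>) \<delta>"
      unfolding exceed_def using elim by (intro Collect_cong conj_cong bex_cong refl) (simp add: assms(1,2))
    then show ?case by simp
  qed
  ultimately show "((\<lambda>\<epsilon>. prob (exceed M (\<lambda>t \<omega>. Z' \<epsilon> t \<omega> - A' t \<omega>) \<delta>)) \<longlongrightarrow> 0) (at_right 0)"
    by (rule Lim_transform_eventually)
qed

lemma ucp_limit_add:
  assumes "ucp_limit M Z A" "ucp_limit M Z' A'"
    and c: "\<And>\<epsilon>. 0 < \<epsilon> \<Longrightarrow> continuous_process M (Z \<epsilon>)" "continuous_process M A"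
      "\<And>\<epsilon>. 0 < \<epsilon> \<Longrightarrow> continuous_process M (Z' \<epsilon>)" "continuous_process M A'"
  shows "ucp_limit M (\<lambda>\<epsilon> t \<omega>. Z \<epsilon> t \<omega> + Z' \<epsilon> t \<omega>) (\<lambda>t \<omega>. A t \<omega> + A' t \<omega>)"
proof (rule ucp_limitI)
  fix \<delta> :: real assume d: "0 < \<delta>"
  from d have h: "0 < \<delta> / 2" by simp
  show "\<forall>\<^sub>F \<epsilon> in at_right 0. prob (exceed M (\<lambda>t \<omega>. Z \<epsilon> t \<omega> + Z' \<epsilon> t \<omega> - (A t \<omega> + A' t \<omega>)) \<delta>) < \<delta>"
    using ucp_limitD[OF assms(1) h h] ucp_limitD[OF assms(2) h h] eventually_at_right_0_01
  proof eventually_elim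
    case (elim \<epsilon>)
    have "prob (exceed M (\<lambda>t \<omega>. Z \<epsilon> t \<omega> + Z' \<epsilon> t \<omega> - (A t \<omega> + A' t \<omega>)) (\<delta>/2 + \<delta>/2))
      \<le> prob (exceed M (\<lambda>t \<omega>. Z \<epsilon> t \<omega> - A t \<omega>) (\<delta>/2)) + prob (exceed M (\<lambda>t \<omega>. Z' \<epsilon> t \<omega> - A' t \<omega>) (\<delta>/2))"
      using elim by (intro prob_exceed_triangle continuous_process_diff c) auto
    with elim show ?case by simp
  qed
qed (auto intro!: continuous_process_add c)

lemma ucp_limit_cmult:
  assumes "ucp_limit M Z A" and xi: "\<xi> \<in> borel_measurable M" "\<And>\<omega>. \<omega> \<in> space M \<Longrightarrow> \<bar>\<xi> \<omega>\<bar> \<le> K"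
    and c: "\<And>\<epsilon>. 0 < \<epsilon> \<Longrightarrow> continuous_process M (Z \<epsilon>)" "continuous_process M A"
  shows "ucp_limit M (\<lambda>\<epsilon> t \<omega>. \<xi> \<omega> * Z \<epsilon> t \<omega>) (\<lambda>t \<omega>. \<xi> \<omega> * A t \<omega>)"
proof (rule ucp_limitI)
  fix \<delta> :: real assume d: "0 < \<delta>"
  define K' where "K' = max K 1"
  have K': "0 < K'" "K \<le> K'" by (auto simp: K'_def)
  with d have h: "0 < \<delta> / K'" by simp
  show "\<forall>\<^sub>F \<epsilon> in at_right 0. prob (exceed M (\<lambda>t \<omega>. \<xi> \<omega> * Z \<epsilon> t \<omega> - \<xi> \<omega> * A t \<omega>) \<delta>) < \<delta>"
    using ucp_limitD[OF assms(1) h d] eventually_at_right_0_01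
  proof eventually_elim
    case (elim \<epsilon>)
    have "prob (exceed M (\<lambda>t \<omega>. \<xi> \<omega> * Z \<epsilon> t \<omega> - \<xi> \<omega> * A t \<omega>) \<delta>) \<le> prob (exceed M (\<lambda>t \<omega>. Z \<epsilon> t \<omega> - A t \<omega>) (\<delta> / K'))"
    proof (intro finite_measure_mono exceed_sets continuous_process_diff c subsetI)
      fix \<omega> assume "\<omega> \<in> exceed M (\<lambda>t \<omega>. \<xi> \<omega> * Z \<epsilon> t \<omega> - \<xi> \<omega> * A t \<omega>) \<delta>"
      then obtain t where t: "\<omega> \<in> space M" "t \<in> {0..1}" "\<delta> < \<bar>\<xi> \<omega> * Z \<epsilon> t \<omega> - \<xi> \<omega> * A t \<omega>\<bar>"
        by (auto simp: exceed_def)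
      note t(3)
      also have "\<bar>\<xi> \<omega> * Z \<epsilon> t \<omega> - \<xi> \<omega> * A t \<omega>\<bar> = \<bar>\<xi> \<omega>\<bar> * \<bar>Z \<epsilon> t \<omega> - A t \<omega>\<bar>"
        by (simp add: abs_mult[symmetric] right_diff_distrib)
      also have "\<dots> \<le> K' * \<bar>Z \<epsilon> t \<omega> - A t \<omega>\<bar>"
        using xi(2)[OF t(1)] K' by (intro mult_right_mono) auto
      finally show "\<omega> \<in> exceed M (\<lambda>t \<omega>. Z \<epsilon> t \<omega> - A t \<omega>) (\<delta> / K')"
        using t K' by (auto simp: exceed_def pos_divide_less_eq mult.commute)
    qed (use elim in auto)
    with elim show ?case by simp
  qed
qed (auto intro!: continuous_process_cmult c xi)

lemma ucp_limit_stop: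
  assumes "ucp_limit M Z A" and b: "b \<in> {0..1}"
    and c: "\<And>\<epsilon>. 0 < \<epsilon> \<Longrightarrow> continuous_process M (Z \<epsilon>)" "continuous_process M A"
  shows "ucp_limit M (\<lambda>\<epsilon> t. Z \<epsilon> (min t b)) (\<lambda>t. A (min t b))"
proof (rule ucp_limitI)
  fix \<delta> :: real assume d: "0 < \<delta>"
  show "\<forall>\<^sub>F \<epsilon> in at_right 0. prob (exceed M (\<lambda>t \<omega>. Z \<epsilon> (min t b) \<omega> - A (min t b) \<omega>) \<delta>) < \<delta>"
    using ucp_limitD[OF assms(1) d d] eventually_at_right_0_01
  proof eventually_elim
    case (elim \<epsilon>)
    have "prob (exceed M (\<lambda>t \<omega>. Z \<epsilon> (min t b) \<omega> - A (min t b) \<omega>) \<delta>) \<le> prob (exceed M (\<lambda>t \<omega>. Z \<epsilon> t \<omega> - A t \<omega>) \<delta>)"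
      using elim b
      by (intro finite_measure_mono exceed_sets continuous_process_diff c)
        (fastforce simp: exceed_def)+
    with elim show ?case by simp
  qed
qed (auto intro!: continuous_process_stop c b simp del: atLeastAtMost_iff)

text \<open>
Dominated convergence for the indicators, along sequences. It turns convergence that holds for
each \<open>\<omega>\<close> separately into convergence in probability as the continuous parameter tends to 0.
\<close>

lemma tendsto_prob_eventually_avoided:
  assumes S: "\<And>\<epsilon>. 0 < \<epsilon> \<Longrightarrow> S \<epsilon> \<in> events"
    and ev: "\<And>\<omega>. \<omega> \<in> space M \<Longrightarrow> \<forall>\<^sub>F \<epsilon> in at_right (0::real). \<omega> \<notin> S \<epsilon>"
  shows "((\<lambda>\<epsilon>. prob (S \<epsilon>)) \<longlongrightarrow> 0) (at_right 0)"
proof (rule tendsto_at_right_sequentially[of _ 1])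
  fix e :: "nat \<Rightarrow> real" assume e: "\<And>n. 0 < e n" "\<And>n. e n < 1" "decseq e" "e \<longlonglongrightarrow> 0"
  have lim: "filterlim e (at_right 0) sequentially"
    using e(1) by (auto simp: filterlim_at e(4) less_imp_neq[THEN not_sym])
  have "(\<lambda>n. \<integral>\<omega>. indicator (S (e n)) \<omega> \<partial>M) \<longlonglongrightarrow> (\<integral>\<omega>. 0 \<partial>M :: real)"
  proof (rule integral_dominated_convergence[where w="\<lambda>_. 1"])
    show "AE \<omega> in M. (\<lambda>n. indicator (S (e n)) \<omega> :: real) \<longlonglongrightarrow> 0"
    proof (rule AE_I2)
      fix \<omega> assume "\<omega> \<in> space M"
      from ev[OF this] lim have "\<forall>\<^sub>F n in sequentially. \<omega> \<notin> S (e n)"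
        unfolding filterlim_iff by blast
      then show "(\<lambda>n. indicator (S (e n)) \<omega> :: real) \<longlonglongrightarrow> 0"
        by (intro tendsto_eventually) (auto elim: eventually_mono)
    qed
  qed (use e S in \<open>auto simp: indicator_def\<close>)
  then show "(\<lambda>n. prob (S (e n))) \<longlonglongrightarrow> 0" using e S by simp
qed simp

lemma covariation_approx_commute: "covariation_approx X Y = covariation_approx Y X"
  unfolding covariation_approx_def by (intro ext) (subst mult.commute[of "extend Y _ _ - _"], rule refl)

lemma has_covariation_commute: "has_covariation M X Y A \<Longrightarrow> has_covariation M Y X A"
  unfolding has_covariation_def
  by (simp add: covariation_approx_commute[of Y X])

lemma has_covariation_cong:
  assumes "has_covariation M X Y A" and X': "continuous_process M X'"
    and "\<And>t \<omega>. t \<in> {0..1} \<Longrightarrow> \<omega> \<in> space M \<Longrightarrow> X t \<omega> = X' t \<omega>"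
  shows "has_covariation M X' Y A"
proof -
  have XY: "continuous_process M X" "continuous_process M Y" using assms by (auto simp: has_covariation_def)
  have e: "extend X s \<omega> = extend X' s \<omega>" if "\<omega> \<in> space M" for s \<omega>
    unfolding extend_def by (rule assms(3)) (use that in auto)
  have "ucp_limit M (covariation_approx X' Y) A"
  proof (rule ucp_limit_cong)
    show "ucp_limit M (covariation_approx X Y) A" using assms by (simp add: has_covariation_def)
  qed (simp_all add: covariation_approx_def e)
  then show ?thesis using assms by (simp add: has_covariation_def)
qed

lemma has_covariation_add:
  assumes "has_covariation M X Y A" "has_covariation M X' Y A'"
  shows "has_covariation M (\<lambda>t \<omega>. X t \<omega> + X' t \<omega>) Y (\<lambda>t \<omega>. A t \<omega> + A' t \<omega>)"
proof -
  have c: "continuous_process M X" "continuous_process M Y" "continuous_process M X'"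
    "continuous_process M A" "continuous_process M A'"
    and u: "ucp_limit M (covariation_approx X Y) A" "ucp_limit M (covariation_approx X' Y) A'"
    using assms by (auto simp: has_covariation_def)
  have "ucp_limit M (covariation_approx (\<lambda>t \<omega>. X t \<omega> + X' t \<omega>) Y) (\<lambda>t \<omega>. A t \<omega> + A' t \<omega>)"
  proof (rule ucp_limit_cong[OF _ _ ucp_limit_add[OF u]])
    fix \<epsilon> t \<omega> assume w: "\<omega> \<in> space M"
    have x: "extend (\<lambda>t \<omega>. X t \<omega> + X' t \<omega>) s \<omega> = extend X s \<omega> + extend X' s \<omega>" for s
      by (simp add: extend_def)
    show "covariation_approx X Y \<epsilon> t \<omega> + covariation_approx X' Y \<epsilon> t \<omega> =
      covariation_approx (\<lambda>t \<omega>. X t \<omega> + X' t \<omega>) Y \<epsilon> t \<omega>"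
      using path_cov_add[OF continuous_on_extend[OF c(1) w] continuous_on_extend[OF c(3) w] continuous_on_extend[OF c(2) w]]
      by (simp add: covariation_approx_eq_path_cov[OF _ _ w] c continuous_process_add x)
  qed (auto intro!: continuous_process_covariation_approx c)
  then show ?thesis by (simp add: has_covariation_def c continuous_process_add)
qed

text \<open>
The factor \<open>\<xi>\<close> is constant in time and comes out of the integral for each \<open>\<omega>\<close>; boundedness keeps
the convergence uniform.
\<close>

lemma has_covariation_cmult:
  assumes "has_covariation M X Y A" and xi: "\<xi> \<in> borel_measurable M" "\<And>\<omega>. \<omega> \<in> space M \<Longrightarrow> \<bar>\<xi> \<omega>\<bar> \<le> K"
  shows "has_covariation M (\<lambda>t \<omega>. \<xi> \<omega> * X t \<omega>) Y (\<lambda>t \<omega>. \<xi> \<omega> * A t \<omega>)"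
proof -
  have c: "continuous_process M X" "continuous_process M Y" "continuous_process M A"
    and u: "ucp_limit M (covariation_approx X Y) A"
    using assms by (auto simp: has_covariation_def)
  have "ucp_limit M (covariation_approx (\<lambda>t \<omega>. \<xi> \<omega> * X t \<omega>) Y) (\<lambda>t \<omega>. \<xi> \<omega> * A t \<omega>)"
  proof (rule ucp_limit_cong[OF _ _ ucp_limit_cmult[OF u xi]])
    fix \<epsilon> t \<omega> assume w: "\<omega> \<in> space M"
    have x: "extend (\<lambda>t \<omega>. \<xi> \<omega> * X t \<omega>) s \<omega> = \<xi> \<omega> * extend X s \<omega>" for s
      by (simp add: extend_def)
    show "\<xi> \<omega> * covariation_approx X Y \<epsilon> t \<omega> = covariation_approx (\<lambda>t \<omega>. \<xi> \<omega> * X t \<omega>) Y \<epsilon> t \<omega>"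
      by (simp add: covariation_approx_eq_path_cov[OF _ _ w] c continuous_process_cmult xi x path_cov_cmult)
  qed (auto intro!: continuous_process_covariation_approx c)
  then show ?thesis by (simp add: has_covariation_def c continuous_process_cmult xi)
qed

lemma has_covariation_diff:
  assumes "has_covariation M X Y A" "has_covariation M X' Y A'"
  shows "has_covariation M (\<lambda>t \<omega>. X t \<omega> - X' t \<omega>) Y (\<lambda>t \<omega>. A t \<omega> - A' t \<omega>)"
  using has_covariation_add[OF assms(1) has_covariation_cmult[OF assms(2), of "\<lambda>_. -1" 1]] by simp

lemma has_covariation_const:
  assumes "continuous_process M Y" and "c \<in> borel_measurable M"
  shows "has_covariation M (\<lambda>_. c) Y (\<lambda>_ _. 0)"
proof -
  have "covariation_approx (\<lambda>_. c) Y = (\<lambda>_ _ _. 0)"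
    by (intro ext) (simp add: covariation_approx_def extend_def)
  then have "ucp_limit M (covariation_approx (\<lambda>_. c) Y) (\<lambda>_ _. 0)"
    by (simp add: ucp_limit_def)
  then show ?thesis
    using assms by (simp add: has_covariation_def continuous_process_const)
qed

text \<open>
Stopping \<open>Y\<close> and stopping the approximation of \<open>[X,Y]\<close> at \<open>b\<close> give the same up to a product of
moduli of continuity, which vanishes for every \<open>\<omega>\<close>.
\<close>

lemma has_covariation_stop:
  assumes XY: "has_covariation M X Y A" and b: "b \<in> {0..1}"
  shows "has_covariation M X (\<lambda>t. Y (min t b)) (\<lambda>t. A (min t b))"
proof -
  let ?Y = "\<lambda>t. Y (min t b)"
  have c: "continuous_process M X" "continuous_process M Y" "continuous_process M A"
    and u: "ucp_limit M (covariation_approx X Y) A"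
    using XY by (auto simp: has_covariation_def)
  have cs: "continuous_process M ?Y" "continuous_process M (\<lambda>t. A (min t b))"
    by (intro continuous_process_stop c b)+
  have cb: "continuous_process M (\<lambda>t. covariation_approx X Y \<epsilon> (min t b))" for \<epsilon>
    by (intro continuous_process_stop continuous_process_covariation_approx c b)
  define V where "V \<epsilon> t \<omega> = covariation_approx X ?Y \<epsilon> t \<omega> - covariation_approx X Y \<epsilon> (min t b) \<omega>" for \<epsilon> t \<omega>
  have V: "continuous_process M (V \<epsilon>)" for \<epsilon>
    unfolding V_def by (intro continuous_process_diff cb continuous_process_covariation_approx c cs)
  have "ucp_limit M V (\<lambda>_ _. 0)"
    unfolding ucp_limit_iff_exceed
  proof (intro allI impI tendsto_prob_eventually_avoided)
    fix \<delta> :: real and \<omega> assume d: "0 < \<delta>" and w: "\<omega> \<in> space M"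
    define f where "f = (\<lambda>s. extend X s \<omega>)"
    define g where "g = (\<lambda>s. extend Y s \<omega>)"
    have f: "continuous_on UNIV f" and g: "continuous_on UNIV g"
      unfolding f_def g_def by (intro continuous_on_extend[OF _ w] c)+
    have gb: "(\<lambda>s. extend ?Y s \<omega>) = (\<lambda>s. g (min s b))"
      using b by (auto simp: g_def extend_def fun_eq_iff min_def max_def)
    define \<eta> where "\<eta> = min 1 \<delta>"
    have eta: "0 < \<eta>" "\<eta> * \<eta> \<le> \<delta>" using d mult_left_le[of \<eta> \<eta>] by (auto simp: \<eta>_def)
    have "isCont g b" using g by (simp add: continuous_on_eq_continuous_at)
    have "uniformly_continuous_on {-1..2} f"
      by (rule compact_uniformly_continuous[OF continuous_on_subset[OF f]]) auto
    obtain r1 where r1: "0 < r1" "\<And>s. dist s b < r1 \<Longrightarrow> dist (g s) (g b) < \<eta>"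
      using \<open>isCont g b\<close> eta(1) unfolding continuous_at_eps_delta by (auto simp: dist_real_def)
    obtain r2 where r2: "0 < r2" "\<And>s s'. s \<in> {-1..2} \<Longrightarrow> s' \<in> {-1..2} \<Longrightarrow> dist s s' < r2 \<Longrightarrow> dist (f s) (f s') < \<eta>"
      using \<open>uniformly_continuous_on {-1..2} f\<close> eta(1) unfolding uniformly_continuous_on_def by blast
    note r = r1 r2
    have "\<forall>\<^sub>F \<epsilon> in at_right 0. \<epsilon> \<in> {0<..<min 1 (min r1 r2)}" 
      using r by (intro eventually_at_right_real) auto
    then show "\<forall>\<^sub>F \<epsilon> in at_right 0. \<omega> \<notin> exceed M (\<lambda>t \<omega>. V \<epsilon> t \<omega> - 0) \<delta>"
    proof eventually_elim
      case (elim \<epsilon>)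
      have *: "\<bar>V \<epsilon> t \<omega>\<bar> \<le> \<eta> * \<eta>" if t: "t \<in> {0..1}" for t
        unfolding V_def covariation_approx_eq_path_cov[OF c(1,2) w] covariation_approx_eq_path_cov[OF c(1) cs(1) w] gb
          f_def[symmetric] g_def[symmetric]
      proof (rule path_cov_stopped[OF f g])
        show "\<bar>f (s + \<epsilon>) - f s\<bar> \<le> \<eta>" if "s \<in> {b - \<epsilon>..b}" for s
          using r(4)[of "s + \<epsilon>" s] that elim b by (auto simp: dist_real_def)
        show "\<bar>g s - g b\<bar> \<le> \<eta>" if "s \<in> {b..b + \<epsilon>}" for s
          using r(2)[of s] that elim b by (auto simp: dist_real_def)
      qed (use t b elim in auto)
      show ?case using order_trans[OF * eta(2)] by (auto simp: exceed_def not_less)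
    qed
  qed (auto intro!: exceed_sets V)
  then have "ucp_limit M (\<lambda>\<epsilon> t \<omega>. V \<epsilon> t \<omega> + covariation_approx X Y \<epsilon> (min t b) \<omega>) (\<lambda>t \<omega>. 0 + A (min t b) \<omega>)"
    by (intro ucp_limit_add[where Z'="\<lambda>\<epsilon> t. covariation_approx X Y \<epsilon> (min t b)" and A'="\<lambda>t. A (min t b)"]
      ucp_limit_stop[OF u b] V cb cs continuous_process_const continuous_process_covariation_approx c) auto
  then have "ucp_limit M (covariation_approx X ?Y) (\<lambda>t. A (min t b))" by (simp add: V_def)
  then show ?thesis by (simp add: has_covariation_def c cs)
qed

end

section \<open>The quadratic variation of an integrable martingale\<close>

context prob_space
begin

lemma tendsto_prob_eventually_avoided_seq:
  assumes S: "\<And>n. S n \<in> events" and ev: "AE \<omega> in M. \<forall>\<^sub>F n in sequentially. \<omega> \<notin> S n"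
  shows "(\<lambda>n. prob (S n)) \<longlonglongrightarrow> 0"
proof -
  have "(\<lambda>n. \<integral>\<omega>. indicator (S n) \<omega> \<partial>M) \<longlonglongrightarrow> (\<integral>\<omega>. 0 \<partial>M :: real)"
  proof (rule integral_dominated_convergence[where w="\<lambda>_. 1"])
    show "AE \<omega> in M. (\<lambda>n. indicator (S n) \<omega> :: real) \<longlonglongrightarrow> 0"
      using ev by eventually_elim (intro tendsto_eventually, auto elim: eventually_mono)
  qed (use S in \<open>auto simp: indicator_def\<close>)
  then show ?thesis using S by simp
qed

text \<open>
Completeness of ucp convergence. Approximations \<open>B\<^sub>k\<close> with tolerance \<open>2\<^sup>-\<^sup>k\<close> have summable
consecutive distances, so by the Borel--Cantelli lemma their paths converge uniformly almost
surely; the limit is set to 0 on the exceptional event to keep all paths continuous.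
\<close>

lemma ucp_limit_exists_of_approximations:
  assumes Z: "\<And>\<epsilon>. 0 < \<epsilon> \<Longrightarrow> continuous_process M (Z \<epsilon>)"
    and approx: "\<And>\<delta>. 0 < \<delta> \<Longrightarrow> \<exists>B. continuous_process M B \<and>
      (\<forall>\<^sub>F \<epsilon> in at_right 0. prob (exceed M (\<lambda>t \<omega>. Z \<epsilon> t \<omega> - B t \<omega>) \<delta>) < \<delta>)"
  shows "\<exists>A. continuous_process M A \<and> ucp_limit M Z A"
proof -
  have "\<forall>k::nat. \<exists>B. continuous_process M B \<and>
      (\<forall>\<^sub>F \<epsilon> in at_right 0. prob (exceed M (\<lambda>t \<omega>. Z \<epsilon> t \<omega> - B t \<omega>) ((1/2)^k)) < (1/2)^k)"
    by (intro allI approx) simp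
  from choice[OF this] obtain B where B: "\<And>k. continuous_process M (B k)"
    and near: "\<And>k. \<forall>\<^sub>F \<epsilon> in at_right 0. prob (exceed M (\<lambda>t \<omega>. Z \<epsilon> t \<omega> - B k t \<omega>) ((1/2)^k)) < (1/2)^k"
    by blast
  define f where "f k t \<omega> = B (Suc k) t \<omega> - B k t \<omega>" for k t \<omega>
  define E where "E k = exceed M (f k) (2 * (1/2)^k)" for k
  have f: "continuous_process M (f k)" for k unfolding f_def by (intro continuous_process_diff B)
  have E: "E k \<in> events" for k unfolding E_def by (intro exceed_sets f)
  have pE: "prob (E k) \<le> 2 * (1/2)^k" for k
  proof -
    have "(at_right (0::real)) \<noteq> bot" by simp
    from eventually_happens'[OF this eventually_conj[OF near[of k] eventually_conj[OF near[of "Suc k"] eventually_at_right_0_01]]]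
    obtain \<epsilon> where e: "0 < \<epsilon>"
      "prob (exceed M (\<lambda>t \<omega>. Z \<epsilon> t \<omega> - B k t \<omega>) ((1/2)^k)) < (1/2)^k"
      "prob (exceed M (\<lambda>t \<omega>. Z \<epsilon> t \<omega> - B (Suc k) t \<omega>) ((1/2)^Suc k)) < (1/2)^Suc k"
      by blast
    have "prob (E k) \<le> prob (exceed M (f k) ((1/2)^k + (1/2)^Suc k))"
      unfolding E_def by (intro finite_measure_mono exceed_antimono exceed_sets f) simp
    also have "\<dots> \<le> prob (exceed M (\<lambda>t \<omega>. Z \<epsilon> t \<omega> - B k t \<omega>) ((1/2)^k)) +
        prob (exceed M (\<lambda>t \<omega>. Z \<epsilon> t \<omega> - B (Suc k) t \<omega>) ((1/2)^Suc k))"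
      using e(1) by (intro prob_exceed_triangle continuous_process_diff Z B) (auto simp: f_def)
    also have "\<dots> \<le> (1/2)^k + (1/2)^Suc k" using e by (intro add_mono) auto
    also have "\<dots> \<le> 2 * (1/2)^k" by simp
    finally show ?thesis .
  qed
  define G where "G = {\<omega>\<in>space M. \<forall>\<^sub>F k in sequentially. \<omega> \<notin> E k}"
  have "AE \<omega> in M. \<forall>\<^sub>F k in sequentially. \<omega> \<in> space M - E k"
  proof (rule borel_cantelli_AE1[OF E])
    show "summable (\<lambda>k. prob (E k))"
      by (rule summable_comparison_test'[of "\<lambda>k. 2 * (1/2)^k"])
        (use pE in \<open>auto intro!: summable_mult summable_geometric\<close>)
  qed (simp add: emeasure_eq_measure)
  then have AEG: "AE \<omega> in M. \<omega> \<in> G"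
    using AE_space by eventually_elim (auto simp: G_def elim: eventually_mono)
  have Gs: "G \<in> events" unfolding G_def eventually_sequentially using E by measurable
  define A where "A t \<omega> = (if \<omega> \<in> G then B 0 t \<omega> + (\<Sum>k. f k t \<omega>) else 0)" for t \<omega>
  have unif: "uniform_limit {0..1} (\<lambda>n t. B n t \<omega>) (\<lambda>t. A t \<omega>) sequentially" if w: "\<omega> \<in> G" for \<omega>
  proof -
    have "uniform_limit {0..1} (\<lambda>n t. \<Sum>k<n. f k t \<omega>) (\<lambda>t. \<Sum>k. f k t \<omega>) sequentially"
    proof (rule Weierstrass_m_test_ev)
      show "\<forall>\<^sub>F n in sequentially. \<forall>t\<in>{0..1}. norm (f n t \<omega>) \<le> 2 * (1/2)^n"
        using w unfolding G_def E_def exceed_def by (auto simp: not_less elim: eventually_mono)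
    qed (auto intro!: summable_mult summable_geometric)
    then have "uniform_limit {0..1} (\<lambda>n t. B 0 t \<omega> + (\<Sum>k<n. f k t \<omega>)) (\<lambda>t. B 0 t \<omega> + (\<Sum>k. f k t \<omega>)) sequentially"
      by (intro uniform_limit_add uniform_limit_const)
    moreover have "B 0 t \<omega> + (\<Sum>k<n. f k t \<omega>) = B n t \<omega>" for n t
      unfolding f_def using sum_lessThan_telescope[of "\<lambda>k. B k t \<omega>" n] by simp
    ultimately show ?thesis using w by (simp add: A_def)
  qed
  have A: "continuous_process M A" unfolding continuous_process_def
  proof (intro conjI ballI)
    fix t :: real assume t: "t \<in> {0..1}"
    show "A t \<in> borel_measurable M"
    proof (rule borel_measurable_LIMSEQ_real)
      show "(\<lambda>n. indicator G \<omega> * B n t \<omega>) \<longlonglongrightarrow> A t \<omega>" for \<omega>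
        using tendsto_uniform_limitI[OF unif t, of \<omega>] by (cases "\<omega> \<in> G") (auto simp: A_def)
      show "(\<lambda>\<omega>. indicator G \<omega> * B n t \<omega>) \<in> borel_measurable M" for n
        using continuous_processD(1)[OF B t] Gs by measurable
    qed
  next
    fix \<omega> assume w: "\<omega> \<in> space M"
    show "continuous_on {0..1} (\<lambda>t. A t \<omega>)"
    proof (cases "\<omega> \<in> G")
      case True
      show ?thesis
        by (rule uniform_limit_theorem[OF _ unif[OF True]])
          (auto intro!: always_eventually continuous_processD(2)[OF B w])
    qed (simp add: A_def)
  qed
  have "ucp_limit M Z A"
  proof (rule ucp_limitI[OF _ Z A])
    fix \<delta> :: real assume d: "0 < \<delta>"
    have "(\<lambda>n. prob (exceed M (\<lambda>t \<omega>. A t \<omega> - B n t \<omega>) (\<delta>/2))) \<longlonglongrightarrow> 0"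
    proof (rule tendsto_prob_eventually_avoided_seq)
      show "AE \<omega> in M. \<forall>\<^sub>F n in sequentially. \<omega> \<notin> exceed M (\<lambda>t \<omega>. A t \<omega> - B n t \<omega>) (\<delta>/2)"
        using AEG
      proof eventually_elim
        case (elim \<omega>)
        from uniform_limitD[OF unif[OF elim], of "\<delta>/2"] d show ?case
          by (auto elim!: eventually_mono simp: exceed_def dist_real_def not_less abs_minus_commute)
      qed
    qed (intro exceed_sets continuous_process_diff A B)
    then have 1: "\<forall>\<^sub>F n in sequentially. prob (exceed M (\<lambda>t \<omega>. A t \<omega> - B n t \<omega>) (\<delta>/2)) < \<delta>/2"
      using d by (intro order_tendstoD(2)) auto
    have "(\<lambda>n. (1/2::real)^n) \<longlonglongrightarrow> 0" by (rule LIMSEQ_power_zero) simp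
    then have 2: "\<forall>\<^sub>F n in sequentially. (1/2::real)^n < \<delta>/2"
      using d by (intro order_tendstoD(2)) auto
    from eventually_happens'[OF _ eventually_conj[OF 1 2]] obtain n where
      n: "prob (exceed M (\<lambda>t \<omega>. A t \<omega> - B n t \<omega>) (\<delta>/2)) < \<delta>/2" "(1/2::real)^n < \<delta>/2" by auto
    show "\<forall>\<^sub>F \<epsilon> in at_right 0. prob (exceed M (\<lambda>t \<omega>. Z \<epsilon> t \<omega> - A t \<omega>) \<delta>) < \<delta>"
      using near[of n] eventually_at_right_0_01
    proof eventually_elim
      case (elim \<epsilon>)
      have c: "continuous_process M (\<lambda>t \<omega>. Z \<epsilon> t \<omega> - B n t \<omega>)" using elim by (intro continuous_process_diff Z B) auto
      have "prob (exceed M (\<lambda>t \<omega>. Z \<epsilon> t \<omega> - A t \<omega>) (\<delta>/2 + \<delta>/2))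
        \<le> prob (exceed M (\<lambda>t \<omega>. Z \<epsilon> t \<omega> - B n t \<omega>) (\<delta>/2)) + prob (exceed M (\<lambda>t \<omega>. A t \<omega> - B n t \<omega>) (\<delta>/2))"
        by (intro prob_exceed_triangle continuous_process_diff A B c) auto
      also have "prob (exceed M (\<lambda>t \<omega>. Z \<epsilon> t \<omega> - B n t \<omega>) (\<delta>/2)) \<le> prob (exceed M (\<lambda>t \<omega>. Z \<epsilon> t \<omega> - B n t \<omega>) ((1/2)^n))"
        using n(2) by (intro finite_measure_mono exceed_antimono exceed_sets c) simp
      finally show ?case using elim n by simp
    qed
  qed
  with A show ?thesis by blast
qed

text \<open>
Fatou's lemma for the events \<open>f\<^sub>n > \<delta>\<close>: if the limit exceeds \<open>\<delta>\<close>, then so do almost all \<open>f\<^sub>n\<close>.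
\<close>

lemma prob_greater_le_of_tendsto:
  fixes f :: "nat \<Rightarrow> 'a \<Rightarrow> real"
  assumes [measurable]: "\<And>n. f n \<in> borel_measurable M"
    and lim: "\<And>\<omega>. \<omega> \<in> space M \<Longrightarrow> (\<lambda>n. f n \<omega>) \<longlonglongrightarrow> g \<omega>"
    and bound: "\<forall>\<^sub>F n in sequentially. prob {\<omega>\<in>space M. f n \<omega> > \<delta>} \<le> c"
  shows "prob {\<omega>\<in>space M. g \<omega> > \<delta>} \<le> c"
proof -
  define S where "S N = (\<Inter>n\<in>{N..}. {\<omega>\<in>space M. f n \<omega> > \<delta>})" for N
  have S: "S N \<in> events" for N unfolding S_def by (intro sets.countable_INT') auto
  have "incseq S" by (auto simp: S_def incseq_def)
  then have lim': "(\<lambda>N. prob (S N)) \<longlonglongrightarrow> prob (\<Union>N. S N)"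
    using S by (intro finite_Lim_measure_incseq) auto
  have "prob {\<omega>\<in>space M. g \<omega> > \<delta>} \<le> prob (\<Union>N. S N)"
  proof (rule finite_measure_mono)
    show "{\<omega>\<in>space M. g \<omega> > \<delta>} \<subseteq> (\<Union>N. S N)"
    proof
      fix \<omega> assume w: "\<omega> \<in> {\<omega>\<in>space M. g \<omega> > \<delta>}"
      then have "\<forall>\<^sub>F n in sequentially. f n \<omega> > \<delta>" using order_tendstoD(1)[OF lim] by blast
      then show "\<omega> \<in> (\<Union>N. S N)" using w by (auto simp: S_def eventually_sequentially)
    qed
  qed (use S in auto)
  also have "\<dots> \<le> c"
  proof (rule tendsto_upperbound[OF lim'])
    show "\<forall>\<^sub>F N in sequentially. prob (S N) \<le> c" using bound
    proof eventually_elim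
      case (elim n)
      have "prob (S n) \<le> prob {\<omega>\<in>space M. f n \<omega> > \<delta>}"
        by (intro finite_measure_mono) (auto simp: S_def)
      with elim show ?case by simp
    qed
  qed simp
  finally show ?thesis .
qed

end

text \<open>
A convex function that equals the square near 0, so that it sees squared increments, and grows
linearly, so that it can be applied to martingales without second moments.
\<close>

definition huber :: "real \<Rightarrow> real" where
  "huber x = (if \<bar>x\<bar> \<le> 1 then x\<^sup>2 else 2 * \<bar>x\<bar> - 1)"

definition huber_slope :: "real \<Rightarrow> real" where
  "huber_slope x = 2 * max (- 1) (min 1 x)"

lemma huber_measurable [measurable]: "huber \<in> borel_measurable borel" "huber_slope \<in> borel_measurable borel"
  unfolding huber_def[abs_def] huber_slope_def[abs_def] by measurable

lemma huber_nonneg: "0 \<le> huber x"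
  by (simp add: huber_def)

lemma huber_le: "huber x \<le> 2 * \<bar>x\<bar>"
proof (cases "\<bar>x\<bar> \<le> 1")
  case True
  have "x\<^sup>2 = \<bar>x\<bar> * \<bar>x\<bar>" by (simp add: power2_eq_square)
  also have "\<dots> \<le> \<bar>x\<bar> * 1" using True by (intro mult_left_mono) auto
  finally show ?thesis using True by (simp add: huber_def)
qed (simp add: huber_def)

lemma huber_slope_le: "\<bar>huber_slope x\<bar> \<le> 2"
  by (simp add: huber_slope_def)

text \<open>
The gap between \<open>huber\<close> and its tangent at \<open>x\<close> is nonnegative by convexity, and it is exactly
\<open>(y - x)\<^sup>2\<close> while both points lie in the quadratic region.
\<close>

lemma huber_bregman:
  "huber y - huber x - huber_slope x * (y - x) \<ge> (if \<bar>x\<bar> \<le> 1 \<and> \<bar>y\<bar> \<le> 1 then (y - x)\<^sup>2 else 0)"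
proof -
  consider "\<bar>x\<bar> \<le> 1" "\<bar>y\<bar> \<le> 1" | "\<bar>x\<bar> \<le> 1" "y > 1" | "\<bar>x\<bar> \<le> 1" "y < - 1" | "x > 1" | "x < -1"
    by linarith
  then show ?thesis
  proof cases
    case 2
    then have "0 \<le> (1 - x) * (2 * y - 1 - x)" by (intro mult_nonneg_nonneg) auto
    with 2 show ?thesis by (simp add: huber_def huber_slope_def power2_eq_square algebra_simps)
  next
    case 3
    then have "0 \<le> (1 + x) * (- 2 * y - 1 + x)" by (intro mult_nonneg_nonneg) auto
    with 3 show ?thesis by (simp add: huber_def huber_slope_def power2_eq_square algebra_simps)
  next
    case 4
    have "0 \<le> (y - 1)\<^sup>2" by simp
    with 4 show ?thesis by (simp add: huber_def huber_slope_def power2_eq_square algebra_simps abs_if)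
  next
    case 5
    have "0 \<le> (y + 1)\<^sup>2" by simp
    with 5 show ?thesis by (simp add: huber_def huber_slope_def power2_eq_square algebra_simps abs_if)
  qed (simp add: huber_def huber_slope_def power2_eq_square algebra_simps)
qed

text \<open>
Shifting the summation by one step trades one boundary term for another, at a cost of at most \<open>c\<close>.
\<close>

lemma sum_shift_le:
  fixes a :: "nat \<Rightarrow> real"
  assumes "\<And>k. 0 \<le> a k" "\<And>k. a k \<le> c"
  shows "(\<Sum>k<n. a (k + m)) \<le> (\<Sum>k<n. a k) + real m * c"
proof (induction m)
  case (Suc m)
  have "(\<Sum>k<n. a (k + Suc m)) + a m = (\<Sum>k<Suc n. a (k + m))"
    by (subst sum.lessThan_Suc_shift) simp
  also have "\<dots> = (\<Sum>k<n. a (k + m)) + a (n + m)" by simp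
  finally have "(\<Sum>k<n. a (k + Suc m)) = (\<Sum>k<n. a (k + m)) + a (n + m) - a m" by simp
  with Suc assms(1)[of m] assms(2)[of "n + m"] show ?case by (simp add: algebra_simps)
qed simp

locale filtered_prob_space = prob_space M for M :: "'a measure" +
  fixes F :: "real \<Rightarrow> 'a measure"
  assumes subalg: "subalgebra M (F t)"
    and mono: "s \<le> t \<Longrightarrow> sets (F s) \<subseteq> sets (F t)"
begin

lemma space_F: "space (F t) = space M"
  using subalg[of t] by (simp add: subalgebra_def)

lemma measurable_F_mono: "s \<le> t \<Longrightarrow> f \<in> measurable (F s) N \<Longrightarrow> f \<in> measurable (F t) N"
  using mono[of s t] by (auto simp: measurable_def space_F)

lemma measurable_F_M: "f \<in> measurable (F s) N \<Longrightarrow> f \<in> measurable M N"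
  by (rule measurable_from_subalg[OF subalg])

lemma sigma_finite_F: "sigma_finite_subalgebra M (F t)"
proof -
  interpret finite_measure_subalgebra M "F t"
    by unfold_locales (rule subalg)
  show ?thesis by unfold_locales
qed

text \<open>
The martingale property in the form in which it is applied: tested against bounded variables known
at the earlier time.
\<close>

lemma martingale_integral:
  assumes X: "martingale M F X" and st: "0 \<le> s" "s \<le> t" "t \<le> 1"
    and z: "\<zeta> \<in> borel_measurable (F s)" "\<And>\<omega>. \<omega> \<in> space M \<Longrightarrow> \<bar>\<zeta> \<omega>\<bar> \<le> K"
  shows "integrable M (\<lambda>\<omega>. \<zeta> \<omega> * X t \<omega>)" "integrable M (\<lambda>\<omega>. \<zeta> \<omega> * X s \<omega>)"
    "(\<integral>\<omega>. \<zeta> \<omega> * X t \<omega> \<partial>M) = (\<integral>\<omega>. \<zeta> \<omega> * X s \<omega> \<partial>M)"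
proof -
  interpret S: sigma_finite_subalgebra M "F s" by (rule sigma_finite_F)
  have [measurable]: "\<zeta> \<in> borel_measurable M" using measurable_F_M[OF z(1)] .
  have i: "integrable M (\<lambda>\<omega>. \<zeta> \<omega> * X u \<omega>)" if "0 \<le> u" "u \<le> 1" for u
  proof (rule Bochner_Integration.integrable_bound[of _ "\<lambda>\<omega>. K * X u \<omega>"])
    have Xi: "integrable M (X u)" using X that by (auto simp: martingale_def)
    then show "integrable M (\<lambda>\<omega>. K * X u \<omega>)" by simp
    show "(\<lambda>\<omega>. \<zeta> \<omega> * X u \<omega>) \<in> borel_measurable M" using Xi by measurable
    show "AE \<omega> in M. norm (\<zeta> \<omega> * X u \<omega>) \<le> norm (K * X u \<omega>)"
      using z(2) by (intro AE_I2) (auto simp: abs_mult intro!: mult_right_mono intro: order_trans[OF _ abs_ge_self])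
  qed
  then show "integrable M (\<lambda>\<omega>. \<zeta> \<omega> * X t \<omega>)" "integrable M (\<lambda>\<omega>. \<zeta> \<omega> * X s \<omega>)" using st by auto
  have ae: "AE \<omega> in M. real_cond_exp M (F s) (X t) \<omega> = X s \<omega>" using X st by (auto simp: martingale_def)
  have m: "X t \<in> borel_measurable M" "X s \<in> borel_measurable M" using X st by (auto simp: martingale_def)
  have "(\<integral>\<omega>. \<zeta> \<omega> * X t \<omega> \<partial>M) = (\<integral>\<omega>. \<zeta> \<omega> * real_cond_exp M (F s) (X t) \<omega> \<partial>M)"
    using st by (intro S.real_cond_exp_intg(2)[symmetric] i z m) auto
  also have "\<dots> = (\<integral>\<omega>. \<zeta> \<omega> * X s \<omega> \<partial>M)"
    using ae m by (intro integral_cong_AE) auto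
  finally show "(\<integral>\<omega>. \<zeta> \<omega> * X t \<omega> \<partial>M) = (\<integral>\<omega>. \<zeta> \<omega> * X s \<omega> \<partial>M)" .
qed

lemma martingaleD:
  assumes "martingale M F X" "t \<in> {0..1}"
  shows "X t \<in> borel_measurable (F t)" "X t \<in> borel_measurable M" "integrable M (X t)"
  using assms by (auto simp: martingale_def adapted_def)

text \<open>
The modulus of a martingale is a submartingale: test with the sign of \<open>X\<^sub>s\<close>.
\<close>

lemma martingale_abs_integral_le:
  assumes X: "martingale M F X" and st: "0 \<le> s" "s \<le> t" "t \<le> 1" and A: "A \<in> sets (F s)"
  shows "(\<integral>\<omega>. indicator A \<omega> * \<bar>X s \<omega>\<bar> \<partial>M) \<le> (\<integral>\<omega>. indicator A \<omega> * \<bar>X t \<omega>\<bar> \<partial>M)"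
proof -
  have s01: "s \<in> {0..1}" "t \<in> {0..1}" using st by auto
  have [measurable]: "A \<in> events" using A subalg[of s] by (auto simp: subalgebra_def)
  define \<zeta> where "\<zeta> \<omega> = indicator A \<omega> * sgn (X s \<omega>)" for \<omega>
  have z: "\<zeta> \<in> borel_measurable (F s)" unfolding \<zeta>_def using A martingaleD(1)[OF X s01(1)] by measurable
  have b: "\<bar>\<zeta> \<omega>\<bar> \<le> 1" for \<omega> by (auto simp: \<zeta>_def indicator_def sgn_if)
  have ai: "integrable M (\<lambda>\<omega>. indicator A \<omega> * \<bar>X t \<omega>\<bar>)"
    using integrable_mult_indicator[OF \<open>A \<in> events\<close>, of "\<lambda>\<omega>. \<bar>X t \<omega>\<bar>"] martingaleD(3)[OF X s01(2)] by simp
  have "(\<integral>\<omega>. indicator A \<omega> * \<bar>X s \<omega>\<bar> \<partial>M) = (\<integral>\<omega>. \<zeta> \<omega> * X s \<omega> \<partial>M)"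
    by (intro Bochner_Integration.integral_cong) (auto simp: \<zeta>_def sgn_if)
  also have "\<dots> = (\<integral>\<omega>. \<zeta> \<omega> * X t \<omega> \<partial>M)"
    using martingale_integral(3)[OF X st z, of 1] b by simp
  also have "\<dots> \<le> (\<integral>\<omega>. indicator A \<omega> * \<bar>X t \<omega>\<bar> \<partial>M)"
    using martingale_integral(1)[OF X st z, of 1] b
    by (intro integral_mono ai) (auto simp: \<zeta>_def sgn_if indicator_def)
  finally show ?thesis .
qed

text \<open>
Doob's maximal inequality, by adding the times of \<open>T\<close> in increasing order. When \<open>b\<close> is added, the
event that the level is crossed at \<open>b\<close> for the first time is known at time \<open>b\<close>, so the submartingale
property moves its contribution from \<open>b\<close> to \<open>u\<close>.
\<close>

lemma doob_maximal_finite: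
  assumes X: "martingale M F X" and T: "finite T" "T \<subseteq> {0..1}" and u: "u \<in> {0..1}" "\<And>t. t \<in> T \<Longrightarrow> t \<le> u"
  shows "{\<omega>\<in>space M. \<exists>t\<in>T. \<bar>X t \<omega>\<bar> > 1} \<in> sets (F u)"
    "prob {\<omega>\<in>space M. \<exists>t\<in>T. \<bar>X t \<omega>\<bar> > 1} \<le>
      (\<integral>\<omega>. indicator {\<omega>\<in>space M. \<exists>t\<in>T. \<bar>X t \<omega>\<bar> > 1} \<omega> * \<bar>X u \<omega>\<bar> \<partial>M)"
proof -
  have sets: "{\<omega>\<in>space M. \<exists>t\<in>S. \<bar>X t \<omega>\<bar> > 1} \<in> sets (F v)"
    if "finite S" "S \<subseteq> {0..1}" "\<And>t. t \<in> S \<Longrightarrow> t \<le> v" for S v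
  proof -
    have "{\<omega>\<in>space M. \<exists>t\<in>S. \<bar>X t \<omega>\<bar> > 1} = (\<Union>t\<in>S. {\<omega>\<in>space (F v). \<bar>X t \<omega>\<bar> > 1})" by (auto simp: space_F)
    also have "\<dots> \<in> sets (F v)"
    proof (intro sets.finite_UN that)
      fix t assume "t \<in> S"
      then have [measurable]: "X t \<in> borel_measurable (F v)"
        using that martingaleD(1)[OF X, of t] by (intro measurable_F_mono[of t v]) auto
      show "{\<omega>\<in>space (F v). \<bar>X t \<omega>\<bar> > 1} \<in> sets (F v)" by measurable
    qed
    finally show ?thesis .
  qed
  show "{\<omega>\<in>space M. \<exists>t\<in>T. \<bar>X t \<omega>\<bar> > 1} \<in> sets (F u)" by (rule sets) (use T u in auto)
  show "prob {\<omega>\<in>space M. \<exists>t\<in>T. \<bar>X t \<omega>\<bar> > 1} \<le>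
      (\<integral>\<omega>. indicator {\<omega>\<in>space M. \<exists>t\<in>T. \<bar>X t \<omega>\<bar> > 1} \<omega> * \<bar>X u \<omega>\<bar> \<partial>M)"
    using T u
  proof (induction T arbitrary: u rule: finite_linorder_max_induct)
    case (insert b T)
    define A where "A = {\<omega>\<in>space M. \<exists>t\<in>T. \<bar>X t \<omega>\<bar> > 1}"
    define C where "C = {\<omega>\<in>space M. \<bar>X b \<omega>\<bar> > 1} - A"
    have b: "0 \<le> b" "b \<le> u" "u \<le> 1" "b \<in> {0..1}" "T \<subseteq> {0..1}" "\<And>t. t \<in> T \<Longrightarrow> t \<le> b" using insert by auto
    have AF: "A \<in> sets (F b)" unfolding A_def by (rule sets) (use insert b in auto)
    have "{\<omega>\<in>space M. \<bar>X b \<omega>\<bar> > 1} \<in> sets (F b)"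
      using sets[of "{b}" b] b by simp
    then have CF: "C \<in> sets (F b)" unfolding C_def using AF by auto
    have [measurable]: "A \<in> events" "C \<in> events" using AF CF subalg[of b] by (auto simp: subalgebra_def)
    have Xi: "integrable M (\<lambda>\<omega>. \<bar>X v \<omega>\<bar>)" if "v \<in> {0..1}" for v using martingaleD(3)[OF X that] by simp
    have ii: "integrable M (\<lambda>\<omega>. indicator S \<omega> * \<bar>X v \<omega>\<bar>)" if "S \<in> events" "v \<in> {0..1}" for S v
      using integrable_mult_indicator[OF that(1) Xi[OF that(2)]] by simp
    have dec: "{\<omega>\<in>space M. \<exists>t\<in>insert b T. \<bar>X t \<omega>\<bar> > 1} = A \<union> C" "A \<inter> C = {}"
      by (auto simp: A_def C_def)
    have "prob C = (\<integral>\<omega>. indicator C \<omega> \<partial>M)" by simp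
    also have "\<dots> \<le> (\<integral>\<omega>. indicator C \<omega> * \<bar>X b \<omega>\<bar> \<partial>M)"
    proof (rule integral_mono)
      show "integrable M (indicator C :: 'a \<Rightarrow> real)"
        by (rule integrable_real_indicator) (auto simp: emeasure_eq_measure)
      show "integrable M (\<lambda>\<omega>. indicator C \<omega> * \<bar>X b \<omega>\<bar>)" by (intro ii b) fact
    qed (auto simp: C_def indicator_def)
    also have "\<dots> \<le> (\<integral>\<omega>. indicator C \<omega> * \<bar>X u \<omega>\<bar> \<partial>M)"
      using b by (intro martingale_abs_integral_le[OF X] CF) auto
    finally have C: "prob C \<le> (\<integral>\<omega>. indicator C \<omega> * \<bar>X u \<omega>\<bar> \<partial>M)" .
    have A: "prob A \<le> (\<integral>\<omega>. indicator A \<omega> * \<bar>X u \<omega>\<bar> \<partial>M)"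
      unfolding A_def by (rule insert.IH) (use insert b in force)+
    have "prob (A \<union> C) = prob A + prob C"
      using dec by (intro finite_measure_Union) auto
    also have "\<dots> \<le> (\<integral>\<omega>. indicator A \<omega> * \<bar>X u \<omega>\<bar> \<partial>M) + (\<integral>\<omega>. indicator C \<omega> * \<bar>X u \<omega>\<bar> \<partial>M)"
      using A C by simp
    also have "\<dots> = (\<integral>\<omega>. indicator A \<omega> * \<bar>X u \<omega>\<bar> + indicator C \<omega> * \<bar>X u \<omega>\<bar> \<partial>M)"
      using b by (intro Bochner_Integration.integral_add[symmetric] ii) auto
    also have "\<dots> = (\<integral>\<omega>. indicator (A \<union> C) \<omega> * \<bar>X u \<omega>\<bar> \<partial>M)"
      using dec(2) by (intro Bochner_Integration.integral_cong) (auto simp: indicator_def)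
    finally show ?case unfolding dec(1) .
  qed simp
qed

text \<open>
Integrate \<open>huber_bregman\<close> at \<open>x = X\<^sub>s\<close>, \<open>y = X\<^sub>t\<close>: the tangent term is a bounded variable known at
time \<open>s\<close> times a martingale increment and disappears.
\<close>

lemma huber_increment:
  assumes X: "martingale M F X" and st: "0 \<le> s" "s \<le> t" "t \<le> 1"
  shows "integrable M (\<lambda>\<omega>. huber (X t \<omega>))"
    "integrable M (\<lambda>\<omega>. if \<bar>X s \<omega>\<bar> \<le> 1 \<and> \<bar>X t \<omega>\<bar> \<le> 1 then (X t \<omega> - X s \<omega>)\<^sup>2 else 0)"
    "(\<integral>\<omega>. (if \<bar>X s \<omega>\<bar> \<le> 1 \<and> \<bar>X t \<omega>\<bar> \<le> 1 then (X t \<omega> - X s \<omega>)\<^sup>2 else 0) \<partial>M) \<le>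
      (\<integral>\<omega>. huber (X t \<omega>) \<partial>M) - (\<integral>\<omega>. huber (X s \<omega>) \<partial>M)"
proof -
  have s01: "s \<in> {0..1}" "t \<in> {0..1}" using st by auto
  note [measurable] = martingaleD(2)[OF X s01(1)] martingaleD(2)[OF X s01(2)]
  have hi: "integrable M (\<lambda>\<omega>. huber (X v \<omega>))" if "v \<in> {0..1}" for v
  proof (rule Bochner_Integration.integrable_bound[of _ "\<lambda>\<omega>. 2 * \<bar>X v \<omega>\<bar>"])
    show "(\<lambda>\<omega>. huber (X v \<omega>)) \<in> borel_measurable M"
      by (rule measurable_compose[OF martingaleD(2)[OF X that] huber_measurable(1)])
  qed (use martingaleD(3)[OF X that] huber_le huber_nonneg in auto)
  show hti: "integrable M (\<lambda>\<omega>. huber (X t \<omega>))" by (rule hi) fact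
  have sm: "(\<lambda>\<omega>. huber_slope (X s \<omega>)) \<in> borel_measurable (F s)"
    by (rule measurable_compose[OF martingaleD(1)[OF X s01(1)] huber_measurable(2)])
  note mi = martingale_integral[OF X st sm huber_slope_le]
  show qi: "integrable M (\<lambda>\<omega>. if \<bar>X s \<omega>\<bar> \<le> 1 \<and> \<bar>X t \<omega>\<bar> \<le> 1 then (X t \<omega> - X s \<omega>)\<^sup>2 else 0)"
  proof (rule integrable_const_bound[of _ 4])
    show "AE \<omega> in M. norm (if \<bar>X s \<omega>\<bar> \<le> 1 \<and> \<bar>X t \<omega>\<bar> \<le> 1 then (X t \<omega> - X s \<omega>)\<^sup>2 else 0) \<le> 4"
    proof (rule AE_I2)
      fix \<omega>
      have "(y - x)\<^sup>2 \<le> 2\<^sup>2" if "\<bar>x\<bar> \<le> 1" "\<bar>y\<bar> \<le> 1" for x y :: real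
        using that by (intro abs_le_square_iff[THEN iffD1]) auto
      then show "norm (if \<bar>X s \<omega>\<bar> \<le> 1 \<and> \<bar>X t \<omega>\<bar> \<le> 1 then (X t \<omega> - X s \<omega>)\<^sup>2 else 0) \<le> 4" by auto
    qed
  qed measurable
  have "(\<integral>\<omega>. (if \<bar>X s \<omega>\<bar> \<le> 1 \<and> \<bar>X t \<omega>\<bar> \<le> 1 then (X t \<omega> - X s \<omega>)\<^sup>2 else 0) \<partial>M)
    \<le> (\<integral>\<omega>. huber (X t \<omega>) - huber (X s \<omega>) - (huber_slope (X s \<omega>) * X t \<omega> - huber_slope (X s \<omega>) * X s \<omega>) \<partial>M)"
  proof (rule integral_mono[OF qi])
    show "integrable M (\<lambda>\<omega>. huber (X t \<omega>) - huber (X s \<omega>) - (huber_slope (X s \<omega>) * X t \<omega> - huber_slope (X s \<omega>) * X s \<omega>))"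
      using hi s01 mi(1,2) by (intro Bochner_Integration.integrable_diff) auto
  next
    fix \<omega>
    show "(if \<bar>X s \<omega>\<bar> \<le> 1 \<and> \<bar>X t \<omega>\<bar> \<le> 1 then (X t \<omega> - X s \<omega>)\<^sup>2 else 0) \<le>
      huber (X t \<omega>) - huber (X s \<omega>) - (huber_slope (X s \<omega>) * X t \<omega> - huber_slope (X s \<omega>) * X s \<omega>)"
      using huber_bregman[of "X s \<omega>" "X t \<omega>"] by (simp add: right_diff_distrib)
  qed
  also have "\<dots> = (\<integral>\<omega>. huber (X t \<omega>) \<partial>M) - (\<integral>\<omega>. huber (X s \<omega>) \<partial>M)"
    using hi s01 mi by (simp add: Bochner_Integration.integral_diff)
  finally show "(\<integral>\<omega>. (if \<bar>X s \<omega>\<bar> \<le> 1 \<and> \<bar>X t \<omega>\<bar> \<le> 1 then (X t \<omega> - X s \<omega>)\<^sup>2 else 0) \<partial>M) \<le>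
      (\<integral>\<omega>. huber (X t \<omega>) \<partial>M) - (\<integral>\<omega>. huber (X s \<omega>) \<partial>M)" .
qed

text \<open>
The bound does not depend on \<open>\<epsilon>\<close> and involves only the \<open>L\<^sup>1\<close> norm of the terminal value. It is
proved for Riemann sums. Off the event that \<open>\<bar>X\<bar>\<close> exceeds 1 at one of the finitely many times
involved, a sum of squared increments over \<open>[s, s + \<epsilon>]\<close> is controlled by the increments of the
monotone function \<open>t \<mapsto> E huber(X\<^sub>t)\<close>, and the sum of these over a grid of mesh \<open>1 / n\<close> telescopes to
about \<open>\<epsilon> n\<close> boundary terms.
\<close>

lemma martingale_quadratic_variation_tail:
  assumes X: "martingale M F X" and cX: "continuous_process M X" and e: "0 < \<epsilon>" and d: "0 < \<delta>"
  shows "prob {\<omega>\<in>space M. covariation_approx X X \<epsilon> 1 \<omega> > \<delta>} \<le> (1 + 4 / \<delta>) * (\<integral>\<omega>. \<bar>X 1 \<omega>\<bar> \<partial>M)"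
proof -
  define c where "c = (\<integral>\<omega>. \<bar>X 1 \<omega>\<bar> \<partial>M)"
  define R where "R n \<omega> = riemann_cov (\<lambda>s. extend X s \<omega>) (\<lambda>s. extend X s \<omega>) \<epsilon> 1 n" for n \<omega>
  have Rm: "R n \<in> borel_measurable M" for n unfolding R_def by (rule measurable_riemann_cov[OF cX cX])
  define \<Phi> where "\<Phi> t = (\<integral>\<omega>. huber (X t \<omega>) \<partial>M)" for t
  have Phi0: "0 \<le> \<Phi> t" for t unfolding \<Phi>_def by (simp add: huber_nonneg)
  have Phi_mono: "\<Phi> s \<le> \<Phi> t" if "0 \<le> s" "s \<le> t" "t \<le> 1" for s t
  proof -
    have "0 \<le> (\<integral>\<omega>. (if \<bar>X s \<omega>\<bar> \<le> 1 \<and> \<bar>X t \<omega>\<bar> \<le> 1 then (X t \<omega> - X s \<omega>)\<^sup>2 else 0) \<partial>M)"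
      by (intro Bochner_Integration.integral_nonneg) auto
    with huber_increment(3)[OF X that] show ?thesis unfolding \<Phi>_def by linarith
  qed
  have one: "(1::real) \<in> {0..1}" by simp
  have Phi1: "\<Phi> 1 \<le> 2 * c"
  proof -
    have "\<Phi> 1 \<le> (\<integral>\<omega>. 2 * \<bar>X 1 \<omega>\<bar> \<partial>M)" unfolding \<Phi>_def
      using martingaleD(3)[OF X one] by (intro integral_mono huber_increment(1)[OF X, of 0] huber_le) auto
    then show ?thesis by (simp add: c_def)
  qed
  have main: "prob {\<omega>\<in>space M. R n \<omega> > \<delta>} \<le> (1 + 4 / \<delta>) * c" if n: "1 / \<epsilon> < real n" for n
  proof -
    have n0: "0 < real n" using n e by (meson divide_pos_pos less_trans zero_less_one)
    have ne: "1 < real n * \<epsilon>" using n e by (simp add: pos_divide_less_eq)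
    define s where "s k = real k * (1 / real n)" for k
    define u where "u k = min (s k + \<epsilon>) 1" for k
    have s: "0 \<le> s k" "s k \<le> u k" "u k \<le> 1" if "k < n" for k
      using that n0 e by (auto simp: s_def u_def field_simps)
    have ext: "extend X (s k) = X (s k)" "extend X (s k + \<epsilon>) = X (u k)" if "k < n" for k
      using s[OF that] e by (auto simp: extend_def u_def max_absorb1 min_absorb1)
    define T where "T = s ` {..<n} \<union> u ` {..<n}"
    have T: "finite T" "T \<subseteq> {0..1}" using s by (force simp: T_def)+
    define N where "N = {\<omega>\<in>space M. \<exists>t\<in>T. \<bar>X t \<omega>\<bar> > 1}"
    have T1: "t \<le> 1" if "t \<in> T" for t using T that by auto
    have N: "N \<in> sets (F 1)" "prob N \<le> (\<integral>\<omega>. indicator N \<omega> * \<bar>X 1 \<omega>\<bar> \<partial>M)"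
      unfolding N_def using doob_maximal_finite[OF X T one T1] by blast+
    have NM [measurable]: "N \<in> events" using N(1) subalg[of 1] by (auto simp: subalgebra_def)
    have "(\<integral>\<omega>. indicator N \<omega> * \<bar>X 1 \<omega>\<bar> \<partial>M) \<le> c" unfolding c_def
      using martingaleD(3)[OF X one] integrable_mult_indicator[OF NM, of "\<lambda>\<omega>. \<bar>X 1 \<omega>\<bar>"]
      by (intro integral_mono) (auto simp: indicator_def)
    with N have N: "prob N \<le> c" by simp
    define q where "q k \<omega> = (if \<bar>X (s k) \<omega>\<bar> \<le> 1 \<and> \<bar>X (u k) \<omega>\<bar> \<le> 1 then (X (u k) \<omega> - X (s k) \<omega>)\<^sup>2 else 0)" for k \<omega>
    have q: "integrable M (q k)" "(\<integral>\<omega>. q k \<omega> \<partial>M) \<le> \<Phi> (u k) - \<Phi> (s k)" if "k < n" for k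
      unfolding q_def \<Phi>_def using huber_increment(2,3)[OF X s[OF that]] by auto
    define Y where "Y \<omega> = 1 / \<epsilon> * (1 / real n * (\<Sum>k<n. q k \<omega>))" for \<omega>
    have Y: "integrable M Y" unfolding Y_def
      by (intro integrable_mult_right Bochner_Integration.integrable_sum q) auto
    define a where "a k = \<Phi> (min (s k) 1)" for k
    \<comment> \<open>the number of grid steps that covers a time span of length \<open>\<epsilon>\<close>; at most twice \<open>\<epsilon> n\<close> as \<open>\<epsilon> n > 1\<close>\<close>
    define m where "m = nat \<lceil>\<epsilon> * real n\<rceil>"
    have m: "\<epsilon> * real n \<le> real m" "real m \<le> 2 * (\<epsilon> * real n)"
      using ne by (auto simp: m_def mult.commute) linarith+
    have "(\<integral>\<omega>. Y \<omega> \<partial>M) = 1 / \<epsilon> * (1 / real n * (\<Sum>k<n. \<integral>\<omega>. q k \<omega> \<partial>M))"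
      unfolding Y_def using q by (simp add: Bochner_Integration.integral_sum)
    also have "\<dots> \<le> 1 / \<epsilon> * (1 / real n * (\<Sum>k<n. a (k + m) - a k))"
    proof (intro mult_left_mono sum_mono)
      fix k assume k: "k \<in> {..<n}"
      have "\<epsilon> \<le> real m * (1 / real n)" using m n0 by (simp add: field_simps)
      then have "u k \<le> min (s (k + m)) 1" by (auto simp: u_def s_def algebra_simps)
      then have "\<Phi> (u k) \<le> a (k + m)" unfolding a_def using s[of k] k by (intro Phi_mono) auto
      moreover have "a k = \<Phi> (s k)" using s[of k] k by (auto simp: a_def intro!: arg_cong[where f=\<Phi>])
      ultimately show "(\<integral>\<omega>. q k \<omega> \<partial>M) \<le> a (k + m) - a k" using q(2)[of k] k by auto
    qed (use e in auto)
    also have "\<dots> \<le> 1 / \<epsilon> * (1 / real n * (real m * (2 * c)))"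
    proof (intro mult_left_mono)
      have "a k \<le> \<Phi> 1" for k unfolding a_def using n0 by (intro Phi_mono) (auto simp: s_def)
      with Phi1 have "a k \<le> 2 * c" for k using order_trans by blast
      from sum_shift_le[of a "2 * c" m n, OF _ this] show "(\<Sum>k<n. a (k + m) - a k) \<le> real m * (2 * c)"
        by (simp add: sum_subtractf a_def Phi0)
    qed (use e in auto)
    also have "\<dots> \<le> 1 / \<epsilon> * (1 / real n * (2 * (\<epsilon> * real n) * (2 * c)))"
    proof -
      have "0 \<le> c" by (simp add: c_def)
      then show ?thesis using m e n0 by (intro mult_left_mono mult_right_mono) auto
    qed
    also have "\<dots> = 4 * c" using e n0 by simp
    finally have EY: "(\<integral>\<omega>. Y \<omega> \<partial>M) \<le> 4 * c" .
    have Y0: "0 \<le> Y \<omega>" for \<omega> unfolding Y_def using e by (intro mult_nonneg_nonneg sum_nonneg) (auto simp: q_def)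
    have [measurable]: "Y \<in> borel_measurable M" using Y by auto
    have "prob {\<omega>\<in>space M. Y \<omega> \<ge> \<delta>} \<le> (\<integral>\<omega>. Y \<omega> \<partial>M) / \<delta>"
      using integral_Markov_inequality_measure[OF Y, of "space M" \<delta>] Y0 d by simp
    also have "\<dots> \<le> 4 * c / \<delta>" using EY d by (intro divide_right_mono) auto
    finally have PY: "prob {\<omega>\<in>space M. Y \<omega> \<ge> \<delta>} \<le> 4 * c / \<delta>" .
    have "{\<omega>\<in>space M. R n \<omega> > \<delta>} \<subseteq> N \<union> {\<omega>\<in>space M. Y \<omega> \<ge> \<delta>}"
    proof
      fix \<omega> assume w: "\<omega> \<in> {\<omega>\<in>space M. R n \<omega> > \<delta>}"
      show "\<omega> \<in> N \<union> {\<omega>\<in>space M. Y \<omega> \<ge> \<delta>}"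
      proof (cases "\<omega> \<in> N")
        case False
        have "R n \<omega> = Y \<omega>" unfolding R_def riemann_cov_def Y_def s_def[symmetric]
        proof (intro arg_cong[where f="\<lambda>x. 1 / \<epsilon> * (1 / real n * x)"] sum.cong refl)
          fix k assume k: "k \<in> {..<n}"
          then have "s k \<in> T" "u k \<in> T" by (auto simp: T_def)
          then have "\<bar>X (s k) \<omega>\<bar> \<le> 1" "\<bar>X (u k) \<omega>\<bar> \<le> 1" using False w by (auto simp: N_def not_less)
          then show "(extend X (s k + \<epsilon>) \<omega> - extend X (s k) \<omega>) * (extend X (s k + \<epsilon>) \<omega> - extend X (s k) \<omega>) = q k \<omega>"
            using ext[of k] k by (simp add: q_def power2_eq_square)
        qed
        with w show ?thesis by auto
      qed simp
    qed
    then have "prob {\<omega>\<in>space M. R n \<omega> > \<delta>} \<le> prob (N \<union> {\<omega>\<in>space M. Y \<omega> \<ge> \<delta>})"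
      by (intro finite_measure_mono) auto
    also have "\<dots> \<le> prob N + prob {\<omega>\<in>space M. Y \<omega> \<ge> \<delta>}" by (intro measure_Un_le) auto
    also have "\<dots> \<le> c + 4 * c / \<delta>" using N PY by simp
    finally show ?thesis by (simp add: algebra_simps)
  qed
  obtain N0 :: nat where N0: "1 / \<epsilon> < real N0" using reals_Archimedean2 by blast
  show ?thesis unfolding c_def[symmetric]
  proof (rule prob_greater_le_of_tendsto[OF Rm])
    show "(\<lambda>n. R n \<omega>) \<longlonglongrightarrow> covariation_approx X X \<epsilon> 1 \<omega>" if w: "\<omega> \<in> space M" for \<omega>
      unfolding R_def covariation_approx_eq_path_cov[OF cX cX w]
      by (intro path_cov_riemann continuous_on_extend[OF cX w]) simp
    show "\<forall>\<^sub>F n in sequentially. prob {\<omega>\<in>space M. R n \<omega> > \<delta>} \<le> (1 + 4 / \<delta>) * c"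
      using eventually_ge_at_top[of N0]
    proof eventually_elim
      case (elim n)
      have "real N0 \<le> real n" using elim by simp
      then show ?case by (intro main) (use N0 in linarith)
    qed
  qed
qed

end

section \<open>The Brownian filtration and its independent increments\<close>

locale brownian = prob_space M for M :: "'a measure" +
  fixes W :: "real \<Rightarrow> 'a \<Rightarrow> real"
  assumes brownian_motion: "brownian_motion M W"
begin

abbreviation H :: "real \<Rightarrow> 'a measure" where "H \<equiv> augmented_filtration M W"

lemma continuous_W: "continuous_process M W"
  using brownian_motion by (simp add: brownian_motion_def)

lemma W_0: "AE \<omega> in M. W 0 \<omega> = 0"
  using brownian_motion by (simp add: brownian_motion_def)

lemma W_measurable: "t \<in> {0..1} \<Longrightarrow> W t \<in> borel_measurable M"
  by (rule continuous_processD(1)[OF continuous_W])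

sublocale filtered_prob_space M H
proof
  show "subalgebra M (H t)" for t
    by (rule subalgebra_augmented_filtration) (rule W_measurable)
  show "sets (H s) \<subseteq> sets (H t)" if "s \<le> t" for s t
    by (rule filtration.sets_F_mono[OF filtration_augmented_filtration that])
qed

lemma sets_H:
  "sets (H t) = sigma_sets (space M)
     ({W s -` B \<inter> space M | s B. s \<in> {0..1} \<and> s \<le> t \<and> B \<in> sets borel} \<union> null_sets M)"
  unfolding augmented_filtration_def by (rule sets_measure_of[OF augmented_filtration_generators])

lemma W_adapted:
  assumes "s \<in> {0..1}" "s \<le> t"
  shows "W s \<in> borel_measurable (H t)"
proof (rule measurableI)
  fix B :: "real set" assume "B \<in> sets borel"
  then show "W s -` B \<inter> space (H t) \<in> sets (H t)"
    unfolding space_F sets_H using assms by (intro sigma_sets.Basic) auto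
qed simp

lemma increment_measurable: "s \<in> {0..1} \<Longrightarrow> t \<in> {0..1} \<Longrightarrow> (\<lambda>\<omega>. W t \<omega> - W s \<omega>) \<in> borel_measurable M"
  by (intro borel_measurable_diff W_measurable)

definition cylinder :: "real set \<Rightarrow> (real \<Rightarrow> real set) \<Rightarrow> 'a set" where
  "cylinder J B = {\<omega>\<in>space M. \<forall>j\<in>J. W j \<omega> \<in> B j}"

text \<open>
Events that agree with a cylinder up to a null event. Including the null modifications makes this
class contain both kinds of generators of the augmented filtration while it stays closed under
intersections.
\<close>

definition cylinders :: "real \<Rightarrow> 'a set set" where
  "cylinders s = {A\<in>events. \<exists>J B. finite J \<and> J \<subseteq> {0..1} \<inter> {..s} \<and> (\<forall>j. B j \<in> sets borel) \<and>
     (AE \<omega> in M. \<omega> \<in> A \<longleftrightarrow> \<omega> \<in> cylinder J B)}"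

lemma cylinder_sets:
  assumes "finite J" "J \<subseteq> {0..1}" "\<And>j. B j \<in> sets borel"
  shows "cylinder J B \<in> events"
proof -
  have "{\<omega>\<in>space M. W j \<omega> \<in> B j} \<in> events" if "j \<in> J" for j
    using measurable_sets[OF W_measurable assms(3), of j j] that assms(2) by (auto simp: vimage_def Int_def conj_commute)
  then show ?thesis unfolding cylinder_def
    by (intro sets.sets_Collect_finite_All assms) auto
qed

lemma Int_stable_cylinders: "Int_stable (cylinders s)"
proof (rule Int_stableI)
  fix a b assume "a \<in> cylinders s" "b \<in> cylinders s"
  then obtain J B K C where
    J: "a \<in> events" "finite J" "J \<subseteq> {0..1} \<inter> {..s}" "\<forall>j. B j \<in> sets borel" "AE \<omega> in M. \<omega> \<in> a \<longleftrightarrow> \<omega> \<in> cylinder J B"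
    and K: "b \<in> events" "finite K" "K \<subseteq> {0..1} \<inter> {..s}" "\<forall>j. C j \<in> sets borel" "AE \<omega> in M. \<omega> \<in> b \<longleftrightarrow> \<omega> \<in> cylinder K C"
    unfolding cylinders_def by blast
  define D where "D j = (if j \<in> J then B j else UNIV) \<inter> (if j \<in> K then C j else UNIV)" for j
  have "cylinder J B \<inter> cylinder K C = cylinder (J \<union> K) D" by (auto simp: cylinder_def D_def)
  moreover have "AE \<omega> in M. \<omega> \<in> a \<inter> b \<longleftrightarrow> \<omega> \<in> cylinder J B \<inter> cylinder K C"
    using J(5) K(5) by eventually_elim auto
  moreover have "\<forall>j. D j \<in> sets borel" using J K by (auto simp: D_def)
  ultimately show "a \<inter> b \<in> cylinders s"
    unfolding cylinders_def using J K by (auto intro!: exI[of _ "J \<union> K"] exI[of _ D])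
qed

lemma sets_H_subset_cylinders:
  assumes s: "0 \<le> s"
  shows "sets (H s) \<subseteq> sigma_sets (space M) (cylinders s)"
  unfolding sets_H
proof (rule sigma_sets_mono', rule Un_least; rule subsetI)
  fix A assume "A \<in> {W r -` B \<inter> space M | r B. r \<in> {0..1} \<and> r \<le> s \<and> B \<in> sets borel}"
  then obtain r B where A: "A = W r -` B \<inter> space M" "r \<in> {0..1}" "r \<le> s" "B \<in> sets borel" by blast
  have "A = cylinder {r} (\<lambda>_. B)" using A by (auto simp: cylinder_def)
  then show "A \<in> cylinders s"
    unfolding cylinders_def using A measurable_sets[OF W_measurable A(4), of r]
    by (auto intro!: exI[of _ "{r}"] exI[of _ "\<lambda>_. B"])
next
  fix A assume A: "A \<in> null_sets M"
  have "cylinder {0} (\<lambda>_. {}) = {}" by (auto simp: cylinder_def)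
  then show "A \<in> cylinders s"
    unfolding cylinders_def using A s AE_not_in[OF A]
    by (auto intro!: exI[of _ "{0}"] exI[of _ "\<lambda>_. {}"])
qed

text \<open>
Arrange the times of \<open>J\<close> in increasing order after time 0. Since \<open>W\<^sub>0 = 0\<close> almost surely, the values
of \<open>W\<close> at these times are partial sums of increments, and the last increment is independent of them.
\<close>

lemma cylinder_indep_increment:
  assumes J: "finite J" "J \<subseteq> {0..1} \<inter> {..s}" and B: "\<And>j. B j \<in> sets borel"
    and st: "0 \<le> s" "s \<le> t" "t \<le> 1" and C: "C \<in> sets borel"
  shows "prob (cylinder J B \<inter> {\<omega>\<in>space M. W t \<omega> - W s \<omega> \<in> C}) =
    prob (cylinder J B) * prob {\<omega>\<in>space M. W t \<omega> - W s \<omega> \<in> C}"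
proof -
  define xs where "xs = sorted_list_of_set (insert 0 J)"
  define n where "n = length xs"
  define u where "u i = (if i < n then xs ! i else if i = n then s else t)" for i
  define X where "X i \<omega> = W (u (Suc i)) \<omega> - W (u i) \<omega>" for i \<omega>
  have xs: "set xs = insert 0 J" "sorted xs" using J unfolding xs_def by (simp_all only: set_sorted_list_of_set finite_insert sorted_sorted_list_of_set)
  have n0: "0 < n" unfolding n_def using xs(1) by (cases xs) auto
  have xs_bd: "0 \<le> xs ! i" "xs ! i \<le> s" if "i < n" for i
    using nth_mem[of i xs] that J st unfolding n_def[symmetric] xs(1) by auto
  have u0: "u 0 = 0"
  proof -
    have "0 \<in> set xs" using xs by simp
    then obtain i where "i < n" "xs ! i = 0" by (auto simp: in_set_conv_nth n_def)
    then have "xs ! 0 \<le> 0" using sorted_nth_mono[OF xs(2), of 0 i] by (simp add: n_def)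
    then show ?thesis using xs_bd(1)[of 0] n0 by (simp add: u_def)
  qed
  have mono: "u i \<le> u (Suc i)" if "i < Suc n" for i
    using that st xs_bd(2)[of i] sorted_nth_mono[OF xs(2), of i "Suc i"] by (auto simp: u_def n_def)
  have ind: "indep_vars (\<lambda>_. borel) X {..<Suc n}"
  proof -
    have "\<forall>(n::nat) u. 0 \<le> u 0 \<longrightarrow> u n \<le> 1 \<longrightarrow> (\<forall>i<n. u i \<le> u (Suc i)) \<longrightarrow>
        indep_vars (\<lambda>_. borel) (\<lambda>i \<omega>. W (u (Suc i)) \<omega> - W (u i) \<omega>) {..<n}"
      using brownian_motion unfolding brownian_motion_def by blast
    moreover have "0 \<le> u 0" "u (Suc n) \<le> 1" using u0 st by (auto simp: u_def)
    ultimately show ?thesis using mono unfolding X_def by blast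
  qed
  have I: "indep_var (PiM {..<n} (\<lambda>_. borel)) (\<lambda>\<omega>. restrict (\<lambda>i. X i \<omega>) {..<n})
     (PiM {n} (\<lambda>_. borel)) (\<lambda>\<omega>. restrict (\<lambda>i. X i \<omega>) {n})"
    by (rule indep_var_restrict[OF ind]) auto
  \<comment> \<open>the cylinder expressed through the increments\<close>
  define P where "P = {x\<in>space (PiM {..<n} (\<lambda>_. borel)). \<forall>k\<in>{..<n}. u k \<in> J \<longrightarrow> (\<Sum>i<k. x i :: real) \<in> B (u k)}"
  define Q where "Q = {x\<in>space (PiM {n} (\<lambda>_. borel)). x n \<in> C}"
  have P: "P \<in> sets (PiM {..<n} (\<lambda>_. borel))" unfolding P_def
  proof (intro sets.sets_Collect_finite_All sets.sets_Collect_imp)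
    fix k assume k: "k \<in> {..<n}"
    have "(\<lambda>x. \<Sum>i<k. x i) \<in> borel_measurable (PiM {..<n} (\<lambda>_. borel :: real measure))"
      using k by (intro borel_measurable_sum measurable_component_singleton) auto
    from measurable_sets[OF this B[of "u k"]]
    show "{x \<in> space (PiM {..<n} (\<lambda>_. borel)). (\<Sum>i<k. x i) \<in> B (u k)} \<in> sets (PiM {..<n} (\<lambda>_. borel))"
      by (simp add: vimage_def Int_def conj_commute)
  qed auto
  have Q: "Q \<in> sets (PiM {n} (\<lambda>_. borel))" unfolding Q_def
    using measurable_sets[OF measurable_component_singleton[of n "{n}" "\<lambda>_. borel"] C]
    by (simp add: vimage_def Int_def conj_commute)
  have D: "(\<lambda>\<omega>. restrict (\<lambda>i. X i \<omega>) {n}) -` Q \<inter> space M = {\<omega>\<in>space M. W t \<omega> - W s \<omega> \<in> C}"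
    by (auto simp: Q_def space_PiM X_def u_def)
  have tel: "(\<Sum>i<k. X i \<omega>) = W (u k) \<omega> - W 0 \<omega>" for k \<omega>
    unfolding X_def using sum_lessThan_telescope[of "\<lambda>i. W (u i) \<omega>" k] u0 by simp
  have uJ: "j \<in> J \<Longrightarrow> \<exists>k<n. u k = j" for j
  proof -
    assume "j \<in> J"
    then have "j \<in> set xs" using xs by simp
    then show "\<exists>k<n. u k = j" by (auto simp: in_set_conv_nth u_def n_def)
  qed
  \<comment> \<open>as \<open>W\<^sub>0 = 0\<close> holds almost surely, so does this description of the cylinder\<close>
  have E: "AE \<omega> in M. \<omega> \<in> (\<lambda>\<omega>. restrict (\<lambda>i. X i \<omega>) {..<n}) -` P \<inter> space M \<longleftrightarrow> \<omega> \<in> cylinder J B"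
    using W_0
  proof eventually_elim
    case (elim \<omega>)
    have "(\<Sum>i<k. restrict (\<lambda>i. X i \<omega>) {..<n} i) = W (u k) \<omega>" if "k < n" for k
      using tel[of \<omega> k] elim that by simp
    then show ?case using uJ by (auto simp: P_def cylinder_def space_PiM)
  qed
  have cy: "cylinder J B \<in> events" using J B by (intro cylinder_sets) auto
  have De: "{\<omega>\<in>space M. W t \<omega> - W s \<omega> \<in> C} \<in> events"
    using measurable_sets[OF increment_measurable[of s t] C] st by (simp add: vimage_def Int_def conj_commute)
  have Pe: "(\<lambda>\<omega>. restrict (\<lambda>i. X i \<omega>) {..<n}) -` P \<inter> space M \<in> events"
    using I P unfolding indep_var_eq by (auto intro: measurable_sets)
  have "prob (cylinder J B \<inter> {\<omega>\<in>space M. W t \<omega> - W s \<omega> \<in> C}) =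
     prob (((\<lambda>\<omega>. restrict (\<lambda>i. X i \<omega>) {..<n}) -` P \<inter> space M) \<inter> {\<omega>\<in>space M. W t \<omega> - W s \<omega> \<in> C})"
    using E by (intro finite_measure_eq_AE sets.Int cy De Pe) auto
  also have "\<dots> = prob ((\<lambda>\<omega>. restrict (\<lambda>i. X i \<omega>) {..<n}) -` P \<inter> space M) * prob {\<omega>\<in>space M. W t \<omega> - W s \<omega> \<in> C}"
    using indep_varD[OF I P Q] unfolding D[symmetric] by (simp add: vimage_def Int_def conj_commute conj_left_commute)
  also have "prob ((\<lambda>\<omega>. restrict (\<lambda>i. X i \<omega>) {..<n}) -` P \<inter> space M) = prob (cylinder J B)"
    using E by (intro finite_measure_eq_AE cy Pe) auto
  finally show ?thesis .
qed

lemma indep_increment: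
  assumes z: "\<zeta> \<in> borel_measurable (H s)" and st: "0 \<le> s" "s \<le> t" "t \<le> 1"
  shows "indep_var borel \<zeta> borel (\<lambda>\<omega>. W t \<omega> - W s \<omega>)"
proof -
  let ?D = "{(\<lambda>\<omega>. W t \<omega> - W s \<omega>) -` C \<inter> space M | C. C \<in> sets borel}"
  have Dm: "(\<lambda>\<omega>. W t \<omega> - W s \<omega>) \<in> borel_measurable M" using st by (intro increment_measurable) auto
  have De: "?D \<subseteq> events" using measurable_sets[OF Dm] by auto
  have "indep_set (cylinders s) ?D"
    unfolding indep_sets2_eq
  proof (intro conjI ballI De)
    show "cylinders s \<subseteq> events" by (auto simp: cylinders_def)
    fix a b assume "a \<in> cylinders s" "b \<in> ?D"
    then obtain J B C where J: "a \<in> events" "finite J" "J \<subseteq> {0..1} \<inter> {..s}" "\<forall>j. B j \<in> sets borel"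
      and ae: "AE \<omega> in M. \<omega> \<in> a \<longleftrightarrow> \<omega> \<in> cylinder J B"
      and C: "C \<in> sets borel" and b: "b = (\<lambda>\<omega>. W t \<omega> - W s \<omega>) -` C \<inter> space M"
      unfolding cylinders_def by blast
    have cy: "cylinder J B \<in> events" using J by (intro cylinder_sets) auto
    have be: "b \<in> events" unfolding b by (rule measurable_sets[OF Dm C])
    have b': "b = {\<omega>\<in>space M. W t \<omega> - W s \<omega> \<in> C}" unfolding b by auto
    have "prob (a \<inter> b) = prob (cylinder J B \<inter> b)"
      using ae by (intro finite_measure_eq_AE sets.Int cy be J) auto
    also have "\<dots> = prob (cylinder J B) * prob b"
      unfolding b' using J C st by (intro cylinder_indep_increment) auto
    also have "prob (cylinder J B) = prob a"
      using ae by (intro finite_measure_eq_AE cy J) auto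
    finally show "prob (a \<inter> b) = prob a * prob b" .
  qed
  moreover have "Int_stable ?D"
  proof (rule Int_stableI)
    fix a b assume "a \<in> ?D" "b \<in> ?D"
    then obtain B C where BC: "B \<in> sets borel" "C \<in> sets borel"
      "a = (\<lambda>\<omega>. W t \<omega> - W s \<omega>) -` B \<inter> space M" "b = (\<lambda>\<omega>. W t \<omega> - W s \<omega>) -` C \<inter> space M" by blast
    have "a \<inter> b = (\<lambda>\<omega>. W t \<omega> - W s \<omega>) -` (B \<inter> C) \<inter> space M" using BC by auto
    then show "a \<inter> b \<in> ?D" using BC sets.Int by blast
  qed
  ultimately have "indep_set (sigma_sets (space M) (cylinders s)) (sigma_sets (space M) ?D)"
    by (intro indep_set_sigma_sets Int_stable_cylinders)
  then have ind: "indep_set (sets (H s)) (sigma_sets (space M) ?D)"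
    using sets_H_subset_cylinders[OF st(1)] unfolding indep_sets2_eq by blast
  have "sigma_sets (space M) {\<zeta> -` A \<inter> space M | A. A \<in> sets borel} \<subseteq> sets (H s)"
    unfolding space_F[of s, symmetric]
    by (rule sets.sigma_sets_subset) (use measurable_sets[OF z] in auto)
  with ind have "indep_set (sigma_sets (space M) {\<zeta> -` A \<inter> space M | A. A \<in> sets borel}) (sigma_sets (space M) ?D)"
    unfolding indep_sets2_eq by blast
  then show ?thesis unfolding indep_var_eq using Dm measurable_F_M[OF z] by blast
qed

lemma integral_mult_increment:
  fixes \<zeta> :: "'a \<Rightarrow> real" and f :: "real \<Rightarrow> real"
  assumes z: "\<zeta> \<in> borel_measurable (H s)" and st: "0 \<le> s" "s \<le> t" "t \<le> 1"
    and zi: "integrable M \<zeta>" and f: "f \<in> borel_measurable borel" and fi: "integrable M (\<lambda>\<omega>. f (W t \<omega> - W s \<omega>))"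
  shows "integrable M (\<lambda>\<omega>. \<zeta> \<omega> * f (W t \<omega> - W s \<omega>))"
    "(\<integral>\<omega>. \<zeta> \<omega> * f (W t \<omega> - W s \<omega>) \<partial>M) = (\<integral>\<omega>. \<zeta> \<omega> \<partial>M) * (\<integral>\<omega>. f (W t \<omega> - W s \<omega>) \<partial>M)"
proof -
  have "indep_var borel (id \<circ> \<zeta>) borel (f \<circ> (\<lambda>\<omega>. W t \<omega> - W s \<omega>))"
    by (rule indep_var_compose[OF indep_increment[OF z st]]) (use f in auto)
  then have i: "indep_var borel \<zeta> borel (\<lambda>\<omega>. f (W t \<omega> - W s \<omega>))" by (simp add: comp_def)
  show "integrable M (\<lambda>\<omega>. \<zeta> \<omega> * f (W t \<omega> - W s \<omega>))"
    by (rule indep_var_integrable[OF i zi fi])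
  show "(\<integral>\<omega>. \<zeta> \<omega> * f (W t \<omega> - W s \<omega>) \<partial>M) = (\<integral>\<omega>. \<zeta> \<omega> \<partial>M) * (\<integral>\<omega>. f (W t \<omega> - W s \<omega>) \<partial>M)"
    by (rule indep_var_lebesgue_integral[OF i zi fi])
qed

text \<open>
The trigonometric moments are the real and imaginary part of the characteristic function of the
standard normal distribution.
\<close>

lemma increment_moments:
  assumes st: "0 \<le> s" "s \<le> t" "t \<le> 1"
  shows "integrable M (\<lambda>\<omega>. (W t \<omega> - W s \<omega>) ^ k)"
    "(\<integral>\<omega>. W t \<omega> - W s \<omega> \<partial>M) = 0"
    "(\<integral>\<omega>. (W t \<omega> - W s \<omega>)\<^sup>2 \<partial>M) = t - s"
    "(\<integral>\<omega>. (W t \<omega> - W s \<omega>) ^ 4 \<partial>M) = 3 * (t - s)\<^sup>2"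
    "(\<integral>\<omega>. cos (\<theta> * (W t \<omega> - W s \<omega>)) \<partial>M) = exp (- (\<theta>\<^sup>2 * (t - s) / 2))"
    "(\<integral>\<omega>. sin (\<theta> * (W t \<omega> - W s \<omega>)) \<partial>M) = 0"
proof -
  have "integrable M (\<lambda>\<omega>. (W t \<omega> - W s \<omega>) ^ k) \<and>
    (\<integral>\<omega>. W t \<omega> - W s \<omega> \<partial>M) = 0 \<and>
    (\<integral>\<omega>. (W t \<omega> - W s \<omega>)\<^sup>2 \<partial>M) = t - s \<and>
    (\<integral>\<omega>. (W t \<omega> - W s \<omega>) ^ 4 \<partial>M) = 3 * (t - s)\<^sup>2 \<and>
    (\<integral>\<omega>. cos (\<theta> * (W t \<omega> - W s \<omega>)) \<partial>M) = exp (- (\<theta>\<^sup>2 * (t - s) / 2)) \<and>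
    (\<integral>\<omega>. sin (\<theta> * (W t \<omega> - W s \<omega>)) \<partial>M) = 0"
  proof (cases "s = t")
    case True
    then show ?thesis by (simp add: prob_space power_0_left)
  next
    case False
    define \<sigma> where "\<sigma> = sqrt (t - s)"
    have sg: "0 < \<sigma>" "\<sigma>\<^sup>2 = t - s" using False st by (auto simp: \<sigma>_def)
    have d: "distributed M lborel (\<lambda>\<omega>. W t \<omega> - W s \<omega>) (normal_density 0 \<sigma>)"
      using brownian_motion st False unfolding brownian_motion_def \<sigma>_def by auto
    note di = distributed_integral[OF d, symmetric] distributed_integrable[OF d, symmetric]
    have k: "integrable M (\<lambda>\<omega>. (W t \<omega> - W s \<omega>) ^ k)"
      by (subst di(2)) (use integrable_normal_moment[OF sg(1), of 0 k] in auto)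
    have 1: "(\<integral>\<omega>. W t \<omega> - W s \<omega> \<partial>M) = 0"
      by (subst di(1)) (use integral_normal_moment_nz_1[OF sg(1), of 0] in auto)
    have 2: "(\<integral>\<omega>. (W t \<omega> - W s \<omega>)\<^sup>2 \<partial>M) = t - s"
      by (subst di(1)) (use integral_normal_moment_even[OF sg(1), of 0 1] sg in \<open>auto simp: fact_numeral\<close>)
    have 4: "(\<integral>\<omega>. (W t \<omega> - W s \<omega>) ^ 4 \<partial>M) = 3 * (t - s)\<^sup>2"
      by (subst di(1)) (use integral_normal_moment_even[OF sg(1), of 0 2] sg in \<open>auto simp: fact_numeral power_divide\<close>)
    have z: "distributed M lborel (\<lambda>\<omega>. (W t \<omega> - W s \<omega>) / \<sigma>) std_normal_density"
      using d normal_standard_normal_convert[OF sg(1), of "\<lambda>\<omega>. W t \<omega> - W s \<omega>" 0] by simp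
    note zi = distributed_integral[OF z, symmetric]
    interpret N: real_distribution std_normal_distribution by (rule real_dist_normal_dist)
    have "(\<integral>x. iexp (\<theta> * \<sigma> * x) \<partial>std_normal_distribution) = complex_of_real (exp (- ((\<theta> * \<sigma>)\<^sup>2) / 2))"
      using fun_cong[OF char_std_normal_distribution, of "\<theta> * \<sigma>"] by (simp add: char_def)
    then have re: "Re (\<integral>x. iexp (\<theta> * \<sigma> * x) \<partial>std_normal_distribution) = exp (- ((\<theta> * \<sigma>)\<^sup>2) / 2)"
       and im: "Im (\<integral>x. iexp (\<theta> * \<sigma> * x) \<partial>std_normal_distribution) = 0" by simp_all
    have ii: "integrable std_normal_distribution (\<lambda>x. iexp (\<theta> * \<sigma> * x))"
      by (rule N.integrable_iexp) auto
    have dens: "(\<integral>x. f x \<partial>std_normal_distribution) = (\<integral>x. std_normal_density x * f x \<partial>lborel)"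
      if "f \<in> borel_measurable borel" for f :: "real \<Rightarrow> real"
      using that by (subst integral_density) (auto simp: normal_density_nonneg)
    have c: "(\<integral>\<omega>. cos (\<theta> * (W t \<omega> - W s \<omega>)) \<partial>M) = exp (- (\<theta>\<^sup>2 * (t - s) / 2))"
    proof -
      have "(\<integral>\<omega>. cos (\<theta> * (W t \<omega> - W s \<omega>)) \<partial>M) = (\<integral>\<omega>. cos (\<theta> * \<sigma> * ((W t \<omega> - W s \<omega>) / \<sigma>)) \<partial>M)"
        using sg by simp
      also have "\<dots> = (\<integral>x. std_normal_density x * cos (\<theta> * \<sigma> * x) \<partial>lborel)"
        by (subst zi) auto
      also have "\<dots> = (\<integral>x. Re (iexp (\<theta> * \<sigma> * x)) \<partial>std_normal_distribution)"
        by (subst dens) (auto simp: exp_eq_polar cis.ctr)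
      also have "\<dots> = exp (- ((\<theta> * \<sigma>)\<^sup>2) / 2)" by (subst integral_Re[OF ii]) (rule re)
      finally show ?thesis using sg by (simp add: power_mult_distrib)
    qed
    have "(\<integral>\<omega>. sin (\<theta> * (W t \<omega> - W s \<omega>)) \<partial>M) = 0"
    proof -
      have "(\<integral>\<omega>. sin (\<theta> * (W t \<omega> - W s \<omega>)) \<partial>M) = (\<integral>\<omega>. sin (\<theta> * \<sigma> * ((W t \<omega> - W s \<omega>) / \<sigma>)) \<partial>M)"
        using sg by simp
      also have "\<dots> = (\<integral>x. std_normal_density x * sin (\<theta> * \<sigma> * x) \<partial>lborel)"
        by (subst zi) auto
      also have "\<dots> = (\<integral>x. Im (iexp (\<theta> * \<sigma> * x)) \<partial>std_normal_distribution)"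
        by (subst dens) (auto simp: exp_eq_polar cis.ctr)
      also have "\<dots> = 0" by (subst integral_Im[OF ii]) (rule im)
      finally show ?thesis .
    qed
    with k 1 2 4 c show ?thesis by blast
  qed
  then show "integrable M (\<lambda>\<omega>. (W t \<omega> - W s \<omega>) ^ k)"
    "(\<integral>\<omega>. W t \<omega> - W s \<omega> \<partial>M) = 0"
    "(\<integral>\<omega>. (W t \<omega> - W s \<omega>)\<^sup>2 \<partial>M) = t - s"
    "(\<integral>\<omega>. (W t \<omega> - W s \<omega>) ^ 4 \<partial>M) = 3 * (t - s)\<^sup>2"
    "(\<integral>\<omega>. cos (\<theta> * (W t \<omega> - W s \<omega>)) \<partial>M) = exp (- (\<theta>\<^sup>2 * (t - s) / 2))"
    "(\<integral>\<omega>. sin (\<theta> * (W t \<omega> - W s \<omega>)) \<partial>M) = 0" by blast+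
qed

end

section \<open>The quadratic variation of Brownian motion\<close>

context prob_space
begin

lemma integrable_mult_of_square:
  fixes x y :: "'a \<Rightarrow> real"
  assumes [measurable]: "x \<in> borel_measurable M" "y \<in> borel_measurable M"
    and i: "integrable M (\<lambda>\<omega>. (x \<omega>)\<^sup>2)" "integrable M (\<lambda>\<omega>. (y \<omega>)\<^sup>2)"
  shows "integrable M (\<lambda>\<omega>. x \<omega> * y \<omega>)"
    "\<bar>\<integral>\<omega>. x \<omega> * y \<omega> \<partial>M\<bar> \<le> ((\<integral>\<omega>. (x \<omega>)\<^sup>2 \<partial>M) + (\<integral>\<omega>. (y \<omega>)\<^sup>2 \<partial>M)) / 2"
proof -
  have b: "\<bar>a * b\<bar> \<le> (a\<^sup>2 + b\<^sup>2) / 2" for a b :: real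
    using zero_le_power2[of "\<bar>a\<bar> - \<bar>b\<bar>"] by (simp add: power2_diff abs_mult)
  have ii: "integrable M (\<lambda>\<omega>. ((x \<omega>)\<^sup>2 + (y \<omega>)\<^sup>2) / 2)" using i by simp
  show 1: "integrable M (\<lambda>\<omega>. x \<omega> * y \<omega>)"
    by (rule Bochner_Integration.integrable_bound[OF ii]) (use b in auto)
  have "\<bar>\<integral>\<omega>. x \<omega> * y \<omega> \<partial>M\<bar> \<le> (\<integral>\<omega>. \<bar>x \<omega> * y \<omega>\<bar> \<partial>M)" by simp
  also have "\<dots> \<le> (\<integral>\<omega>. ((x \<omega>)\<^sup>2 + (y \<omega>)\<^sup>2) / 2 \<partial>M)"
    using 1 ii b by (intro integral_mono) auto
  also have "\<dots> = ((\<integral>\<omega>. (x \<omega>)\<^sup>2 \<partial>M) + (\<integral>\<omega>. (y \<omega>)\<^sup>2 \<partial>M)) / 2" using i by simp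
  finally show "\<bar>\<integral>\<omega>. x \<omega> * y \<omega> \<partial>M\<bar> \<le> ((\<integral>\<omega>. (x \<omega>)\<^sup>2 \<partial>M) + (\<integral>\<omega>. (y \<omega>)\<^sup>2 \<partial>M)) / 2" .
qed

lemma integral_square_sum:
  fixes x :: "nat \<Rightarrow> 'a \<Rightarrow> real"
  assumes m: "\<And>k. k < n \<Longrightarrow> x k \<in> borel_measurable M"
    and i: "\<And>k. k < n \<Longrightarrow> integrable M (\<lambda>\<omega>. (x k \<omega>)\<^sup>2)"
  shows "integrable M (\<lambda>\<omega>. (\<Sum>k<n. x k \<omega>)\<^sup>2)"
    "(\<integral>\<omega>. (\<Sum>k<n. x k \<omega>)\<^sup>2 \<partial>M) = (\<Sum>k<n. \<Sum>l<n. \<integral>\<omega>. x k \<omega> * x l \<omega> \<partial>M)"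
proof -
  have e: "(\<lambda>\<omega>. (\<Sum>k<n. x k \<omega>)\<^sup>2) = (\<lambda>\<omega>. \<Sum>k<n. \<Sum>l<n. x k \<omega> * x l \<omega>)"
    by (simp add: power2_eq_square sum_product)
  have ii: "integrable M (\<lambda>\<omega>. x k \<omega> * x l \<omega>)" if "k < n" "l < n" for k l
    using that by (intro integrable_mult_of_square m i)
  show "integrable M (\<lambda>\<omega>. (\<Sum>k<n. x k \<omega>)\<^sup>2)"
    unfolding e by (intro Bochner_Integration.integrable_sum ii) auto
  show "(\<integral>\<omega>. (\<Sum>k<n. x k \<omega>)\<^sup>2 \<partial>M) = (\<Sum>k<n. \<Sum>l<n. \<integral>\<omega>. x k \<omega> * x l \<omega> \<partial>M)"
  proof -
    have "(\<integral>\<omega>. (\<Sum>k<n. x k \<omega>)\<^sup>2 \<partial>M) = (\<Sum>k<n. \<integral>\<omega>. (\<Sum>l<n. x k \<omega> * x l \<omega>) \<partial>M)"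
      unfolding e by (intro Bochner_Integration.integral_sum Bochner_Integration.integrable_sum ii) auto
    also have "\<dots> = (\<Sum>k<n. \<Sum>l<n. \<integral>\<omega>. x k \<omega> * x l \<omega> \<partial>M)"
      by (intro sum.cong refl Bochner_Integration.integral_sum ii) auto
    finally show ?thesis .
  qed
qed

end

lemma card_near_le:
  assumes "0 < c"
  shows "real (card {l\<in>{..<n}. \<bar>real k - real l\<bar> < c}) \<le> 2 * c + 1"
proof -
  define m where "m = nat \<lfloor>c\<rfloor>"
  have "{l\<in>{..<n}. \<bar>real k - real l\<bar> < c} \<subseteq> {k - m..k + m}"
  proof
    fix l assume "l \<in> {l\<in>{..<n}. \<bar>real k - real l\<bar> < c}"
    then have "real_of_int \<bar>int k - int l\<bar> < c" by simp
    then have "\<bar>int k - int l\<bar> \<le> \<lfloor>c\<rfloor>" by (simp add: le_floor_iff)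
    then show "l \<in> {k - m..k + m}" by (auto simp: m_def)
  qed
  then have "card {l\<in>{..<n}. \<bar>real k - real l\<bar> < c} \<le> card {k - m..k + m}" by (intro card_mono) auto
  also have "\<dots> \<le> 2 * m + 1" by simp
  finally have "card {l\<in>{..<n}. \<bar>real k - real l\<bar> < c} \<le> 2 * m + 1" .
  then have "real (card {l\<in>{..<n}. \<bar>real k - real l\<bar> < c}) \<le> 2 * real m + 1" by linarith
  moreover have "real m \<le> c" using assms by (simp add: m_def)
  ultimately show ?thesis by linarith
qed

context brownian
begin

text \<open>
The centred squared increments \<open>g\<^sub>s\<close> over \<open>[s, s + \<epsilon>]\<close> have second moment at most \<open>2 \<epsilon>\<^sup>2\<close> and are
uncorrelated when the intervals do not overlap. In the second moment of their time integral only
pairs of times at distance less than \<open>\<epsilon>\<close> remain, so that after division by \<open>\<epsilon>\<^sup>2\<close> it is of order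
\<open>\<epsilon>\<close>. Chebyshev's inequality for the Riemann sums gives the claim. The extra \<open>\<epsilon>\<close> in the event accounts
for the intervals cut off at time 1.
\<close>

lemma quadratic_variation_W_at:
  assumes t: "0 \<le> t" "t \<le> 1" and e: "0 < \<epsilon>" and d: "0 < \<delta>"
  shows "prob {\<omega>\<in>space M. \<bar>covariation_approx W W \<epsilon> t \<omega> - t\<bar> > \<delta> + \<epsilon>} \<le> 6 * \<epsilon> / \<delta>\<^sup>2"
proof (cases "t = 0")
  case True
  then have "covariation_approx W W \<epsilon> t \<omega> - t = 0" if "\<omega> \<in> space M" for \<omega>
    using that by (simp add: covariation_approx_eq_path_cov[OF continuous_W continuous_W] path_cov_def)
  then have emp: "{\<omega>\<in>space M. \<bar>covariation_approx W W \<epsilon> t \<omega> - t\<bar> > \<delta> + \<epsilon>} = {}" using e d by auto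
  show ?thesis unfolding emp using e by simp
next
  case False
  with t have t0: "0 < t" by simp
  define clip where "clip s = min (max s 0) (1::real)" for s
  define a where "a s = clip (s + \<epsilon>) - clip s" for s
  \<comment> \<open>the squared increment minus its mean \<open>a s\<close>\<close>
  define g where "g s \<omega> = (W (clip (s + \<epsilon>)) \<omega> - W (clip s) \<omega>)\<^sup>2 - a s" for s \<omega>
  have clip: "0 \<le> clip s" "clip s \<le> 1" "s \<le> r \<Longrightarrow> clip s \<le> clip r" for s r by (auto simp: clip_def)
  have a: "0 \<le> a s" "a s \<le> \<epsilon>" for s using e by (auto simp: a_def clip_def)
  have ca: "continuous_on S a" for S unfolding a_def clip_def by (intro continuous_intros)
  have mono: "clip s \<le> clip (s + \<epsilon>)" for s using e by (intro clip) auto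
  have Wm [measurable]: "W (clip s) \<in> borel_measurable M" for s by (rule W_measurable) (use clip in auto)
  have gm [measurable]: "g s \<in> borel_measurable M" for s unfolding g_def by measurable
  have Wi: "integrable M (\<lambda>\<omega>. (W (clip (s + \<epsilon>)) \<omega> - W (clip s) \<omega>) ^ k)" for s k
    by (rule increment_moments(1)[OF clip(1) mono clip(2)])
  have gi: "integrable M (g s)" for s unfolding g_def by (intro Bochner_Integration.integrable_diff Wi integrable_const)
  have g0: "(\<integral>\<omega>. g s \<omega> \<partial>M) = 0" for s
    unfolding g_def using Wi increment_moments(3)[OF clip(1) mono clip(2), of s]
    by (simp add: prob_space a_def)
  \<comment> \<open>expanded so that the fourth and second Gaussian moments apply\<close>
  have g2: "g s \<omega> ^ 2 = (W (clip (s + \<epsilon>)) \<omega> - W (clip s) \<omega>) ^ 4 - 2 * a s * (W (clip (s + \<epsilon>)) \<omega> - W (clip s) \<omega>)\<^sup>2 + (a s)\<^sup>2" for s \<omega>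
  proof -
    have "(y\<^sup>2 - b)\<^sup>2 = y ^ 4 - 2 * b * y\<^sup>2 + b\<^sup>2" for y b :: real
      by (simp add: power2_eq_square power4_eq_xxxx algebra_simps)
    then show ?thesis by (simp add: g_def)
  qed
  have g2i: "integrable M (\<lambda>\<omega>. (g s \<omega>)\<^sup>2)" for s
    unfolding g2 by (intro Bochner_Integration.integrable_diff Bochner_Integration.integrable_add integrable_mult_right Wi integrable_const)
  have g2e: "(\<integral>\<omega>. (g s \<omega>)\<^sup>2 \<partial>M) \<le> 2 * \<epsilon>\<^sup>2" for s
  proof -
    have "(\<integral>\<omega>. (g s \<omega>)\<^sup>2 \<partial>M) = 3 * (a s)\<^sup>2 - 2 * a s * a s + (a s)\<^sup>2"
      unfolding g2 using Wi increment_moments(3,4)[OF clip(1) mono clip(2), of s]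
      by (simp add: prob_space a_def)
    also have "\<dots> = 2 * (a s)\<^sup>2" by (simp add: power2_eq_square)
    also have "\<dots> \<le> 2 * \<epsilon>\<^sup>2" using a by (simp add: power_mono)
    finally show ?thesis .
  qed
  have gg: "(\<integral>\<omega>. g s \<omega> * g r \<omega> \<partial>M) = 0" if "s + \<epsilon> \<le> r" for s r
  proof -
    have c: "clip (s + \<epsilon>) \<le> clip r" using that by (rule clip(3))
    have "g s \<in> borel_measurable (H (clip r))"
      unfolding g_def using c mono[of s] clip
      by (intro borel_measurable_diff borel_measurable_power borel_measurable_const W_adapted) (auto intro: order_trans)
    from integral_mult_increment(2)[OF this clip(1) mono clip(2) gi, of "\<lambda>x. x\<^sup>2 - a r"] gi[of r]
    show ?thesis using g0 unfolding g_def by simp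
  qed
  define R where "R n \<omega> = 1 / \<epsilon> * (t / real n * (\<Sum>k<n. g (real k * (t / real n)) \<omega>))" for n \<omega>
  have main: "prob {\<omega>\<in>space M. \<bar>R n \<omega>\<bar> > \<delta>} \<le> 6 * \<epsilon> / \<delta>\<^sup>2" if n: "1 / \<epsilon> < real n" for n
  proof -
    have n0: "0 < real n" using n e by (meson divide_pos_pos less_trans zero_less_one)
    define h where "h = t / real n"
    have h: "0 < h" using t0 n0 by (simp add: h_def)
    define x where "x k = g (real k * h)" for k
    have x: "x k \<in> borel_measurable M" "integrable M (\<lambda>\<omega>. (x k \<omega>)\<^sup>2)" for k unfolding x_def by (rule gm, rule g2i)
    have xx: "(\<integral>\<omega>. x k \<omega> * x l \<omega> \<partial>M) \<le> (if \<bar>real k - real l\<bar> < \<epsilon> / h then 2 * \<epsilon>\<^sup>2 else 0)" for k l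
    proof (cases "\<bar>real k - real l\<bar> < \<epsilon> / h")
      case True
      have "(\<integral>\<omega>. x k \<omega> * x l \<omega> \<partial>M) \<le> ((\<integral>\<omega>. (x k \<omega>)\<^sup>2 \<partial>M) + (\<integral>\<omega>. (x l \<omega>)\<^sup>2 \<partial>M)) / 2"
        using integrable_mult_of_square(2)[OF x(1) x(1) x(2) x(2), of k l] by linarith
      also have "\<dots> \<le> 2 * \<epsilon>\<^sup>2" using g2e[of "real k * h"] g2e[of "real l * h"] by (simp add: x_def)
      finally show ?thesis using True by simp
    next
      case False
      then have "\<epsilon> \<le> \<bar>real k - real l\<bar> * h" using h by (simp add: not_less pos_divide_le_eq)
      then have "real k * h + \<epsilon> \<le> real l * h \<or> real l * h + \<epsilon> \<le> real k * h"
        by (auto simp: abs_if algebra_simps split: if_splits)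
      then have "(\<integral>\<omega>. x k \<omega> * x l \<omega> \<partial>M) = 0"
      proof
        assume "real l * h + \<epsilon> \<le> real k * h"
        from gg[OF this] show ?thesis by (simp add: x_def mult.commute)
      qed (simp add: x_def gg)
      then show ?thesis using False by simp
    qed
    have "(\<integral>\<omega>. (\<Sum>k<n. x k \<omega>)\<^sup>2 \<partial>M) = (\<Sum>k<n. \<Sum>l<n. \<integral>\<omega>. x k \<omega> * x l \<omega> \<partial>M)"
      by (rule integral_square_sum(2)) (rule x)+
    also have "\<dots> \<le> (\<Sum>k<n. \<Sum>l<n. if \<bar>real k - real l\<bar> < \<epsilon> / h then 2 * \<epsilon>\<^sup>2 else 0)"
      by (intro sum_mono xx)
    also have "\<dots> = (\<Sum>k<n. 2 * \<epsilon>\<^sup>2 * real (card {l\<in>{..<n}. \<bar>real k - real l\<bar> < \<epsilon> / h}))"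
      by (intro sum.cong refl) (simp add: sum.If_cases Int_def mult.commute)
    also have "\<dots> \<le> (\<Sum>k<n. 2 * \<epsilon>\<^sup>2 * (2 * (\<epsilon> / h) + 1))"
      using e h by (intro sum_mono mult_left_mono card_near_le) auto
    also have "\<dots> = real n * (2 * \<epsilon>\<^sup>2 * (2 * (\<epsilon> / h) + 1))" by simp
    finally have S: "(\<integral>\<omega>. (\<Sum>k<n. x k \<omega>)\<^sup>2 \<partial>M) \<le> real n * (2 * \<epsilon>\<^sup>2 * (2 * (\<epsilon> / h) + 1))" .
    have Ri: "integrable M (\<lambda>\<omega>. (R n \<omega>)\<^sup>2)" and RE: "(\<integral>\<omega>. (R n \<omega>)\<^sup>2 \<partial>M) \<le> 6 * \<epsilon>"
    proof -
      have R2: "(\<lambda>\<omega>. (R n \<omega>)\<^sup>2) = (\<lambda>\<omega>. (h / \<epsilon>)\<^sup>2 * (\<Sum>k<n. x k \<omega>)\<^sup>2)"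
        unfolding power_mult_distrib[symmetric] by (simp add: R_def x_def h_def mult.commute)
      show "integrable M (\<lambda>\<omega>. (R n \<omega>)\<^sup>2)" unfolding R2
        by (intro integrable_mult_right integral_square_sum(1) x)
      have "(\<integral>\<omega>. (R n \<omega>)\<^sup>2 \<partial>M) = (h / \<epsilon>)\<^sup>2 * (\<integral>\<omega>. (\<Sum>k<n. x k \<omega>)\<^sup>2 \<partial>M)" unfolding R2 by simp
      also have "\<dots> \<le> (h / \<epsilon>)\<^sup>2 * (real n * (2 * \<epsilon>\<^sup>2 * (2 * (\<epsilon> / h) + 1)))"
        by (intro mult_left_mono S) simp
      also have "\<dots> = (real n * h) * (4 * \<epsilon> + 2 * h)"
        using e h by (simp add: power2_eq_square field_simps)
      also have "\<dots> = t * (4 * \<epsilon> + 2 * h)" using n0 by (simp add: h_def)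
      also have "\<dots> \<le> 1 * (6 * \<epsilon>)"
      proof -
        have "h \<le> 1 / real n" using t n0 by (simp add: h_def divide_right_mono)
        also have "\<dots> \<le> \<epsilon>" using n e n0 by (simp add: field_simps)
        finally show ?thesis using e h t by (intro mult_mono) auto
      qed
      finally show "(\<integral>\<omega>. (R n \<omega>)\<^sup>2 \<partial>M) \<le> 6 * \<epsilon>" by simp
    qed
    have [measurable]: "R n \<in> borel_measurable M" unfolding R_def by measurable
    have "prob {\<omega>\<in>space M. \<bar>R n \<omega>\<bar> > \<delta>} \<le> prob {\<omega>\<in>space M. (R n \<omega>)\<^sup>2 \<ge> \<delta>\<^sup>2}"
      using d by (intro finite_measure_mono) (auto simp: abs_le_square_iff[symmetric])
    also have "\<dots> \<le> (\<integral>\<omega>. (R n \<omega>)\<^sup>2 \<partial>M) / \<delta>\<^sup>2"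
      using d by (intro integral_Markov_inequality_measure[OF Ri, of "space M"]) auto
    also have "\<dots> \<le> 6 * \<epsilon> / \<delta>\<^sup>2" using RE by (intro divide_right_mono) auto
    finally show ?thesis .
  qed
  define V where "V \<omega> = covariation_approx W W \<epsilon> t \<omega> - 1 / \<epsilon> * integral {0..t} a" for \<omega>
  have "prob {\<omega>\<in>space M. \<bar>V \<omega>\<bar> > \<delta>} \<le> 6 * \<epsilon> / \<delta>\<^sup>2"
  proof (rule prob_greater_le_of_tendsto)
    show "(\<lambda>\<omega>. \<bar>R n \<omega>\<bar>) \<in> borel_measurable M" for n unfolding R_def by measurable
    fix \<omega> assume w: "\<omega> \<in> space M"
    have cW: "continuous_on UNIV (\<lambda>s. extend W s \<omega>)" by (rule continuous_on_extend[OF continuous_W w])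
    have "(\<lambda>n. riemann_cov (\<lambda>s. extend W s \<omega>) (\<lambda>s. extend W s \<omega>) \<epsilon> t n -
      1 / \<epsilon> * (t / real n * (\<Sum>k<n. a (real k * (t / real n))))) \<longlonglongrightarrow> V \<omega>"
      unfolding V_def covariation_approx_eq_path_cov[OF continuous_W continuous_W w]
      by (intro tendsto_diff path_cov_riemann cW tendsto_mult_left riemann_sums_tendsto_integral ca) (use t in auto)
    moreover have "R n \<omega> = riemann_cov (\<lambda>s. extend W s \<omega>) (\<lambda>s. extend W s \<omega>) \<epsilon> t n -
      1 / \<epsilon> * (t / real n * (\<Sum>k<n. a (real k * (t / real n))))" for n
      by (simp add: R_def riemann_cov_def g_def extend_def clip_def power2_eq_square sum_subtractf right_diff_distrib)
    ultimately show "(\<lambda>n. \<bar>R n \<omega>\<bar>) \<longlonglongrightarrow> \<bar>V \<omega>\<bar>" by (intro tendsto_rabs) simp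
  next
    obtain N0 :: nat where N0: "1 / \<epsilon> < real N0" using reals_Archimedean2 by blast
    show "\<forall>\<^sub>F n in sequentially. prob {\<omega>\<in>space M. \<bar>R n \<omega>\<bar> > \<delta>} \<le> 6 * \<epsilon> / \<delta>\<^sup>2"
      using eventually_ge_at_top[of N0]
    proof eventually_elim
      case (elim n)
      have "real N0 \<le> real n" using elim by simp
      then show ?case by (intro main) (use N0 in linarith)
    qed
  qed
  moreover have "\<bar>1 / \<epsilon> * integral {0..t} a - t\<bar> \<le> \<epsilon>"
  proof -
    have ai: "a integrable_on S" if "S = {x..y}" for S x y unfolding that by (intro integrable_continuous_real ca)
    have di: "(\<lambda>s. \<epsilon> - a s) integrable_on {x..y}" for x y
      by (intro integrable_continuous_real continuous_on_diff continuous_on_const ca)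
    have 1: "integral {0..t} (\<lambda>s. \<epsilon> - a s) = \<epsilon> * t - integral {0..t} a"
      using t by (subst Henstock_Kurzweil_Integration.integral_diff) (auto intro: ai)
    have 2: "0 \<le> integral {0..t} (\<lambda>s. \<epsilon> - a s)"
      by (intro integral_nonneg di) (use a in auto)
    have 3: "integral {0..t} (\<lambda>s. \<epsilon> - a s) \<le> \<epsilon> * \<epsilon>"
    proof (cases "t \<le> 1 - \<epsilon>")
      case True
      then have "integral {0..t} (\<lambda>s. \<epsilon> - a s) = integral {0..t} (\<lambda>s. 0)"
        by (intro integral_cong) (use e in \<open>auto simp: a_def clip_def\<close>)
      then show ?thesis using e by simp
    next
      case False
      define b where "b = max 0 (1 - \<epsilon>)"
      have b: "0 \<le> b" "b \<le> t" "t - b \<le> \<epsilon>" using False t e by (auto simp: b_def)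
      have "integral {0..b} (\<lambda>s. \<epsilon> - a s) = 0"
      proof (cases "b = 0")
        case False
        then have "integral {0..b} (\<lambda>s. \<epsilon> - a s) = integral {0..b} (\<lambda>s. 0)"
          by (intro integral_cong) (use e in \<open>auto simp: a_def clip_def b_def\<close>)
        then show ?thesis by simp
      qed simp
      moreover have "integral {b..t} (\<lambda>s. \<epsilon> - a s) \<le> integral {b..t} (\<lambda>s. \<epsilon>)"
        by (intro integral_le di) (use a in auto)
      moreover have "integral {b..t} (\<lambda>s. \<epsilon>) \<le> \<epsilon> * \<epsilon>" using b e by simp
      ultimately show ?thesis using Henstock_Kurzweil_Integration.integral_combine[OF b(1,2) di] by linarith
    qed
    have "1 / \<epsilon> * integral {0..t} a - t = - (1 / \<epsilon> * integral {0..t} (\<lambda>s. \<epsilon> - a s))"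
      unfolding 1 using e by (simp add: field_simps)
    moreover have "0 \<le> 1 / \<epsilon> * integral {0..t} (\<lambda>s. \<epsilon> - a s)" using 2 e by simp
    moreover have "1 / \<epsilon> * integral {0..t} (\<lambda>s. \<epsilon> - a s) \<le> \<epsilon>" using 3 e by (simp add: pos_divide_le_eq)
    ultimately show ?thesis by linarith
  qed
  moreover have "{\<omega>\<in>space M. \<bar>covariation_approx W W \<epsilon> t \<omega> - t\<bar> > \<delta> + \<epsilon>} \<subseteq> {\<omega>\<in>space M. \<bar>V \<omega>\<bar> > \<delta>}"
    if "\<bar>1 / \<epsilon> * integral {0..t} a - t\<bar> \<le> \<epsilon>" using that by (auto simp: V_def)
  moreover have "{\<omega>\<in>space M. \<bar>V \<omega>\<bar> > \<delta>} \<in> events"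
  proof -
    have [measurable]: "covariation_approx W W \<epsilon> t \<in> borel_measurable M"
      using t by (intro continuous_processD(1)[OF continuous_process_covariation_approx[OF continuous_W continuous_W]]) auto
    show ?thesis unfolding V_def by measurable
  qed
  ultimately show ?thesis using finite_measure_mono order_trans by meson
qed

text \<open>
The approximations and their limit \<open>t\<close> are monotone in \<open>t\<close>, so closeness on a finite grid implies
uniform closeness.
\<close>

lemma has_covariation_W: "has_covariation M W W (\<lambda>t _. t)"
proof -
  let ?Q = "covariation_approx W W"
  have id: "continuous_process M (\<lambda>t _. t)" by (auto simp: continuous_process_def)
  have Q: "continuous_process M (?Q \<epsilon>)" for \<epsilon>
    by (rule continuous_process_covariation_approx[OF continuous_W continuous_W])
  have "ucp_limit M ?Q (\<lambda>t _. t)"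
  proof (rule ucp_limitI[OF _ Q id])
    fix \<delta> :: real assume d: "0 < \<delta>"
    obtain m :: nat where m: "4 / \<delta> < real m" using reals_Archimedean2 by blast
    have m0: "0 < real m" using m d by (meson divide_pos_pos less_trans zero_less_numeral)
    have m': "1 / real m < \<delta> / 4" using m m0 d by (simp add: field_simps)
    define r where "r = min (\<delta> / 4) (\<delta> / (real (Suc m) * (6 / (\<delta>/4)\<^sup>2)))"
    have r: "0 < r" using d by (auto simp: r_def)
    have "\<forall>\<^sub>F \<epsilon> in at_right 0. \<epsilon> \<in> {0<..<r}" by (rule eventually_at_right_real[OF r])
    then show "\<forall>\<^sub>F \<epsilon> in at_right 0. prob (exceed M (\<lambda>t \<omega>. ?Q \<epsilon> t \<omega> - t) \<delta>) < \<delta>"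
    proof eventually_elim
      case (elim \<epsilon>)
      then have e: "0 < \<epsilon>" "\<epsilon> < \<delta> / 4" "\<epsilon> < \<delta> / (real (Suc m) * (6 / (\<delta>/4)\<^sup>2))" by (auto simp: r_def)
      define E where "E i = {\<omega>\<in>space M. \<bar>?Q \<epsilon> (real i / real m) \<omega> - real i / real m\<bar> > \<delta> / 4 + \<epsilon>}" for i :: nat
      have im: "0 \<le> real i / real m" "real i / real m \<le> 1" if "i \<le> m" for i using that m0 by auto
      have E: "E i \<in> events" if "i \<le> m" for i
      proof -
        have [measurable]: "?Q \<epsilon> (real i / real m) \<in> borel_measurable M"
          using im[OF that] by (intro continuous_processD(1)[OF Q]) auto
        show ?thesis unfolding E_def by measurable
      qed
      have "exceed M (\<lambda>t \<omega>. ?Q \<epsilon> t \<omega> - t) \<delta> \<subseteq> (\<Union>i\<le>m. E i)"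
      proof
        fix \<omega> assume "\<omega> \<in> exceed M (\<lambda>t \<omega>. ?Q \<epsilon> t \<omega> - t) \<delta>"
        then obtain t where w: "\<omega> \<in> space M" and t: "0 \<le> t" "t \<le> 1" "\<bar>?Q \<epsilon> t \<omega> - t\<bar> > \<delta>" by (auto simp: exceed_def)
        have mono: "?Q \<epsilon> s \<omega> \<le> ?Q \<epsilon> s' \<omega>" if "s \<le> s'" for s s'
          unfolding covariation_approx_eq_path_cov[OF continuous_W continuous_W w]
          by (rule path_cov_mono[OF continuous_on_extend[OF continuous_W w] e(1) that])
        \<comment> \<open>the grid points next to \<open>t\<close> on either side\<close>
        define j where "j = nat \<lfloor>t * real m\<rfloor>"
        define i where "i = nat \<lceil>t * real m\<rceil>"
        have tm: "0 \<le> t * real m" "t * real m \<le> real m" using t by (auto intro: mult_left_le_one_le)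
        have ji: "real j \<le> t * real m" "t * real m \<le> real j + 1" "t * real m \<le> real i" "real i \<le> t * real m + 1" "i \<le> m" "j \<le> m"
          using tm by (auto simp: j_def i_def nat_le_iff floor_le_iff ceiling_le_iff)
        have "real j / real m \<le> t" "t - real j / real m \<le> 1 / real m" "t \<le> real i / real m" "real i / real m - t \<le> 1 / real m"
        proof -
          have "t - real j / real m = (t * real m - real j) / real m" "real i / real m - t = (real i - t * real m) / real m"
            using m0 by (simp_all add: field_simps)
          then show "t - real j / real m \<le> 1 / real m" "real i / real m - t \<le> 1 / real m"
            using ji m0 by (auto intro!: divide_right_mono)
          show "real j / real m \<le> t" "t \<le> real i / real m" using ji m0 by (auto simp: field_simps)
        qed
        then have b: "real j / real m \<le> t" "t - real j / real m \<le> \<delta> / 4" "t \<le> real i / real m" "real i / real m - t \<le> \<delta> / 4"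
          using m' by linarith+
        show "\<omega> \<in> (\<Union>i\<le>m. E i)"
        proof (rule ccontr)
          assume "\<omega> \<notin> (\<Union>i\<le>m. E i)"
          then have "\<bar>?Q \<epsilon> (real i / real m) \<omega> - real i / real m\<bar> \<le> \<delta> / 4 + \<epsilon>" "\<bar>?Q \<epsilon> (real j / real m) \<omega> - real j / real m\<bar> \<le> \<delta> / 4 + \<epsilon>"
            using ji w by (auto simp: E_def not_less)
          with mono[OF b(1)] mono[OF b(3)] b t e show False by linarith
        qed
      qed
      then have "prob (exceed M (\<lambda>t \<omega>. ?Q \<epsilon> t \<omega> - t) \<delta>) \<le> prob (\<Union>i\<le>m. E i)"
        using E by (intro finite_measure_mono sets.finite_UN) auto
      also have "\<dots> \<le> (\<Sum>i\<le>m. prob (E i))" using E by (intro finite_measure_subadditive_finite) auto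
      also have "\<dots> \<le> (\<Sum>i\<le>m. 6 * \<epsilon> / (\<delta>/4)\<^sup>2)"
        unfolding E_def using im e d by (intro sum_mono quadratic_variation_W_at) auto
      also have "\<dots> = \<epsilon> * (real (Suc m) * (6 / (\<delta>/4)\<^sup>2))" by simp
      also have "\<dots> < \<delta>"
      proof -
        have "0 < real (Suc m) * (6 / (\<delta>/4)\<^sup>2)" using d by (intro mult_pos_pos) auto
        with e(3) show ?thesis by (simp only: pos_less_divide_eq)
      qed
      finally show ?case .
    qed
  qed
  then show ?thesis using continuous_W id by (simp add: has_covariation_def)
qed

end

section \<open>Simple processes\<close>

context filtered_prob_space
begin

lemma martingaleI:
  assumes ad: "adapted F X" and i: "\<And>t. t \<in> {0..1} \<Longrightarrow> integrable M (X t)"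
    and eq: "\<And>s t A. 0 \<le> s \<Longrightarrow> s \<le> t \<Longrightarrow> t \<le> 1 \<Longrightarrow> A \<in> sets (F s) \<Longrightarrow>
      (\<integral>\<omega>. indicator A \<omega> * X t \<omega> \<partial>M) = (\<integral>\<omega>. indicator A \<omega> * X s \<omega> \<partial>M)"
  shows "martingale M F X"
  unfolding martingale_def
proof (intro conjI allI impI ballI ad i)
  fix s t :: real assume st: "0 \<le> s" "s \<le> t" "t \<le> 1"
  interpret S: sigma_finite_subalgebra M "F s" by (rule sigma_finite_F)
  show "AE \<omega> in M. real_cond_exp M (F s) (X t) \<omega> = X s \<omega>"
  proof (rule S.real_cond_exp_charact)
    show "(\<integral>x\<in>A. X t x \<partial>M) = (\<integral>x\<in>A. X s x \<partial>M)" if "A \<in> sets (F s)" for A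
      using eq[OF st that] by (simp add: set_lebesgue_integral_def)
  qed (use st i ad in \<open>auto simp: adapted_def\<close>)
qed

lemma martingale_indicator_integral:
  assumes "martingale M F X" "0 \<le> s" "s \<le> t" "t \<le> 1" "A \<in> sets (F s)"
  shows "integrable M (\<lambda>\<omega>. indicator A \<omega> * X t \<omega>)" "integrable M (\<lambda>\<omega>. indicator A \<omega> * X s \<omega>)"
    "(\<integral>\<omega>. indicator A \<omega> * X t \<omega> \<partial>M) = (\<integral>\<omega>. indicator A \<omega> * X s \<omega> \<partial>M)"
  using martingale_integral[OF assms(1-4), of "indicator A" 1] assms(5) by (auto simp: indicator_def[abs_def])

lemma martingale_add:
  assumes X: "martingale M F X" and Y: "martingale M F Y"
  shows "martingale M F (\<lambda>t \<omega>. X t \<omega> + Y t \<omega>)"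
proof (rule martingaleI)
  show "adapted F (\<lambda>t \<omega>. X t \<omega> + Y t \<omega>)"
    using martingaleD(1)[OF X] martingaleD(1)[OF Y] by (auto simp: adapted_def intro!: borel_measurable_add)
  show "integrable M (\<lambda>\<omega>. X t \<omega> + Y t \<omega>)" if "t \<in> {0..1}" for t
    using martingaleD(3)[OF X that] martingaleD(3)[OF Y that] by simp
  fix s t A assume *: "0 \<le> s" "s \<le> t" "t \<le> 1" "A \<in> sets (F s)"
  note martingale_indicator_integral[OF X *] martingale_indicator_integral[OF Y *]
  then show "(\<integral>\<omega>. indicator A \<omega> * (X t \<omega> + Y t \<omega>) \<partial>M) = (\<integral>\<omega>. indicator A \<omega> * (X s \<omega> + Y s \<omega>) \<partial>M)"
    by (simp add: distrib_left)
qed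

lemma martingale_diff:
  assumes X: "martingale M F X" and Y: "martingale M F Y"
  shows "martingale M F (\<lambda>t \<omega>. X t \<omega> - Y t \<omega>)"
proof (rule martingaleI)
  show "adapted F (\<lambda>t \<omega>. X t \<omega> - Y t \<omega>)"
    using martingaleD(1)[OF X] martingaleD(1)[OF Y] by (auto simp: adapted_def intro!: borel_measurable_diff)
  show "integrable M (\<lambda>\<omega>. X t \<omega> - Y t \<omega>)" if "t \<in> {0..1}" for t
    using martingaleD(3)[OF X that] martingaleD(3)[OF Y that] by simp
  fix s t A assume *: "0 \<le> s" "s \<le> t" "t \<le> 1" "A \<in> sets (F s)"
  note martingale_indicator_integral[OF X *] martingale_indicator_integral[OF Y *]
  then show "(\<integral>\<omega>. indicator A \<omega> * (X t \<omega> - Y t \<omega>) \<partial>M) = (\<integral>\<omega>. indicator A \<omega> * (X s \<omega> - Y s \<omega>) \<partial>M)"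
    by (simp add: right_diff_distrib)
qed

end

context brownian
begin

lemma increment_integrable: "0 \<le> s \<Longrightarrow> s \<le> t \<Longrightarrow> t \<le> 1 \<Longrightarrow> integrable M (\<lambda>\<omega>. W t \<omega> - W s \<omega>)"
  using increment_moments(1)[of s t 1] by simp

lemma integral_mult_W_increment:
  assumes z: "\<zeta> \<in> borel_measurable (H s)" "integrable M \<zeta>" and st: "0 \<le> s" "s \<le> t" "t \<le> 1"
  shows "integrable M (\<lambda>\<omega>. \<zeta> \<omega> * (W t \<omega> - W s \<omega>))" "(\<integral>\<omega>. \<zeta> \<omega> * (W t \<omega> - W s \<omega>) \<partial>M) = 0"
  using integral_mult_increment[OF z(1) st z(2), of "\<lambda>x. x"] increment_integrable[OF st] increment_moments(2)[OF st] by auto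

lemma bounded_integrable:
  assumes "\<xi> \<in> borel_measurable M" "\<And>\<omega>. \<omega> \<in> space M \<Longrightarrow> \<bar>\<xi> \<omega>\<bar> \<le> K"
  shows "integrable M (\<xi> :: 'a \<Rightarrow> real)"
  by (rule integrable_const_bound[of _ K]) (use assms in auto)

text \<open>
Stochastic integrals of step processes, up to a constant. The inductive form lets every property
be checked on a single increment of \<open>W\<close> multiplied by a variable known at its left end.
\<close>

inductive simple_process :: "(real \<Rightarrow> 'a \<Rightarrow> real) \<Rightarrow> bool" where
  const: "simple_process (\<lambda>_ _. c)"
| increment: "0 \<le> a \<Longrightarrow> a \<le> b \<Longrightarrow> b \<le> 1 \<Longrightarrow> \<xi> \<in> borel_measurable (H a) \<Longrightarrow>
    (\<And>\<omega>. \<omega> \<in> space M \<Longrightarrow> \<bar>\<xi> \<omega>\<bar> \<le> K) \<Longrightarrow>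
    simple_process (\<lambda>t \<omega>. \<xi> \<omega> * (W (min t b) \<omega> - W (min t a) \<omega>))"
| add: "simple_process X \<Longrightarrow> simple_process Y \<Longrightarrow> simple_process (\<lambda>t \<omega>. X t \<omega> + Y t \<omega>)"

lemma simple_process_cmult: "simple_process X \<Longrightarrow> simple_process (\<lambda>t \<omega>. c * X t \<omega>)"
proof (induction rule: simple_process.induct)
  case (increment a b \<xi> K)
  have "simple_process (\<lambda>t \<omega>. (c * \<xi> \<omega>) * (W (min t b) \<omega> - W (min t a) \<omega>))"
    using increment by (intro simple_process.increment[of a b _ "\<bar>c\<bar> * K"]) (auto simp: abs_mult mult_left_mono)
  then show ?case by (simp add: mult.assoc)
next
  case (add X Y)
  from simple_process.add[OF add.IH] show ?case by (simp add: distrib_left)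
qed (rule simple_process.const)

lemma simple_process_sum:
  "(\<And>k. k < n \<Longrightarrow> simple_process (X k)) \<Longrightarrow> simple_process (\<lambda>t \<omega>. \<Sum>k<(n::nat). X k t \<omega>)"
proof (induction n)
  case 0
  then show ?case using simple_process.const[of 0] by simp
next
  case (Suc n)
  then have "simple_process (\<lambda>t \<omega>. (\<Sum>k<n. X k t \<omega>) + X n t \<omega>)" by (intro simple_process.add) auto
  then show ?case by simp
qed

lemma simple_process_continuous: "simple_process X \<Longrightarrow> continuous_process M X"
proof (induction rule: simple_process.induct)
  case (increment a b \<xi> K)
  then show ?case
    by (intro continuous_process_cmult continuous_process_diff continuous_process_stop continuous_W
        measurable_F_M[of \<xi> a]) auto
qed (auto intro: continuous_process_const continuous_process_add)

lemma simple_process_martingale: "simple_process X \<Longrightarrow> martingale M H X"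
proof (induction rule: simple_process.induct)
  case (const c)
  show ?case by (rule martingaleI) (auto simp: adapted_def)
next
  case (increment a b \<xi> K)
  let ?X = "\<lambda>t \<omega>. \<xi> \<omega> * (W (min t b) \<omega> - W (min t a) \<omega>)"
  note ab = increment(1,2,3) and xi = increment(4,5)
  have xiM: "\<xi> \<in> borel_measurable M" using measurable_F_M[OF xi(1)] .
  have zero: "?X t = (\<lambda>_. 0)" if "t \<le> a" for t using that ab by (simp add: min_absorb1)
  show ?case
  proof (rule martingaleI)
    show "adapted H ?X" unfolding adapted_def
    proof
      fix t :: real assume t: "t \<in> {0..1}"
      show "?X t \<in> borel_measurable (H t)"
      proof (cases "t \<le> a")
        case True
        show ?thesis unfolding zero[OF True] by simp
      next
        case False
        then show ?thesis using t ab
          by (intro borel_measurable_times borel_measurable_diff W_adapted measurable_F_mono[OF _ xi(1)]) auto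
      qed
    qed
  next
    fix t :: real assume t: "t \<in> {0..1}"
    show "integrable M (?X t)"
    proof (cases "t \<le> a")
      case True
      show ?thesis unfolding zero[OF True] by simp
    next
      case False
      then show ?thesis
        using integral_mult_W_increment(1)[OF xi(1) bounded_integrable[OF xiM xi(2)], of "min t b"] t ab
        by (simp add: min_absorb2)
    qed
  next
    fix s t A assume st: "0 \<le> s" "s \<le> t" "t \<le> 1" and A: "A \<in> sets (H s)"
    define s' where "s' = max (min s b) a"
    define t' where "t' = max (min t b) a"
    have s't': "0 \<le> s'" "s' \<le> t'" "t' \<le> 1" using st ab by (auto simp: s'_def t'_def)
    have X: "?X r \<omega> = \<xi> \<omega> * (W (max (min r b) a) \<omega> - W a \<omega>)" for r \<omega>
      using ab by (auto simp: min_def max_def)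
    have AM: "A \<in> events" using A subalg[of s] by (auto simp: subalgebra_def)
    have bd: "integrable M (\<lambda>\<omega>. indicator A \<omega> * \<xi> \<omega>)"
      using integrable_mult_indicator[OF AM bounded_integrable[OF xiM xi(2)]] by simp
    have diff: "integrable M (\<lambda>\<omega>. (indicator A \<omega> * \<xi> \<omega>) * (W t' \<omega> - W s' \<omega>)) \<and>
      (\<integral>\<omega>. (indicator A \<omega> * \<xi> \<omega>) * (W t' \<omega> - W s' \<omega>) \<partial>M) = 0"
    proof (cases "s' = t'")
      case False
      then have sb: "s \<le> s'" using st ab by (auto simp: s'_def t'_def)
      have "(\<lambda>\<omega>. indicator A \<omega> * \<xi> \<omega>) \<in> borel_measurable (H s')"
        using measurable_F_mono[OF _ xi(1), of s'] A mono[OF sb] by (intro borel_measurable_times borel_measurable_indicator) (auto simp: s'_def)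
      with integral_mult_W_increment[OF this bd s't'] show ?thesis by blast
    qed simp
    have Xs: "integrable M (\<lambda>\<omega>. indicator A \<omega> * ?X s \<omega>)"
    proof (cases "s \<le> a")
      case True
      show ?thesis unfolding zero[OF True, THEN fun_cong] by simp
    next
      case False
      then have "(\<lambda>\<omega>. indicator A \<omega> * ?X s \<omega>) = (\<lambda>\<omega>. indicator A \<omega> *\<^sub>R (\<xi> \<omega> * (W (min s b) \<omega> - W a \<omega>)))"
        by (simp add: min_absorb2)
      moreover have "integrable M (\<lambda>\<omega>. \<xi> \<omega> * (W (min s b) \<omega> - W a \<omega>))"
        using st ab False by (intro integral_mult_W_increment(1)[OF xi(1) bounded_integrable[OF xiM xi(2)]]) auto
      ultimately show ?thesis using integrable_mult_indicator[OF AM] by metis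
    qed
    have "(\<integral>\<omega>. indicator A \<omega> * ?X t \<omega> \<partial>M) =
      (\<integral>\<omega>. indicator A \<omega> * ?X s \<omega> + (indicator A \<omega> * \<xi> \<omega>) * (W t' \<omega> - W s' \<omega>) \<partial>M)"
      unfolding X s'_def t'_def by (intro Bochner_Integration.integral_cong) (auto simp: algebra_simps)
    also have "\<dots> = (\<integral>\<omega>. indicator A \<omega> * ?X s \<omega> \<partial>M)"
      using Xs diff by (subst Bochner_Integration.integral_add) auto
    finally show "(\<integral>\<omega>. indicator A \<omega> * ?X t \<omega> \<partial>M) = (\<integral>\<omega>. indicator A \<omega> * ?X s \<omega> \<partial>M)" .
  qed
next
  case (add X Y)
  then show ?case by (intro martingale_add)
qed

text \<open>
By induction, using that covariations are compatible with stopping, bounded factors and sums. The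
second conjunct records that nothing but 0 can arise from \<open>[X,W] = 0\<close>.
\<close>

lemma covariation_simple_process:
  assumes XW: "has_covariation M X W A" and N: "simple_process N"
  shows "\<exists>B. has_covariation M X N B \<and> (A = (\<lambda>_ _. 0) \<longrightarrow> B = (\<lambda>_ _. 0))"
  using N
proof (induction rule: simple_process.induct)
  case (const c)
  have "has_covariation M X (\<lambda>_ _. c) (\<lambda>_ _. 0)"
    using XW by (intro has_covariation_commute[OF has_covariation_const]) (auto simp: has_covariation_def)
  then show ?case by blast
next
  case (increment a b \<xi> K)
  let ?B = "\<lambda>t \<omega>. \<xi> \<omega> * (A (min t b) \<omega> - A (min t a) \<omega>)"
  have ab: "a \<in> {0..1}" "b \<in> {0..1}" using increment by auto
  have stop: "has_covariation M (\<lambda>t. W (min t b)) X (\<lambda>t. A (min t b))"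
    "has_covariation M (\<lambda>t. W (min t a)) X (\<lambda>t. A (min t a))"
    using has_covariation_stop[OF XW ab(2)] has_covariation_stop[OF XW ab(1)] has_covariation_commute by blast+
  have "has_covariation M X (\<lambda>t \<omega>. \<xi> \<omega> * (W (min t b) \<omega> - W (min t a) \<omega>)) ?B"
    by (rule has_covariation_commute[OF has_covariation_cmult[OF has_covariation_diff[OF stop]
        measurable_F_M[OF increment(4)] increment(5)]])
  then show ?case by (intro exI[of _ ?B]) auto
next
  case (add Y Z)
  then obtain B C where BC: "has_covariation M X Y B" "A = (\<lambda>_ _. 0) \<longrightarrow> B = (\<lambda>_ _. 0)"
    "has_covariation M X Z C" "A = (\<lambda>_ _. 0) \<longrightarrow> C = (\<lambda>_ _. 0)" by blast
  have "has_covariation M X (\<lambda>t \<omega>. Y t \<omega> + Z t \<omega>) (\<lambda>t \<omega>. B t \<omega> + C t \<omega>)"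
    by (rule has_covariation_commute[OF has_covariation_add[OF has_covariation_commute[OF BC(1)] has_covariation_commute[OF BC(3)]]])
  with BC show ?case by (intro exI[of _ "\<lambda>t \<omega>. B t \<omega> + C t \<omega>"]) auto
qed

lemma covariation_simple_processes_exists:
  assumes "simple_process N" "simple_process N'"
  shows "\<exists>A. has_covariation M N N' A"
proof -
  obtain B where "has_covariation M W N B" using covariation_simple_process[OF has_covariation_W assms(1)] by blast
  then have "has_covariation M N W B" by (rule has_covariation_commute)
  from covariation_simple_process[OF this assms(2)] show ?thesis by blast
qed

end

section \<open>Approximation of random variables by simple processes\<close>

text \<open>
The left-hand side is the modulus of the real part of \<open>e\<^sup>i\<^sup>a (e\<^sup>i\<^sup>x - 1 - i x)\<close>.
\<close>

lemma cos_second_order: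
  fixes a x :: real
  shows "\<bar>cos (a + x) - cos a + x * sin a\<bar> \<le> x\<^sup>2 / 2"
proof -
  have "norm (cis a * (iexp x - (1 + \<i> * x))) \<le> x\<^sup>2 / 2"
    using iexp_approx1[of x 1] by (simp add: norm_mult power2_eq_square)
  moreover have "cos (a + x) - cos a + x * sin a = Re (cis a * (iexp x - (1 + \<i> * x)))"
    by (simp add: cos_add exp_eq_polar cis.ctr algebra_simps)
  ultimately show ?thesis
    using abs_Re_le_cmod[of "cis a * (iexp x - (1 + \<i> * x))"] by linarith
qed

context brownian
begin

text \<open>
Membership in the \<open>L\<^sup>1\<close> closure of the terminal values of simple processes.
\<close>

definition approximable :: "('a \<Rightarrow> real) \<Rightarrow> bool" where
  "approximable Y \<longleftrightarrow> integrable M Y \<and>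
     (\<forall>\<delta>>0. \<exists>N. simple_process N \<and> (\<integral>\<omega>. \<bar>Y \<omega> - N 1 \<omega>\<bar> \<partial>M) < \<delta>)"

lemma simple_process_integrable: "simple_process N \<Longrightarrow> integrable M (N 1)"
  using martingaleD(3)[OF simple_process_martingale, of N 1] by simp

lemma approximableD:
  assumes "approximable Y"
  shows "integrable M Y" and "Y \<in> borel_measurable M"
    and "0 < \<delta> \<Longrightarrow> \<exists>N. simple_process N \<and> (\<integral>\<omega>. \<bar>Y \<omega> - N 1 \<omega>\<bar> \<partial>M) < \<delta>"
  using assms by (auto simp: approximable_def)

lemma L1_triangle:
  fixes X Y Z :: "'a \<Rightarrow> real"
  assumes "integrable M X" "integrable M Y" "integrable M Z"
  shows "(\<integral>\<omega>. \<bar>X \<omega> - Z \<omega>\<bar> \<partial>M) \<le> (\<integral>\<omega>. \<bar>X \<omega> - Y \<omega>\<bar> \<partial>M) + (\<integral>\<omega>. \<bar>Y \<omega> - Z \<omega>\<bar> \<partial>M)"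
proof -
  have "(\<integral>\<omega>. \<bar>X \<omega> - Z \<omega>\<bar> \<partial>M) \<le> (\<integral>\<omega>. \<bar>X \<omega> - Y \<omega>\<bar> + \<bar>Y \<omega> - Z \<omega>\<bar> \<partial>M)"
    using assms by (intro integral_mono) auto
  also have "\<dots> = (\<integral>\<omega>. \<bar>X \<omega> - Y \<omega>\<bar> \<partial>M) + (\<integral>\<omega>. \<bar>Y \<omega> - Z \<omega>\<bar> \<partial>M)"
    using assms by (intro Bochner_Integration.integral_add) auto
  finally show ?thesis .
qed

lemma approximable_closed:
  assumes Y: "integrable M Y"
    and near: "\<And>\<delta>. 0 < \<delta> \<Longrightarrow> \<exists>Y'. approximable Y' \<and> (\<integral>\<omega>. \<bar>Y \<omega> - Y' \<omega>\<bar> \<partial>M) < \<delta>"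
  shows "approximable Y"
  unfolding approximable_def
proof (intro conjI allI impI Y)
  fix \<delta> :: real assume "0 < \<delta>"
  then have d: "0 < \<delta> / 2" by simp
  from near[OF d] obtain Y' where Y': "approximable Y'" "(\<integral>\<omega>. \<bar>Y \<omega> - Y' \<omega>\<bar> \<partial>M) < \<delta> / 2" by blast
  from approximableD(3)[OF Y'(1) d] obtain N where N: "simple_process N" "(\<integral>\<omega>. \<bar>Y' \<omega> - N 1 \<omega>\<bar> \<partial>M) < \<delta> / 2" by blast
  have "(\<integral>\<omega>. \<bar>Y \<omega> - N 1 \<omega>\<bar> \<partial>M) < \<delta>"
    using L1_triangle[OF Y approximableD(1)[OF Y'(1)] simple_process_integrable[OF N(1)]] Y' N by linarith
  with N show "\<exists>N. simple_process N \<and> (\<integral>\<omega>. \<bar>Y \<omega> - N 1 \<omega>\<bar> \<partial>M) < \<delta>" by blast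
qed

lemma approximable_simple: "simple_process N \<Longrightarrow> approximable (N 1)"
  using simple_process_integrable by (auto simp: approximable_def intro!: exI[of _ N])

lemma approximable_const: "approximable (\<lambda>_. c)"
  using approximable_simple[OF simple_process.const[of c]] by simp

lemma approximable_add:
  assumes "approximable X" "approximable Y"
  shows "approximable (\<lambda>\<omega>. X \<omega> + Y \<omega>)"
  unfolding approximable_def
proof (intro conjI allI impI)
  note i = approximableD(1)[OF assms(1)] approximableD(1)[OF assms(2)]
  show "integrable M (\<lambda>\<omega>. X \<omega> + Y \<omega>)" using i by simp
  fix \<delta> :: real assume "0 < \<delta>"
  then have d: "0 < \<delta> / 2" by simp
  from approximableD(3)[OF assms(1) d] obtain N where N: "simple_process N" "(\<integral>\<omega>. \<bar>X \<omega> - N 1 \<omega>\<bar> \<partial>M) < \<delta> / 2" by blast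
  from approximableD(3)[OF assms(2) d] obtain N' where N': "simple_process N'" "(\<integral>\<omega>. \<bar>Y \<omega> - N' 1 \<omega>\<bar> \<partial>M) < \<delta> / 2" by blast
  note j = simple_process_integrable[OF N(1)] simple_process_integrable[OF N'(1)]
  have "(\<integral>\<omega>. \<bar>X \<omega> + Y \<omega> - (N 1 \<omega> + N' 1 \<omega>)\<bar> \<partial>M) \<le> (\<integral>\<omega>. \<bar>X \<omega> - N 1 \<omega>\<bar> + \<bar>Y \<omega> - N' 1 \<omega>\<bar> \<partial>M)"
    using i j by (intro integral_mono) auto
  also have "\<dots> = (\<integral>\<omega>. \<bar>X \<omega> - N 1 \<omega>\<bar> \<partial>M) + (\<integral>\<omega>. \<bar>Y \<omega> - N' 1 \<omega>\<bar> \<partial>M)"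
    using i j by (intro Bochner_Integration.integral_add) auto
  finally show "\<exists>N. simple_process N \<and> (\<integral>\<omega>. \<bar>X \<omega> + Y \<omega> - N 1 \<omega>\<bar> \<partial>M) < \<delta>"
    using N N' simple_process.add[OF N(1) N'(1)] by (intro exI[of _ "\<lambda>t \<omega>. N t \<omega> + N' t \<omega>"]) auto
qed

lemma approximable_cmult:
  assumes "approximable X"
  shows "approximable (\<lambda>\<omega>. c * X \<omega>)"
  unfolding approximable_def
proof (intro conjI allI impI)
  show "integrable M (\<lambda>\<omega>. c * X \<omega>)" using approximableD(1)[OF assms] by simp
  fix \<delta> :: real assume d: "0 < \<delta>"
  define k where "k = \<bar>c\<bar> + 1"
  have k: "0 < k" "\<bar>c\<bar> \<le> k" by (auto simp: k_def)
  from approximableD(3)[OF assms, of "\<delta> / k"] d k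
  obtain N where N: "simple_process N" "(\<integral>\<omega>. \<bar>X \<omega> - N 1 \<omega>\<bar> \<partial>M) < \<delta> / k" by auto
  have "(\<integral>\<omega>. \<bar>c * X \<omega> - c * N 1 \<omega>\<bar> \<partial>M) = \<bar>c\<bar> * (\<integral>\<omega>. \<bar>X \<omega> - N 1 \<omega>\<bar> \<partial>M)"
    by (simp flip: right_diff_distrib add: abs_mult)
  also have "\<dots> \<le> k * (\<integral>\<omega>. \<bar>X \<omega> - N 1 \<omega>\<bar> \<partial>M)" using k by (intro mult_right_mono) auto
  also have "\<dots> < \<delta>" using N k by (simp add: pos_less_divide_eq mult.commute)
  finally show "\<exists>N. simple_process N \<and> (\<integral>\<omega>. \<bar>c * X \<omega> - N 1 \<omega>\<bar> \<partial>M) < \<delta>"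
    using simple_process_cmult[OF N(1), of c] by (intro exI[of _ "\<lambda>t \<omega>. c * N t \<omega>"]) auto
qed

lemma approximable_diff: "approximable X \<Longrightarrow> approximable Y \<Longrightarrow> approximable (\<lambda>\<omega>. X \<omega> - Y \<omega>)"
  using approximable_add[of X "\<lambda>\<omega>. (-1) * Y \<omega>"] approximable_cmult[of Y "-1"] by simp

lemma approximable_sum: "finite I \<Longrightarrow> (\<And>i. i \<in> I \<Longrightarrow> approximable (X i)) \<Longrightarrow> approximable (\<lambda>\<omega>. \<Sum>i\<in>I. X i \<omega>)"
  by (induction I rule: finite_induct) (auto intro: approximable_const approximable_add)

lemma approximable_cong_AE:
  assumes X: "approximable X" and Y: "Y \<in> borel_measurable M" and ae: "AE \<omega> in M. X \<omega> = Y \<omega>"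
  shows "approximable Y"
proof (rule approximable_closed)
  note [measurable] = approximableD(2)[OF X] Y
  show "integrable M Y"
    using approximableD(1)[OF X] ae by (subst integrable_cong_AE[of _ _ X]) auto
  have "(\<integral>\<omega>. \<bar>Y \<omega> - X \<omega>\<bar> \<partial>M) = (\<integral>\<omega>. 0 \<partial>M)"
    using ae by (intro integral_cong_AE) auto
  then show "\<exists>Y'. approximable Y' \<and> (\<integral>\<omega>. \<bar>Y \<omega> - Y' \<omega>\<bar> \<partial>M) < \<delta>" if "0 < \<delta>" for \<delta>
    using X that by (intro exI[of _ X]) auto
qed

lemma approximable_dominated:
  assumes X: "\<And>n. approximable (X n)" and Y: "Y \<in> borel_measurable M"
    and K: "\<And>n \<omega>. \<omega> \<in> space M \<Longrightarrow> \<bar>X n \<omega>\<bar> \<le> w \<omega>" "integrable M w"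
    and lim: "\<And>\<omega>. \<omega> \<in> space M \<Longrightarrow> (\<lambda>n. X n \<omega>) \<longlonglongrightarrow> Y \<omega>"
  shows "approximable Y"
proof (rule approximable_closed)
  note [measurable] = approximableD(2)[OF X] Y
  show Yi: "integrable M Y"
    by (rule integrable_dominated_convergence[of Y M X w]) (use K lim in auto)
  have "(\<lambda>n. \<integral>\<omega>. \<bar>Y \<omega> - X n \<omega>\<bar> \<partial>M) \<longlonglongrightarrow> (\<integral>\<omega>. 0 \<partial>M)"
  proof (rule integral_dominated_convergence[where w="\<lambda>\<omega>. \<bar>Y \<omega>\<bar> + w \<omega>"])
    show "integrable M (\<lambda>\<omega>. \<bar>Y \<omega>\<bar> + w \<omega>)" using Yi K by simp
    show "AE \<omega> in M. (\<lambda>n. \<bar>Y \<omega> - X n \<omega>\<bar>) \<longlonglongrightarrow> 0"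
    proof (rule AE_I2)
      fix \<omega> assume "\<omega> \<in> space M"
      from tendsto_rabs[OF tendsto_diff[OF tendsto_const[of "Y \<omega>"] lim[OF this]]]
      show "(\<lambda>n. \<bar>Y \<omega> - X n \<omega>\<bar>) \<longlonglongrightarrow> 0" by simp
    qed
    show "AE \<omega> in M. norm \<bar>Y \<omega> - X n \<omega>\<bar> \<le> \<bar>Y \<omega>\<bar> + w \<omega>" for n
    proof (rule AE_I2)
      fix \<omega> assume "\<omega> \<in> space M"
      from K(1)[OF this, of n] show "norm \<bar>Y \<omega> - X n \<omega>\<bar> \<le> \<bar>Y \<omega>\<bar> + w \<omega>" by (simp add: abs_if split: if_splits)
    qed
  qed auto
  then have lim0: "(\<lambda>n. \<integral>\<omega>. \<bar>Y \<omega> - X n \<omega>\<bar> \<partial>M) \<longlonglongrightarrow> 0" by simp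
  fix \<delta> :: real assume "0 < \<delta>"
  from eventually_happens'[OF _ order_tendstoD(2)[OF lim0 this]]
  obtain n where "(\<integral>\<omega>. \<bar>Y \<omega> - X n \<omega>\<bar> \<partial>M) < \<delta>" by auto
  with X show "\<exists>Y'. approximable Y' \<and> (\<integral>\<omega>. \<bar>Y \<omega> - Y' \<omega>\<bar> \<partial>M) < \<delta>" by blast
qed

text \<open>
With \<open>c\<^sub>t = exp(- \<theta>\<^sup>2 (u - t) / 2)\<close>, the variable is \<open>\<xi>\<close> times the increment over \<open>[s, u]\<close> of the
martingale \<open>c\<^sub>t cos(\<theta> W\<^sub>t + \<alpha>)\<close>. Split it into \<open>n\<close> increments. The first-order Taylor term of each
is a multiple of an increment of \<open>W\<close>, and these terms make up a simple process. The remainders are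
again martingale increments, hence orthogonal, and their second moments are of order \<open>n\<^sup>-\<^sup>2\<close>, so
their sum tends to 0 in \<open>L\<^sup>2\<close>.
\<close>

lemma cosine_martingale_step:
  assumes xi: "\<xi> \<in> borel_measurable (H s)" "\<And>\<omega>. \<omega> \<in> space M \<Longrightarrow> \<bar>\<xi> \<omega>\<bar> \<le> K" and su: "0 \<le> s" "s \<le> u" "u \<le> 1"
  shows "approximable (\<lambda>\<omega>. \<xi> \<omega> * (cos (\<theta> * W u \<omega> + \<alpha>) - exp (- (\<theta>\<^sup>2 * (u - s) / 2)) * cos (\<theta> * W s \<omega> + \<alpha>)))"
proof -
  define Y where "Y \<omega> = \<xi> \<omega> * (cos (\<theta> * W u \<omega> + \<alpha>) - exp (- (\<theta>\<^sup>2 * (u - s) / 2)) * cos (\<theta> * W s \<omega> + \<alpha>))" for \<omega>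
  have su01: "s \<in> {0..1}" "u \<in> {0..1}" using su by auto
  obtain \<omega>0 where "\<omega>0 \<in> space M" using not_empty by blast
  with xi(2)[of \<omega>0] have K0: "0 \<le> K" by linarith
  note [measurable] = measurable_F_M[OF xi(1)] W_measurable[OF su01(1)] W_measurable[OF su01(2)]
  have Ym [measurable]: "Y \<in> borel_measurable M" unfolding Y_def by measurable
  have step: "\<exists>N. simple_process N \<and> integrable M (\<lambda>\<omega>. (Y \<omega> - N 1 \<omega>)\<^sup>2) \<and>
      (\<integral>\<omega>. (Y \<omega> - N 1 \<omega>)\<^sup>2 \<partial>M) \<le> 2 * K\<^sup>2 * \<theta> ^ 4 / real n" if n: "0 < n" for n :: nat
  proof -
    define h where "h = (u - s) / real n"
    have h: "0 \<le> h" "real n * h = u - s" using su n by (auto simp: h_def)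
    have h1: "h \<le> 1 / real n" unfolding h_def using su by (intro divide_right_mono) auto
    define \<tau> where "\<tau> j = s + real j * h" for j
    have tau: "0 \<le> \<tau> j" "s \<le> \<tau> j" for j using su h by (auto simp: \<tau>_def)
    have tau_mono: "i \<le> j \<Longrightarrow> \<tau> i \<le> \<tau> j" for i j using h by (auto simp: \<tau>_def intro!: mult_right_mono)
    have tau_le: "\<tau> j \<le> u" if "j \<le> n" for j using tau_mono[OF that] h by (simp add: \<tau>_def)
    have tau01: "\<tau> j \<in> {0..1}" if "j \<le> n" for j using tau[of j] tau_le[OF that] su by auto
    have tau_Suc: "\<tau> (Suc j) - \<tau> j = h" "\<tau> j \<le> \<tau> (Suc j)" for j using h by (auto simp: \<tau>_def algebra_simps)
    define c where "c j = exp (- (\<theta>\<^sup>2 * (u - \<tau> j) / 2))" for j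
    define e where "e = exp (- (\<theta>\<^sup>2 * h / 2))"
    have c: "0 \<le> c j" "c j \<le> 1" if "j \<le> n" for j using tau_le[OF that] by (auto simp: c_def)
    have c_Suc: "c j = c (Suc j) * e" for j
      unfolding c_def e_def using tau_Suc[of j] by (simp add: exp_add[symmetric] field_simps)
    define A where "A j \<omega> = \<theta> * W (\<tau> j) \<omega> + \<alpha>" for j \<omega>
    define \<Delta> where "\<Delta> j \<omega> = W (\<tau> (Suc j)) \<omega> - W (\<tau> j) \<omega>" for j \<omega>
    define r where "r j \<omega> = cos (A j \<omega> + \<theta> * \<Delta> j \<omega>) - e * cos (A j \<omega>) + \<theta> * \<Delta> j \<omega> * sin (A j \<omega>)" for j \<omega>
    define x where "x j \<omega> = \<xi> \<omega> * c (Suc j) * r j \<omega>" for j \<omega>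
    \<comment> \<open>the first-order Taylor terms: the derivative of the cosine at the left end of each interval, with the weight \<open>c\<close> of its right end\<close>
    define N where "N = (\<lambda>t \<omega>. \<Sum>j<n. (- (\<xi> \<omega> * c (Suc j) * \<theta> * sin (A j \<omega>))) * (W (min t (\<tau> (Suc j))) \<omega> - W (min t (\<tau> j)) \<omega>))"
    have AH: "A j \<in> borel_measurable (H (\<tau> j))" if "j \<le> n" for j
      unfolding A_def using W_adapted[OF tau01[OF that] order_refl] by measurable
    have xiH: "\<xi> \<in> borel_measurable (H (\<tau> j))" for j by (rule measurable_F_mono[OF tau(2) xi(1)])
    have N: "simple_process N"
      unfolding N_def
    proof (intro simple_process_sum simple_process.increment)
      fix j assume j: "j < n"
      show "(\<lambda>\<omega>. - (\<xi> \<omega> * c (Suc j) * \<theta> * sin (A j \<omega>))) \<in> borel_measurable (H (\<tau> j))"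
      proof -
        have [measurable]: "A j \<in> borel_measurable (H (\<tau> j))" "\<xi> \<in> borel_measurable (H (\<tau> j))"
          using AH[of j] xiH[of j] j by auto
        show ?thesis by measurable
      qed
      show "0 \<le> \<tau> j" "\<tau> j \<le> \<tau> (Suc j)" "\<tau> (Suc j) \<le> 1" using tau tau_Suc tau01[of "Suc j"] j by auto
      fix \<omega> assume w: "\<omega> \<in> space M"
      have "\<bar>\<xi> \<omega>\<bar> * \<bar>c (Suc j)\<bar> * \<bar>\<theta>\<bar> * \<bar>sin (A j \<omega>)\<bar> \<le> K * 1 * \<bar>\<theta>\<bar> * 1"
        using xi(2)[OF w] c[of "Suc j"] j K0 by (intro mult_mono) auto
      then show "\<bar>- (\<xi> \<omega> * c (Suc j) * \<theta> * sin (A j \<omega>))\<bar> \<le> K * \<bar>\<theta>\<bar>" by (simp add: abs_mult)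
    qed
    have "Y \<omega> - N 1 \<omega> = (\<Sum>j<n. x j \<omega>)" for \<omega>
    proof -
      have AS: "A (Suc j) \<omega> = A j \<omega> + \<theta> * \<Delta> j \<omega>" for j by (simp add: A_def \<Delta>_def algebra_simps)
      have "Y \<omega> = \<xi> \<omega> * (c n * cos (A n \<omega>) - c 0 * cos (A 0 \<omega>))"
        using h by (simp add: Y_def c_def A_def \<tau>_def)
      also have "\<dots> = \<xi> \<omega> * (\<Sum>j<n. c (Suc j) * cos (A (Suc j) \<omega>) - c j * cos (A j \<omega>))"
        using sum_lessThan_telescope[of "\<lambda>j. c j * cos (A j \<omega>)" n] by simp
      also have "\<dots> = (\<Sum>j<n. \<xi> \<omega> * c (Suc j) * (cos (A j \<omega> + \<theta> * \<Delta> j \<omega>) - e * cos (A j \<omega>)))"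
        unfolding AS[symmetric] sum_distrib_left
        by (intro sum.cong refl) (subst (2) c_Suc, simp add: algebra_simps)
      finally have Y': "Y \<omega> = (\<Sum>j<n. \<xi> \<omega> * c (Suc j) * (cos (A j \<omega> + \<theta> * \<Delta> j \<omega>) - e * cos (A j \<omega>)))" .
      have N': "N 1 \<omega> = (\<Sum>j<n. - (\<xi> \<omega> * c (Suc j) * \<theta> * sin (A j \<omega>)) * \<Delta> j \<omega>)"
        unfolding N_def \<Delta>_def
      proof (intro sum.cong refl)
        fix j assume "j \<in> {..<n}"
        then have "min 1 (\<tau> (Suc j)) = \<tau> (Suc j)" "min 1 (\<tau> j) = \<tau> j" using tau01[of j] tau01[of "Suc j"] by auto
        then show "- (\<xi> \<omega> * c (Suc j) * \<theta> * sin (A j \<omega>)) * (W (min 1 (\<tau> (Suc j))) \<omega> - W (min 1 (\<tau> j)) \<omega>) =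
         - (\<xi> \<omega> * c (Suc j) * \<theta> * sin (A j \<omega>)) * (W (\<tau> (Suc j)) \<omega> - W (\<tau> j) \<omega>)" by simp
      qed
      show ?thesis unfolding Y' N' sum_subtractf[symmetric]
        by (intro sum.cong refl) (simp add: x_def r_def algebra_simps)
    qed
    note YN = this
    have DH: "\<Delta> j \<in> borel_measurable (H (\<tau> (Suc j)))" if "j < n" for j
      unfolding \<Delta>_def using that tau_Suc by (intro borel_measurable_diff W_adapted tau01) auto
    have xH: "x j \<in> borel_measurable (H (\<tau> (Suc j)))" if "j < n" for j
    proof -
      have [measurable]: "\<Delta> j \<in> borel_measurable (H (\<tau> (Suc j)))" "\<xi> \<in> borel_measurable (H (\<tau> (Suc j)))"
        "A j \<in> borel_measurable (H (\<tau> (Suc j)))"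
        using DH[OF that] xiH[of "Suc j"] measurable_F_mono[OF tau_Suc(2) AH[of j]] that by auto
      show ?thesis unfolding x_def r_def by measurable
    qed
    have xm: "x j \<in> borel_measurable M" if "j < n" for j using measurable_F_M[OF xH[OF that]] .
    note DM = increment_moments[OF tau(1) tau_Suc(2)]
    have D1: "\<tau> (Suc j) \<le> 1" if "j < n" for j using tau01[of "Suc j"] that by auto
    have x2: "(x j \<omega>)\<^sup>2 \<le> K\<^sup>2 * (\<theta> ^ 4 / 2) * (\<Delta> j \<omega> ^ 4 + h\<^sup>2)" if "j < n" "\<omega> \<in> space M" for j \<omega>
    proof -
      have r': "r j \<omega> = (cos (A j \<omega> + \<theta> * \<Delta> j \<omega>) - cos (A j \<omega>) + \<theta> * \<Delta> j \<omega> * sin (A j \<omega>)) + (1 - e) * cos (A j \<omega>)"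
        by (simp add: r_def algebra_simps)
      have e1: "0 \<le> 1 - e" "1 - e \<le> \<theta>\<^sup>2 * h / 2"
        using h exp_ge_add_one_self[of "- (\<theta>\<^sup>2 * h / 2)"] by (auto simp: e_def)
      have "\<bar>(1 - e) * cos (A j \<omega>)\<bar> \<le> \<theta>\<^sup>2 * h / 2 * 1"
        unfolding abs_mult using e1 by (intro mult_mono) auto
      then have "\<bar>r j \<omega>\<bar> \<le> (\<theta> * \<Delta> j \<omega>)\<^sup>2 / 2 + \<theta>\<^sup>2 * h / 2"
        using cos_second_order[of "A j \<omega>" "\<theta> * \<Delta> j \<omega>"] unfolding r' by linarith
      then have "(r j \<omega>)\<^sup>2 \<le> ((\<theta> * \<Delta> j \<omega>)\<^sup>2 / 2 + \<theta>\<^sup>2 * h / 2)\<^sup>2"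
        using h by (intro abs_le_square_iff[THEN iffD1]) simp
      also have "\<dots> \<le> 2 * ((\<theta> * \<Delta> j \<omega>)\<^sup>2 / 2)\<^sup>2 + 2 * (\<theta>\<^sup>2 * h / 2)\<^sup>2"
      proof -
        have "0 \<le> ((\<theta> * \<Delta> j \<omega>)\<^sup>2 / 2 - \<theta>\<^sup>2 * h / 2)\<^sup>2" by simp
        then show ?thesis by (simp add: power2_sum power2_diff)
      qed
      also have "\<dots> = (\<theta> ^ 4 / 2) * (\<Delta> j \<omega> ^ 4 + h\<^sup>2)"
        by (simp add: power_mult_distrib power_divide flip: power_mult) (simp add: algebra_simps)
      finally have r2: "(r j \<omega>)\<^sup>2 \<le> (\<theta> ^ 4 / 2) * (\<Delta> j \<omega> ^ 4 + h\<^sup>2)" .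
      have "\<bar>\<xi> \<omega> * c (Suc j)\<bar> \<le> K * 1"
        unfolding abs_mult using xi(2)[OF that(2)] c[of "Suc j"] that K0 by (intro mult_mono) auto
      then have "(\<xi> \<omega> * c (Suc j))\<^sup>2 \<le> K\<^sup>2" using K0 by (intro abs_le_square_iff[THEN iffD1]) simp
      then have "(\<xi> \<omega> * c (Suc j))\<^sup>2 * (r j \<omega>)\<^sup>2 \<le> K\<^sup>2 * ((\<theta> ^ 4 / 2) * (\<Delta> j \<omega> ^ 4 + h\<^sup>2))"
        using r2 by (intro mult_mono) auto
      then show ?thesis by (simp add: x_def power_mult_distrib mult.assoc)
    qed
    have Bi: "integrable M (\<lambda>\<omega>. K\<^sup>2 * (\<theta> ^ 4 / 2) * (\<Delta> j \<omega> ^ 4 + h\<^sup>2))" if "j < n" for j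
      unfolding \<Delta>_def using DM(1)[OF D1[OF that]] by (intro integrable_mult_right Bochner_Integration.integrable_add) auto
    have x2i: "integrable M (\<lambda>\<omega>. (x j \<omega>)\<^sup>2)" if "j < n" for j
      by (rule Bochner_Integration.integrable_bound[OF Bi[OF that]])
        (use xm[OF that] x2[OF that] in \<open>auto intro!: AE_I2 borel_measurable_power intro: order_trans[OF _ abs_ge_self]\<close>)
    have x2e: "(\<integral>\<omega>. (x j \<omega>)\<^sup>2 \<partial>M) \<le> 2 * K\<^sup>2 * \<theta> ^ 4 * h\<^sup>2" if "j < n" for j
    proof -
      have "(\<integral>\<omega>. (x j \<omega>)\<^sup>2 \<partial>M) \<le> (\<integral>\<omega>. K\<^sup>2 * (\<theta> ^ 4 / 2) * (\<Delta> j \<omega> ^ 4 + h\<^sup>2) \<partial>M)"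
        using x2 that by (intro integral_mono x2i Bi) auto
      also have "\<dots> = K\<^sup>2 * (\<theta> ^ 4 / 2) * (3 * h\<^sup>2 + h\<^sup>2)"
        using DM(1)[OF D1[OF that], of 4] DM(4)[OF D1[OF that]] tau_Suc(1)[of j] unfolding \<Delta>_def by (simp add: prob_space)
      finally show ?thesis by (simp add: mult_ac)
    qed
    \<comment> \<open>\<open>x\<^sub>i\<close> is known at time \<open>\<tau>\<^sub>j\<close>; by the addition theorem, the remaining factor is a combination of centred functions of the increment of \<open>W\<close> after that time\<close>
    have xx: "(\<integral>\<omega>. x i \<omega> * x j \<omega> \<partial>M) = 0" if ij: "i < j" "j < n" for i j
    proof -
      have xi_int: "integrable M (x i)"
        using integrable_mult_of_square(1)[OF xm[of i] _ x2i[of i], of "\<lambda>_. 1"] ij by simp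
      have xiH': "x i \<in> borel_measurable (H (\<tau> j))"
        using measurable_F_mono[OF tau_mono xH, of i j] ij by simp
      have AHj: "A j \<in> borel_measurable (H (\<tau> j))" using AH ij by simp
      note [measurable] = measurable_F_M[OF xiH'] measurable_F_M[OF AHj]
      define \<zeta> where "\<zeta> f \<omega> = x i \<omega> * (\<xi> \<omega> * c (Suc j) * f (A j \<omega>))" for f :: "real \<Rightarrow> real" and \<omega>
      have z: "\<zeta> f \<in> borel_measurable (H (\<tau> j))" "integrable M (\<zeta> f)"
        if f: "f \<in> borel_measurable borel" "\<And>y. \<bar>f y\<bar> \<le> 1" for f
      proof -
        have "(\<lambda>\<omega>. f (A j \<omega>)) \<in> borel_measurable (H (\<tau> j))" by (rule measurable_compose[OF AHj f(1)])
        then show zm: "\<zeta> f \<in> borel_measurable (H (\<tau> j))" unfolding \<zeta>_def using xiH' xiH[of j] by measurable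
        show "integrable M (\<zeta> f)"
        proof (rule Bochner_Integration.integrable_bound[of _ "\<lambda>\<omega>. x i \<omega> * K"])
          show "AE \<omega> in M. norm (\<zeta> f \<omega>) \<le> norm (x i \<omega> * K)"
          proof (rule AE_I2)
            fix \<omega> assume w: "\<omega> \<in> space M"
            have "\<bar>\<xi> \<omega>\<bar> * \<bar>c (Suc j)\<bar> * \<bar>f (A j \<omega>)\<bar> \<le> K * 1 * 1"
              using xi(2)[OF w] c[of "Suc j"] f(2) ij K0 by (intro mult_mono) auto
            then have "\<bar>x i \<omega>\<bar> * (\<bar>\<xi> \<omega>\<bar> * \<bar>c (Suc j)\<bar> * \<bar>f (A j \<omega>)\<bar>) \<le> \<bar>x i \<omega>\<bar> * K" by (intro mult_left_mono) auto
            then show "norm (\<zeta> f \<omega>) \<le> norm (x i \<omega> * K)" using K0 by (simp add: \<zeta>_def abs_mult)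
          qed
        qed (use xi_int measurable_F_M[OF zm] in auto)
      qed
      have D1j: "\<tau> (Suc j) \<le> 1" using D1 ij by simp
      have Dm [measurable]: "(\<lambda>\<omega>. W (\<tau> (Suc j)) \<omega> - W (\<tau> j) \<omega>) \<in> borel_measurable M"
        using tau01[of j] tau01[of "Suc j"] ij by (intro increment_measurable) auto
      have si: "integrable M (\<lambda>\<omega>. sin (\<theta> * (W (\<tau> (Suc j)) \<omega> - W (\<tau> j) \<omega>)))" "integrable M (\<lambda>\<omega>. cos (\<theta> * (W (\<tau> (Suc j)) \<omega> - W (\<tau> j) \<omega>)))"
        by (auto intro!: bounded_integrable[of _ 1])
      have Ci: "integrable M (\<lambda>\<omega>. cos (\<theta> * (W (\<tau> (Suc j)) \<omega> - W (\<tau> j) \<omega>)) - e)"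
        "integrable M (\<lambda>\<omega>. sin (\<theta> * (W (\<tau> (Suc j)) \<omega> - W (\<tau> j) \<omega>)) - \<theta> * (W (\<tau> (Suc j)) \<omega> - W (\<tau> j) \<omega>))"
        using DM(1)[OF D1j, of 1]
        by (auto intro!: Bochner_Integration.integrable_diff integrable_mult_right si)
      have C0: "(\<integral>\<omega>. cos (\<theta> * (W (\<tau> (Suc j)) \<omega> - W (\<tau> j) \<omega>)) - e \<partial>M) = 0"
        using DM(5)[OF D1j, of \<theta>] tau_Suc(1)[of j] si by (simp add: prob_space e_def)
      have S0: "(\<integral>\<omega>. sin (\<theta> * (W (\<tau> (Suc j)) \<omega> - W (\<tau> j) \<omega>)) - \<theta> * (W (\<tau> (Suc j)) \<omega> - W (\<tau> j) \<omega>) \<partial>M) = 0"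
        using DM(6)[OF D1j, of \<theta>] DM(1)[OF D1j, of 1] DM(2)[OF D1j] si by simp
      note P = integral_mult_increment[OF z(1)[of cos] tau(1) tau_Suc(2) D1j z(2)[of cos], of "\<lambda>y. cos (\<theta> * y) - e"]
        integral_mult_increment[OF z(1)[of sin] tau(1) tau_Suc(2) D1j z(2)[of sin], of "\<lambda>y. sin (\<theta> * y) - \<theta> * y"]
      have "x i \<omega> * x j \<omega> = \<zeta> cos \<omega> * (cos (\<theta> * (W (\<tau> (Suc j)) \<omega> - W (\<tau> j) \<omega>)) - e)
         - \<zeta> sin \<omega> * (sin (\<theta> * (W (\<tau> (Suc j)) \<omega> - W (\<tau> j) \<omega>)) - \<theta> * (W (\<tau> (Suc j)) \<omega> - W (\<tau> j) \<omega>))" for \<omega>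
        unfolding \<Delta>_def[symmetric] by (simp add: x_def[of j] r_def \<zeta>_def cos_add algebra_simps)
      then show ?thesis using P Ci C0 S0 by simp
    qed
    have E: "(\<integral>\<omega>. (\<Sum>j<n. x j \<omega>)\<^sup>2 \<partial>M) \<le> 2 * K\<^sup>2 * \<theta> ^ 4 / real n"
    proof -
      have "(\<integral>\<omega>. (\<Sum>j<n. x j \<omega>)\<^sup>2 \<partial>M) = (\<Sum>i<n. \<Sum>j<n. \<integral>\<omega>. x i \<omega> * x j \<omega> \<partial>M)"
        by (rule integral_square_sum(2)) (auto intro: xm x2i)
      also have "\<dots> = (\<Sum>i<n. \<Sum>j<n. if j = i then \<integral>\<omega>. (x i \<omega>)\<^sup>2 \<partial>M else 0)"
      proof (intro sum.cong refl)
        fix i j assume "i \<in> {..<n}" "j \<in> {..<n}"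
        then show "(\<integral>\<omega>. x i \<omega> * x j \<omega> \<partial>M) = (if j = i then \<integral>\<omega>. (x i \<omega>)\<^sup>2 \<partial>M else 0)"
          using xx[of i j] xx[of j i] by (cases i j rule: linorder_cases) (auto simp: power2_eq_square mult.commute)
      qed
      also have "\<dots> = (\<Sum>i<n. \<integral>\<omega>. (x i \<omega>)\<^sup>2 \<partial>M)" by simp
      also have "\<dots> \<le> (\<Sum>i<n. 2 * K\<^sup>2 * \<theta> ^ 4 * h\<^sup>2)" by (intro sum_mono x2e) auto
      also have "\<dots> = 2 * K\<^sup>2 * \<theta> ^ 4 * ((real n * h) * h)" by (simp add: power2_eq_square)
      also have "\<dots> \<le> 2 * K\<^sup>2 * \<theta> ^ 4 * (1 * (1 / real n))"
        using h h1 su by (intro mult_left_mono mult_mono) auto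
      finally show ?thesis by simp
    qed
    show ?thesis
    proof (intro exI[of _ N] conjI N)
      show "integrable M (\<lambda>\<omega>. (Y \<omega> - N 1 \<omega>)\<^sup>2)"
        unfolding YN by (rule integral_square_sum(1)) (auto intro: xm x2i)
      show "(\<integral>\<omega>. (Y \<omega> - N 1 \<omega>)\<^sup>2 \<partial>M) \<le> 2 * K\<^sup>2 * \<theta> ^ 4 / real n"
        unfolding YN by (rule E)
    qed
  qed
  have "approximable Y" unfolding approximable_def
  proof (intro conjI allI impI)
    show Yi: "integrable M Y"
    proof (rule bounded_integrable[OF Ym, of "K * 2"])
      fix \<omega> assume w: "\<omega> \<in> space M"
      have "\<bar>exp (- (\<theta>\<^sup>2 * (u - s) / 2)) * cos (\<theta> * W s \<omega> + \<alpha>)\<bar> \<le> 1 * 1"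
        unfolding abs_mult using su by (intro mult_mono) auto
      then have "\<bar>cos (\<theta> * W u \<omega> + \<alpha>) - exp (- (\<theta>\<^sup>2 * (u - s) / 2)) * cos (\<theta> * W s \<omega> + \<alpha>)\<bar> \<le> 2"
        using abs_cos_le_one[of "\<theta> * W u \<omega> + \<alpha>"] by linarith
      then show "\<bar>Y \<omega>\<bar> \<le> K * 2"
        unfolding Y_def abs_mult using xi(2)[OF w] K0 by (intro mult_mono) auto
    qed
    fix \<delta> :: real assume d: "0 < \<delta>"
    define C where "C = 2 * K\<^sup>2 * \<theta> ^ 4"
    obtain n :: nat where n: "C / (\<delta>/2)\<^sup>2 < real n" using reals_Archimedean2 by blast
    have C: "0 \<le> C" by (simp add: C_def)
    have n0: "0 < real n" using n C d by (meson divide_nonneg_nonneg le_less_trans zero_le_power2)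
    then obtain N where N: "simple_process N" "integrable M (\<lambda>\<omega>. (Y \<omega> - N 1 \<omega>)\<^sup>2)"
      "(\<integral>\<omega>. (Y \<omega> - N 1 \<omega>)\<^sup>2 \<partial>M) \<le> C / real n" using step[of n] by (auto simp: C_def)
    note Ni = simple_process_integrable[OF N(1)]
    \<comment> \<open>from second moments to first moments\<close>
    have b: "\<bar>y\<bar> \<le> \<delta> / 4 + y\<^sup>2 / \<delta>" for y :: real
    proof -
      have "0 \<le> (\<bar>y\<bar> - \<delta> / 2)\<^sup>2 / \<delta>" using d by simp
      also have "\<dots> = y\<^sup>2 / \<delta> - \<bar>y\<bar> + \<delta> / 4" using d by (simp add: power2_diff field_simps) (simp add: power2_eq_square)
      finally show ?thesis by linarith
    qed
    have "(\<integral>\<omega>. \<bar>Y \<omega> - N 1 \<omega>\<bar> \<partial>M) \<le> (\<integral>\<omega>. \<delta> / 4 + (Y \<omega> - N 1 \<omega>)\<^sup>2 / \<delta> \<partial>M)"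
      using Yi Ni N(2) b by (intro integral_mono) auto
    also have "\<dots> = \<delta> / 4 + (\<integral>\<omega>. (Y \<omega> - N 1 \<omega>)\<^sup>2 \<partial>M) / \<delta>"
      using N(2) by (simp add: prob_space)
    also have "\<dots> \<le> \<delta> / 4 + (C / real n) / \<delta>" using N(3) d by (intro add_left_mono divide_right_mono) auto
    also have "\<dots> < \<delta>"
    proof -
      have "C < real n * (\<delta>/2)\<^sup>2" using n d by (simp add: pos_divide_less_eq)
      then have "C / real n < (\<delta>/2)\<^sup>2" using n0 by (simp add: pos_divide_less_eq mult.commute)
      then have "(C / real n) / \<delta> < (\<delta>/2)\<^sup>2 / \<delta>" using d by (intro divide_strict_right_mono) auto
      also have "\<dots> = \<delta> / 4" using d by (simp add: power2_eq_square)
      finally show ?thesis using d by linarith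
    qed
    finally show "\<exists>N. simple_process N \<and> (\<integral>\<omega>. \<bar>Y \<omega> - N 1 \<omega>\<bar> \<partial>M) < \<delta>" using N(1) by blast
  qed
  then show ?thesis by (simp add: Y_def[abs_def])
qed

text \<open>
From cosines to indicators. Products of cosines are sums of cosines, so polynomials in
\<open>cos(\<theta> Z + \<alpha>)\<close> are covered, then continuous functions by the Weierstrass theorem and indicators of
\<open>cos(\<theta> Z + \<alpha>) > \<kappa>\<close> by bounded convergence. An interval with centre \<open>c\<close> and radius \<open>r\<close> is the limit
of the periodic sets \<open>cos((x - c) / n) > cos(r / n)\<close>, and intervals generate the Borel sets.
\<close>

lemma approximable_indicator_of_trigonometric:
  fixes Z \<xi> :: "'a \<Rightarrow> real"
  assumes Z: "Z \<in> borel_measurable M" and xi: "\<xi> \<in> borel_measurable M" "\<And>\<omega>. \<omega> \<in> space M \<Longrightarrow> \<bar>\<xi> \<omega>\<bar> \<le> K"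
    and trig: "\<And>\<theta> \<alpha>. approximable (\<lambda>\<omega>. \<xi> \<omega> * cos (\<theta> * Z \<omega> + \<alpha>))"
    and B: "B \<in> sets borel"
  shows "approximable (\<lambda>\<omega>. \<xi> \<omega> * indicator B (Z \<omega>))"
proof -
  note [measurable] = Z xi(1)
  obtain \<omega>0 where "\<omega>0 \<in> space M" using not_empty by blast
  with xi(2)[of \<omega>0] have K0: "0 \<le> K" by linarith
  have xi0: "approximable \<xi>" using trig[of 0 0] by simp
  have bd: "\<bar>\<xi> \<omega> * y\<bar> \<le> K" if "\<omega> \<in> space M" "\<bar>y\<bar> \<le> 1" for \<omega> y
    unfolding abs_mult using mult_mono[OF xi(2)[OF that(1)] that(2)] K0 by simp
  have pow: "approximable (\<lambda>\<omega>. \<xi> \<omega> * (cos (\<theta> * Z \<omega> + \<alpha>) ^ k * cos (\<beta> * Z \<omega> + \<gamma>)))" for k \<theta> \<alpha> \<beta> \<gamma>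
  proof (induction k arbitrary: \<beta> \<gamma>)
    case (Suc k)
    have "approximable (\<lambda>\<omega>. (1/2) * (\<xi> \<omega> * (cos (\<theta> * Z \<omega> + \<alpha>) ^ k * cos ((\<theta> + \<beta>) * Z \<omega> + (\<alpha> + \<gamma>))) +
        \<xi> \<omega> * (cos (\<theta> * Z \<omega> + \<alpha>) ^ k * cos ((\<theta> - \<beta>) * Z \<omega> + (\<alpha> - \<gamma>)))))"
      by (intro approximable_cmult approximable_add Suc)
    moreover have "(1/2) * (\<xi> \<omega> * (cos (\<theta> * Z \<omega> + \<alpha>) ^ k * cos ((\<theta> + \<beta>) * Z \<omega> + (\<alpha> + \<gamma>))) +
        \<xi> \<omega> * (cos (\<theta> * Z \<omega> + \<alpha>) ^ k * cos ((\<theta> - \<beta>) * Z \<omega> + (\<alpha> - \<gamma>)))) =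
        \<xi> \<omega> * (cos (\<theta> * Z \<omega> + \<alpha>) ^ Suc k * cos (\<beta> * Z \<omega> + \<gamma>))" for \<omega>
    proof -
      have "cos ((\<theta> + \<beta>) * Z \<omega> + (\<alpha> + \<gamma>)) = cos ((\<theta> * Z \<omega> + \<alpha>) + (\<beta> * Z \<omega> + \<gamma>))"
        "cos ((\<theta> - \<beta>) * Z \<omega> + (\<alpha> - \<gamma>)) = cos ((\<theta> * Z \<omega> + \<alpha>) - (\<beta> * Z \<omega> + \<gamma>))"
        by (simp_all add: algebra_simps)
      then show ?thesis by (simp only: cos_add cos_diff) (simp add: algebra_simps)
    qed
    ultimately show ?case by simp
  qed (simp add: trig)
  have poly: "approximable (\<lambda>\<omega>. \<xi> \<omega> * (\<Sum>i\<le>n. a i * cos (\<theta> * Z \<omega> + \<alpha>) ^ i))" for a and n :: nat and \<theta> \<alpha>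
  proof -
    have "approximable (\<lambda>\<omega>. \<Sum>i\<le>n. a i * (\<xi> \<omega> * (cos (\<theta> * Z \<omega> + \<alpha>) ^ i * cos (0 * Z \<omega> + 0))))"
      by (intro approximable_sum approximable_cmult pow) auto
    then show ?thesis by (simp add: sum_distrib_left mult_ac)
  qed
  have cont: "approximable (\<lambda>\<omega>. \<xi> \<omega> * \<phi> (cos (\<theta> * Z \<omega> + \<alpha>)))" if phi: "continuous_on UNIV \<phi>" for \<phi> :: "real \<Rightarrow> real" and \<theta> \<alpha>
  proof -
    have [measurable]: "\<phi> \<in> borel_measurable borel" using phi by (rule borel_measurable_continuous_onI)
    have c1: "continuous_on {-1..1} \<phi>" using continuous_on_subset[OF phi] by auto
    have "\<forall>n. \<exists>f. real_polynomial_function f \<and> (\<forall>x\<in>{-1..1}. norm (\<phi> x - f x) < 1 / real (Suc n))"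
    proof
      fix n
      have "0 < 1 / real (Suc n)" by simp
      then obtain f where f: "real_polynomial_function f" "\<And>x. x \<in> {-1..1} \<Longrightarrow> \<bar>\<phi> x - f x\<bar> < 1 / real (Suc n)"
        by (rule Stone_Weierstrass_real_polynomial_function[OF compact_Icc c1]) (rule that)
      show "\<exists>f. real_polynomial_function f \<and> (\<forall>x\<in>{-1..1}. norm (\<phi> x - f x) < 1 / real (Suc n))"
        using f unfolding real_norm_def by (intro exI[of _ f] conjI ballI)
    qed
    from choice[OF this] obtain p where
      p0: "\<forall>n. real_polynomial_function (p n) \<and> (\<forall>x\<in>{-1..1}. norm (\<phi> x - p n x) < 1 / real (Suc n))" ..
    have p: "real_polynomial_function (p n)" "x \<in> {-1..1} \<Longrightarrow> norm (\<phi> x - p n x) < 1 / real (Suc n)" for n x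
      using spec[OF p0, of n] by auto
    have ap: "approximable (\<lambda>\<omega>. \<xi> \<omega> * p n (cos (\<theta> * Z \<omega> + \<alpha>)))" for n
    proof -
      obtain a m where "p n = (\<lambda>x. \<Sum>i\<le>m. a i * x ^ i)"
        using p(1)[of n] real_polynomial_function_iff_sum by blast
      then show ?thesis using poly[of a \<theta> \<alpha> m] by simp
    qed
    have "compact (\<phi> ` {-1..1})" using c1 by (intro compact_continuous_image) auto
    then obtain L where L: "\<And>x. x \<in> {-1..1} \<Longrightarrow> \<bar>\<phi> x\<bar> \<le> L"
      using compact_imp_bounded[of "\<phi> ` {-1..1}"] unfolding bounded_iff real_norm_def by blast
    have c01: "cos y \<in> {-1..1}" for y :: real by simp
    show ?thesis
    proof (rule approximable_dominated[OF ap, where w="\<lambda>_. K * (L + 1)"])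
      fix n \<omega> assume w: "\<omega> \<in> space M"
      have "1 / real (Suc n) \<le> 1" by simp
      then have "\<bar>p n (cos (\<theta> * Z \<omega> + \<alpha>))\<bar> \<le> L + 1"
        using p(2)[OF c01, of "\<theta> * Z \<omega> + \<alpha>" n] L[OF c01, of "\<theta> * Z \<omega> + \<alpha>"] unfolding real_norm_def by linarith
      then show "\<bar>\<xi> \<omega> * p n (cos (\<theta> * Z \<omega> + \<alpha>))\<bar> \<le> K * (L + 1)"
        unfolding abs_mult using xi(2)[OF w] K0 by (intro mult_mono) auto
    next
      fix \<omega>
      have "(\<lambda>n. p n (cos (\<theta> * Z \<omega> + \<alpha>))) \<longlonglongrightarrow> \<phi> (cos (\<theta> * Z \<omega> + \<alpha>))"
      proof (rule LIM_zero_cancel, rule LIMSEQ_norm_0)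
        show "norm (p n (cos (\<theta> * Z \<omega> + \<alpha>)) - \<phi> (cos (\<theta> * Z \<omega> + \<alpha>))) < 1 / real (Suc n)" for n
          using p(2)[OF c01, of "\<theta> * Z \<omega> + \<alpha>" n] by (simp add: norm_minus_commute)
      qed
      then show "(\<lambda>n. \<xi> \<omega> * p n (cos (\<theta> * Z \<omega> + \<alpha>))) \<longlonglongrightarrow> \<xi> \<omega> * \<phi> (cos (\<theta> * Z \<omega> + \<alpha>))"
        by (intro tendsto_mult_left)
    qed auto
  qed
  have level: "approximable (\<lambda>\<omega>. \<xi> \<omega> * indicator {\<kappa><..} (cos (\<theta> * Z \<omega> + \<alpha>)))" for \<theta> \<alpha> \<kappa> :: real
  proof (rule approximable_dominated[where w="\<lambda>_. K" and X="\<lambda>n \<omega>. \<xi> \<omega> * min 1 (real n * max 0 (cos (\<theta> * Z \<omega> + \<alpha>) - \<kappa>))"])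
    show "approximable (\<lambda>\<omega>. \<xi> \<omega> * min 1 (real n * max 0 (cos (\<theta> * Z \<omega> + \<alpha>) - \<kappa>)))" for n
      by (rule cont[of "\<lambda>x. min 1 (real n * max 0 (x - \<kappa>))" \<theta> \<alpha>]) (intro continuous_intros)
    show "\<bar>\<xi> \<omega> * min 1 (real n * max 0 (cos (\<theta> * Z \<omega> + \<alpha>) - \<kappa>))\<bar> \<le> K" if "\<omega> \<in> space M" for n \<omega>
    proof (rule bd[OF that])
      have "0 \<le> real n * max 0 (cos (\<theta> * Z \<omega> + \<alpha>) - \<kappa>)" by simp
      then show "\<bar>min 1 (real n * max 0 (cos (\<theta> * Z \<omega> + \<alpha>) - \<kappa>))\<bar> \<le> 1" by linarith
    qed
    fix \<omega>
    define y where "y = cos (\<theta> * Z \<omega> + \<alpha>) - \<kappa>"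
    have "(\<lambda>n. min 1 (real n * max 0 y)) \<longlonglongrightarrow> (if 0 < y then 1 else 0)"
    proof (cases "0 < y")
      case True
      obtain N :: nat where N: "1 / y < real N" using reals_Archimedean2 by blast
      have "\<forall>\<^sub>F n in sequentially. min 1 (real n * max 0 y) = 1"
        using eventually_ge_at_top[of N]
      proof eventually_elim
        case (elim n)
        have "1 < real N * y" using N True by (simp add: pos_divide_less_eq)
        also have "\<dots> \<le> real n * y" using elim True by (intro mult_right_mono) auto
        finally show ?case using True by simp
      qed
      then show ?thesis using True by (simp add: tendsto_eventually)
    qed simp
    moreover have "indicator {\<kappa><..} (cos (\<theta> * Z \<omega> + \<alpha>)) = (if 0 < y then 1 else (0::real))"
      by (auto simp: y_def indicator_def)
    ultimately show "(\<lambda>n. \<xi> \<omega> * min 1 (real n * max 0 (cos (\<theta> * Z \<omega> + \<alpha>) - \<kappa>))) \<longlonglongrightarrow>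
      \<xi> \<omega> * indicator {\<kappa><..} (cos (\<theta> * Z \<omega> + \<alpha>))"
      unfolding y_def[symmetric] by (intro tendsto_mult_left) simp
  qed auto
  have interval: "approximable (\<lambda>\<omega>. \<xi> \<omega> * indicator {a<..<b} (Z \<omega>))" for a b :: real
  proof (cases "a < b")
    case False
    then show ?thesis using approximable_const[of 0] by simp
  next
    case True
    define c where "c = (a + b) / 2"
    define r where "r = (b - a) / 2"
    have r: "0 < r" using True by (simp add: r_def)
    show ?thesis
    proof (rule approximable_dominated[where w="\<lambda>_. K" and
        X="\<lambda>n \<omega>. \<xi> \<omega> * indicator {cos (r / real n)<..} (cos ((1 / real n) * Z \<omega> + (- c / real n)))"])
      show "approximable (\<lambda>\<omega>. \<xi> \<omega> * indicator {cos (r / real n)<..} (cos ((1 / real n) * Z \<omega> + (- c / real n))))" for n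
        by (rule level)
      show "\<bar>\<xi> \<omega> * indicator {cos (r / real n)<..} (cos ((1 / real n) * Z \<omega> + (- c / real n)))\<bar> \<le> K" if "\<omega> \<in> space M" for n \<omega>
        by (rule bd[OF that]) (auto simp: indicator_def)
      fix \<omega>
      define d where "d = \<bar>Z \<omega> - c\<bar>"
      obtain N :: nat where N: "(r + d) / pi < real N" using reals_Archimedean2 by blast
      have "\<forall>\<^sub>F n in sequentially. indicator {cos (r / real n)<..} (cos ((1 / real n) * Z \<omega> + (- c / real n))) = (indicator {a<..<b} (Z \<omega>) :: real)"
        using eventually_ge_at_top[of N]
      proof eventually_elim
        case (elim n)
        have rd: "(r + d) / pi < real n" using N elim by linarith
        have d0: "0 \<le> d" by (simp add: d_def)
        have n0: "0 < real n" using rd r d0 by (meson add_nonneg_nonneg divide_nonneg_nonneg le_less_trans less_imp_le pi_ge_zero)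
        have "r + d < real n * pi" using rd by (simp add: pos_divide_less_eq)
        then have b: "0 \<le> r / real n" "r / real n \<le> pi" "0 \<le> d / real n" "d / real n \<le> pi"
          using n0 r d0 by (auto simp: pos_divide_le_eq mult.commute)
        have "cos ((1 / real n) * Z \<omega> + (- c / real n)) = cos (d / real n)"
        proof -
          have "(1 / real n) * Z \<omega> + (- c / real n) = (Z \<omega> - c) / real n" by (simp add: diff_divide_distrib)
          moreover have "\<bar>(Z \<omega> - c) / real n\<bar> = d / real n" using n0 by (simp add: d_def)
          ultimately show ?thesis by (metis cos_abs_real)
        qed
        moreover have "cos (r / real n) < cos (d / real n) \<longleftrightarrow> d / real n < r / real n"
          using b by (intro cos_mono_less_eq) auto
        moreover have "d / real n < r / real n \<longleftrightarrow> d < r" using n0 by (simp add: divide_less_cancel)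
        moreover have "d < r \<longleftrightarrow> Z \<omega> \<in> {a<..<b}" by (auto simp: d_def c_def r_def abs_if field_simps)
        ultimately show ?case by (auto simp: indicator_def)
      qed
      then have "(\<lambda>n. indicator {cos (r / real n)<..} (cos ((1 / real n) * Z \<omega> + (- c / real n))) :: real) \<longlonglongrightarrow> indicator {a<..<b} (Z \<omega>)"
        by (rule tendsto_eventually)
      then show "(\<lambda>n. \<xi> \<omega> * indicator {cos (r / real n)<..} (cos ((1 / real n) * Z \<omega> + (- c / real n)))) \<longlonglongrightarrow> \<xi> \<omega> * indicator {a<..<b} (Z \<omega>)"
        by (intro tendsto_mult_left)
    qed auto
  qed
  let ?G = "range (\<lambda>(a, b). {a<..<b::real})"
  have borel_G: "sets borel = sigma_sets UNIV ?G"
    using arg_cong[OF borel_eq_box[where 'a=real], of sets] by (simp add: box_real)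
  have "Int_stable ?G"
  proof (rule Int_stableI)
    fix A C assume "A \<in> ?G" "C \<in> ?G"
    then obtain a b c d where "A = {a<..<b}" "C = {c<..<d}" by auto
    then have "A \<inter> C = {max a c<..<min b d}" by auto
    then show "A \<inter> C \<in> ?G" by auto
  qed
  moreover have "?G \<subseteq> Pow UNIV" by simp
  moreover have "B \<in> sigma_sets UNIV ?G" using B unfolding borel_G .
  ultimately show ?thesis
  proof (induction rule: sigma_sets_induct_disjoint)
    case (basic A)
    then show ?case using interval by auto
  next
    case empty
    show ?case using approximable_const[of 0] by simp
  next
    case (compl A)
    have "approximable (\<lambda>\<omega>. \<xi> \<omega> - \<xi> \<omega> * indicator A (Z \<omega>))" by (intro approximable_diff xi0 compl)
    moreover have "\<xi> \<omega> - \<xi> \<omega> * indicator A (Z \<omega>) = \<xi> \<omega> * indicator (UNIV - A) (Z \<omega>)" for \<omega>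
      by (auto simp: indicator_def)
    ultimately show ?case by simp
  next
    case (union A)
    have Am [measurable]: "A i \<in> sets borel" for i using union(2) unfolding borel_G by auto
    have sum: "(\<Sum>i<n. indicator (A i) x) = (indicator (\<Union>i<n. A i) x :: real)" for n x
      using union(1) by (subst indicator_UN_disjoint) (auto simp: disjoint_family_on_def)
    show ?case
    proof (rule approximable_dominated[where w="\<lambda>_. K" and X="\<lambda>n \<omega>. \<Sum>i<n. \<xi> \<omega> * indicator (A i) (Z \<omega>)"])
      show "approximable (\<lambda>\<omega>. \<Sum>i<n. \<xi> \<omega> * indicator (A i) (Z \<omega>))" for n :: nat
        by (intro approximable_sum union) auto
      show "\<bar>\<Sum>i<n. \<xi> \<omega> * indicator (A i) (Z \<omega>)\<bar> \<le> K" if "\<omega> \<in> space M" for n :: nat and \<omega>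
        unfolding sum_distrib_left[symmetric] sum by (rule bd[OF that]) (auto simp: indicator_def)
      show "(\<lambda>n. \<Sum>i<n. \<xi> \<omega> * indicator (A i) (Z \<omega>)) \<longlonglongrightarrow> \<xi> \<omega> * indicator (\<Union>i. A i) (Z \<omega>)" for \<omega>
        unfolding sum_distrib_left[symmetric] sum by (intro tendsto_mult_left LIMSEQ_indicator_UN)
      have [measurable]: "(\<Union>i. A i) \<in> sets borel" by auto
      show "(\<lambda>\<omega>. \<xi> \<omega> * indicator (\<Union>i. A i) (Z \<omega>)) \<in> borel_measurable M" by measurable
    qed auto
  qed
qed

text \<open>
The cosine factor carries the induction over the times in increasing order: it is moved from the
latest time \<open>u\<close> to \<open>s\<close> by \<open>cosine_martingale_step\<close>, and at time \<open>u\<close> it is what allows the indicator of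
\<open>W\<^sub>u \<in> B\<^sub>u\<close> to be inserted.
\<close>

lemma approximable_cylinder_cos:
  assumes J: "finite J" "J \<subseteq> {0..1}" and B: "\<And>j. B j \<in> sets borel" and s: "s \<in> {0..1}" "\<And>j. j \<in> J \<Longrightarrow> j \<le> s"
  shows "approximable (\<lambda>\<omega>. indicator (cylinder J B) \<omega> * cos (\<theta> * W s \<omega> + \<alpha>))"
  using J s
proof (induction J arbitrary: s \<theta> \<alpha> rule: finite_linorder_max_induct)
  case empty
  have "approximable (\<lambda>\<omega>. 1 * (cos (\<theta> * W s \<omega> + \<alpha>) - exp (- (\<theta>\<^sup>2 * (s - 0) / 2)) * cos (\<theta> * W 0 \<omega> + \<alpha>)))"
    using empty by (intro cosine_martingale_step[where K=1]) auto
  then have "approximable (\<lambda>\<omega>. 1 * (cos (\<theta> * W s \<omega> + \<alpha>) - exp (- (\<theta>\<^sup>2 * (s - 0) / 2)) * cos (\<theta> * W 0 \<omega> + \<alpha>)) +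
     exp (- (\<theta>\<^sup>2 * (s - 0) / 2)) * cos \<alpha>)"
    by (intro approximable_add approximable_const)
  then show ?case
  proof (rule approximable_cong_AE)
    note [measurable] = W_measurable[OF empty(2)]
    have [simp]: "cylinder {} B = space M" by (auto simp: cylinder_def)
    show "(\<lambda>\<omega>. indicator (cylinder {} B) \<omega> * cos (\<theta> * W s \<omega> + \<alpha>)) \<in> borel_measurable M" by simp
    show "AE \<omega> in M. 1 * (cos (\<theta> * W s \<omega> + \<alpha>) - exp (- (\<theta>\<^sup>2 * (s - 0) / 2)) * cos (\<theta> * W 0 \<omega> + \<alpha>)) +
     exp (- (\<theta>\<^sup>2 * (s - 0) / 2)) * cos \<alpha> = indicator (cylinder {} B) \<omega> * cos (\<theta> * W s \<omega> + \<alpha>)"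
      using W_0 AE_space by eventually_elim simp
  qed
next
  case (insert u J)
  have u: "u \<in> {0..1}" "u \<le> s" "0 \<le> u" "s \<le> 1" "J \<subseteq> {0..1}" using insert.prems by auto
  note [measurable] = W_measurable[OF u(1)]
  have cyl [measurable]: "cylinder J B \<in> events" using insert.hyps u B by (intro cylinder_sets) auto
  have IH: "approximable (\<lambda>\<omega>. indicator (cylinder J B) \<omega> * cos (\<theta> * W u \<omega> + \<alpha>))" for \<theta> \<alpha>
    using insert.hyps u by (intro insert.IH) auto
  have cyl_insert: "indicator (cylinder (insert u J) B) \<omega> = indicator (cylinder J B) \<omega> * (indicator (B u) (W u \<omega>) :: real)" for \<omega>
    by (auto simp: cylinder_def indicator_def)
  have at_u: "approximable (\<lambda>\<omega>. indicator (cylinder (insert u J) B) \<omega> * cos (\<theta> * W u \<omega> + \<alpha>))" for \<theta> \<alpha>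
  proof -
    have "approximable (\<lambda>\<omega>. (indicator (cylinder J B) \<omega> * cos (\<theta> * W u \<omega> + \<alpha>)) * indicator (B u) (W u \<omega>))"
    proof (rule approximable_indicator_of_trigonometric[where K=1])
      show "W u \<in> borel_measurable M" by (rule W_measurable[OF u(1)])
      show "(\<lambda>\<omega>. indicator (cylinder J B) \<omega> * cos (\<theta> * W u \<omega> + \<alpha>)) \<in> borel_measurable M" by measurable
      show "\<bar>indicator (cylinder J B) \<omega> * cos (\<theta> * W u \<omega> + \<alpha>)\<bar> \<le> 1" for \<omega> by (auto simp: indicator_def)
      fix \<theta>' \<alpha>' :: real
      have "approximable (\<lambda>\<omega>. (1/2) * (indicator (cylinder J B) \<omega> * cos ((\<theta> + \<theta>') * W u \<omega> + (\<alpha> + \<alpha>')) +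
          indicator (cylinder J B) \<omega> * cos ((\<theta> - \<theta>') * W u \<omega> + (\<alpha> - \<alpha>'))))"
        by (intro approximable_cmult approximable_add IH)
      moreover have "(1/2) * (indicator (cylinder J B) \<omega> * cos ((\<theta> + \<theta>') * W u \<omega> + (\<alpha> + \<alpha>')) +
          indicator (cylinder J B) \<omega> * cos ((\<theta> - \<theta>') * W u \<omega> + (\<alpha> - \<alpha>'))) =
        indicator (cylinder J B) \<omega> * cos (\<theta> * W u \<omega> + \<alpha>) * cos (\<theta>' * W u \<omega> + \<alpha>')" for \<omega>
      proof -
        have "cos ((\<theta> + \<theta>') * W u \<omega> + (\<alpha> + \<alpha>')) = cos ((\<theta> * W u \<omega> + \<alpha>) + (\<theta>' * W u \<omega> + \<alpha>'))"
          "cos ((\<theta> - \<theta>') * W u \<omega> + (\<alpha> - \<alpha>')) = cos ((\<theta> * W u \<omega> + \<alpha>) - (\<theta>' * W u \<omega> + \<alpha>'))"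
          by (simp_all add: algebra_simps)
        then show ?thesis by (simp only: cos_add cos_diff) (simp add: algebra_simps)
      qed
      ultimately show "approximable (\<lambda>\<omega>. indicator (cylinder J B) \<omega> * cos (\<theta> * W u \<omega> + \<alpha>) * cos (\<theta>' * W u \<omega> + \<alpha>'))"
        by simp
    qed (rule B)
    then show ?thesis unfolding cyl_insert by (simp add: mult_ac)
  qed
  have "indicator (cylinder (insert u J) B) \<in> borel_measurable (H u)"
  proof (rule borel_measurable_indicator)
    have "cylinder (insert u J) B = {\<omega>\<in>space (H u). \<forall>j\<in>insert u J. W j \<omega> \<in> B j}" by (simp add: cylinder_def space_F)
    also have "\<dots> \<in> sets (H u)"
    proof (intro sets.sets_Collect_finite_All)
      fix j assume j: "j \<in> insert u J"
      then have "W j \<in> borel_measurable (H u)" using u insert.hyps by (intro W_adapted) auto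
      from measurable_sets[OF this B] show "{\<omega>\<in>space (H u). W j \<omega> \<in> B j} \<in> sets (H u)"
        by (simp add: vimage_def Int_def conj_commute)
    qed (use insert.hyps in simp)
    finally show "cylinder (insert u J) B \<in> sets (H u)" .
  qed
  then have "approximable (\<lambda>\<omega>. indicator (cylinder (insert u J) B) \<omega> *
     (cos (\<theta> * W s \<omega> + \<alpha>) - exp (- (\<theta>\<^sup>2 * (s - u) / 2)) * cos (\<theta> * W u \<omega> + \<alpha>)))"
    by (rule cosine_martingale_step[where K=1]) (use u in \<open>auto simp: indicator_def\<close>)
  from approximable_add[OF this approximable_cmult[OF at_u[of \<theta> \<alpha>], of "exp (- (\<theta>\<^sup>2 * (s - u) / 2))"]]
  show ?case by (simp add: algebra_simps)
qed

lemma approximable_indicator: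
  assumes A: "A \<in> sets (H 1)"
  shows "approximable (indicator A)"
proof -
  have ev: "sigma_sets (space M) (cylinders 1) \<subseteq> events"
    by (rule sets.sigma_sets_subset) (auto simp: cylinders_def)
  note Int_stable_cylinders[of 1]
  moreover have "cylinders 1 \<subseteq> Pow (space M)" using sets.sets_into_space by (auto simp: cylinders_def)
  moreover have "A \<in> sigma_sets (space M) (cylinders 1)" using A sets_H_subset_cylinders[of 1] by auto
  ultimately show ?thesis
  proof (induction rule: sigma_sets_induct_disjoint)
    case (basic A)
    then obtain J B where J: "A \<in> events" "finite J" "J \<subseteq> {0..1} \<inter> {..1}" "\<forall>j. B j \<in> sets borel"
      and ae: "AE \<omega> in M. \<omega> \<in> A \<longleftrightarrow> \<omega> \<in> cylinder J B"
      unfolding cylinders_def by blast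
    have "approximable (\<lambda>\<omega>. indicator (cylinder J B) \<omega> * cos (0 * W 1 \<omega> + 0))"
      using J by (intro approximable_cylinder_cos) auto
    then show ?case
      by (rule approximable_cong_AE) (use ae J in \<open>auto simp: indicator_def\<close>)
  next
    case empty
    show ?case using approximable_const[of 0] by simp
  next
    case (compl A)
    then have A: "A \<in> events" using ev by auto
    have "approximable (\<lambda>\<omega>. 1 - indicator A \<omega>)" by (intro approximable_diff approximable_const compl)
    then show ?case by (rule approximable_cong_AE) (use A in \<open>auto simp: indicator_def\<close>)
  next
    case (union A)
    have Am [measurable]: "A i \<in> events" for i using union(2) ev by auto
    have sum: "(\<Sum>i<n. indicator (A i) x) = (indicator (\<Union>i<n. A i) x :: real)" for n x
      using union(1) by (subst indicator_UN_disjoint) (auto simp: disjoint_family_on_def)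
    show ?case
    proof (rule approximable_dominated[where w="\<lambda>_. 1" and X="\<lambda>n \<omega>. \<Sum>i<n. indicator (A i) \<omega>"])
      show "approximable (\<lambda>\<omega>. \<Sum>i<n. indicator (A i) \<omega>)" for n :: nat
        by (intro approximable_sum union) auto
      show "\<bar>\<Sum>i<n. indicator (A i) \<omega>\<bar> \<le> (1::real)" for n :: nat and \<omega>
        unfolding sum by (auto simp: indicator_def)
      show "(\<lambda>n. \<Sum>i<n. indicator (A i) \<omega> :: real) \<longlonglongrightarrow> indicator (\<Union>i. A i) \<omega>" for \<omega>
        unfolding sum by (rule LIMSEQ_indicator_UN)
    qed auto
  qed
qed

text \<open>
The weak form of the martingale representation theorem for the Brownian filtration.
\<close>

lemma approximable_H1:
  assumes Y: "integrable M Y" "Y \<in> borel_measurable (H 1)"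
  shows "approximable Y"
proof -
  have "integrable (restr_to_subalg M (H 1)) Y"
    by (rule integrable_in_subalg[OF subalg Y(2,1)])
  then show ?thesis
  proof (induction rule: integrable_induct)
    case (base A c)
    then have "A \<in> sets (H 1)" by (simp add: sets_restr_to_subalg[OF subalg])
    from approximable_cmult[OF approximable_indicator[OF this], of c] show ?case by (simp add: mult.commute)
  next
    case (add f g)
    then show ?case by (intro approximable_add)
  next
    case (lim f s)
    note i = integrable_from_subalg[OF subalg]
    have sp: "space (restr_to_subalg M (H 1)) = space M" by (rule space_restr_to_subalg)
    show ?case
    proof (rule approximable_dominated[OF lim(5), where w="\<lambda>\<omega>. 2 * \<bar>f \<omega>\<bar>"])
      show "f \<in> borel_measurable M" "integrable M (\<lambda>\<omega>. 2 * \<bar>f \<omega>\<bar>)" using i[OF lim(4)] by auto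
    qed (use lim sp in auto)
  qed
qed

end

section \<open>Weak Dirichlet processes\<close>

context brownian
begin

lemma measurable_covariation_approx:
  assumes "continuous_process M X" "continuous_process M Y"
  shows "covariation_approx X Y \<epsilon> 1 \<in> borel_measurable M"
  by (rule continuous_processD(1)[OF continuous_process_covariation_approx[OF assms]]) simp

text \<open>
Take a localizing time \<open>\<tau>\<close> that reaches 1 with probability close to 1 and approximate the terminal
value of the stopped martingale in \<open>L\<^sup>1\<close>. On the event \<open>\<tau> \<ge> 1\<close> the stopped martingale differs from \<open>L\<close>
by the constant \<open>L\<^sub>0\<close>, which does not affect increments.
\<close>

lemma local_martingale_approximation:
  assumes L: "continuous_local_martingale M H L" and d: "0 < \<delta>"
  shows "\<exists>N. simple_process N \<and>
    (\<forall>\<epsilon>>0. prob {\<omega>\<in>space M. covariation_approx (\<lambda>t \<omega>. L t \<omega> - N t \<omega>) (\<lambda>t \<omega>. L t \<omega> - N t \<omega>) \<epsilon> 1 \<omega> > \<delta>} < \<delta>)"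
proof -
  have cL: "continuous_process M L" using L by (simp add: continuous_local_martingale_def)
  obtain \<tau> :: "nat \<Rightarrow> 'a \<Rightarrow> real" where st: "\<And>n. stopping_time H (\<tau> n)"
    and pos: "\<And>n \<omega>. \<omega> \<in> space M \<Longrightarrow> 0 \<le> \<tau> n \<omega>"
    and one: "AE \<omega> in M. \<forall>\<^sub>F n in sequentially. 1 \<le> \<tau> n \<omega>"
    and mart: "\<And>n. martingale M H (\<lambda>t \<omega>. L (min t (\<tau> n \<omega>)) \<omega> - L 0 \<omega>)"
    using L unfolding continuous_local_martingale_def by blast
  define S where "S n = {\<omega>\<in>space M. \<tau> n \<omega> < 1}" for n
  have taum [measurable]: "\<tau> n \<in> borel_measurable M" for n
    by (rule measurable_stopping_time[OF st]) (use subalg space_F in \<open>auto simp: subalgebra_def\<close>)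
  have S [measurable]: "S n \<in> events" for n unfolding S_def by measurable
  have "(\<lambda>n. prob (S n)) \<longlonglongrightarrow> 0"
  proof (rule tendsto_prob_eventually_avoided_seq[OF S])
    show "AE \<omega> in M. \<forall>\<^sub>F n in sequentially. \<omega> \<notin> S n"
      using one by eventually_elim (auto elim!: eventually_mono simp: S_def)
  qed
  from order_tendstoD(2)[OF this, of "\<delta>/2"] d
  have "\<forall>\<^sub>F n in sequentially. prob (S n) < \<delta> / 2" by simp
  then obtain n where n: "prob (S n) < \<delta> / 2" by (auto simp: eventually_sequentially)
  define X where "X = (\<lambda>t \<omega>. L (min t (\<tau> n \<omega>)) \<omega> - L 0 \<omega>)"
  have X: "martingale M H X" unfolding X_def by (rule mart)
  have cX: "continuous_process M X" unfolding continuous_process_def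
  proof (intro conjI ballI)
    show "X t \<in> borel_measurable M" if "t \<in> {0..1}" for t by (rule martingaleD(2)[OF X that])
    fix \<omega> assume w: "\<omega> \<in> space M"
    have "continuous_on {0..1} (\<lambda>t. L (min t (\<tau> n \<omega>)) \<omega>)"
      by (rule continuous_on_compose2[OF continuous_processD(2)[OF cL w]])
        (use pos[OF w] in \<open>auto intro!: continuous_intros simp: min_le_iff_disj\<close>)
    then show "continuous_on {0..1} (\<lambda>t. X t \<omega>)" unfolding X_def by (intro continuous_on_diff continuous_on_const)
  qed
  have "approximable (X 1)" using martingaleD(1,3)[OF X, of 1] by (intro approximable_H1) auto
  moreover have "0 < \<delta> / 2 / (1 + 4 / \<delta>)" using d by (intro divide_pos_pos add_pos_pos) auto
  ultimately obtain N where N: "simple_process N" "(\<integral>\<omega>. \<bar>X 1 \<omega> - N 1 \<omega>\<bar> \<partial>M) < \<delta> / 2 / (1 + 4 / \<delta>)"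
    using approximableD(3) by blast
  define Z where "Z = (\<lambda>t \<omega>. X t \<omega> - N t \<omega>)"
  define Y where "Y = (\<lambda>t \<omega>. L t \<omega> - N t \<omega>)"
  have cN: "continuous_process M N" by (rule simple_process_continuous[OF N(1)])
  have Z: "martingale M H Z" "continuous_process M Z"
    unfolding Z_def by (intro martingale_diff X simple_process_martingale[OF N(1)] continuous_process_diff cX cN)+
  have "prob {\<omega>\<in>space M. covariation_approx Y Y \<epsilon> 1 \<omega> > \<delta>} < \<delta>" if e: "0 < \<epsilon>" for \<epsilon>
  proof -
    have [measurable]: "covariation_approx Z Z \<epsilon> 1 \<in> borel_measurable M"
      by (rule measurable_covariation_approx[OF Z(2) Z(2)])
    have "{\<omega>\<in>space M. covariation_approx Y Y \<epsilon> 1 \<omega> > \<delta>} \<subseteq> S n \<union> {\<omega>\<in>space M. covariation_approx Z Z \<epsilon> 1 \<omega> > \<delta>}"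
    proof
      fix \<omega> assume w: "\<omega> \<in> {\<omega>\<in>space M. covariation_approx Y Y \<epsilon> 1 \<omega> > \<delta>}"
      show "\<omega> \<in> S n \<union> {\<omega>\<in>space M. covariation_approx Z Z \<epsilon> 1 \<omega> > \<delta>}"
      proof (cases "\<omega> \<in> S n")
        case False
        then have "1 \<le> \<tau> n \<omega>" using w by (auto simp: S_def)
        then have "extend Z s \<omega> = extend Y s \<omega> - L 0 \<omega>" for s
          by (simp add: extend_def Z_def X_def Y_def min_absorb1)
        then have "covariation_approx Z Z \<epsilon> 1 \<omega> = covariation_approx Y Y \<epsilon> 1 \<omega>"
          by (simp add: covariation_approx_def)
        then show ?thesis using w by simp
      qed simp
    qed
    then have "prob {\<omega>\<in>space M. covariation_approx Y Y \<epsilon> 1 \<omega> > \<delta>}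
      \<le> prob (S n \<union> {\<omega>\<in>space M. covariation_approx Z Z \<epsilon> 1 \<omega> > \<delta>})"
      by (intro finite_measure_mono) auto
    also have "\<dots> \<le> prob (S n) + prob {\<omega>\<in>space M. covariation_approx Z Z \<epsilon> 1 \<omega> > \<delta>}"
      by (intro measure_Un_le) auto
    also have "prob {\<omega>\<in>space M. covariation_approx Z Z \<epsilon> 1 \<omega> > \<delta>} \<le> (1 + 4 / \<delta>) * (\<integral>\<omega>. \<bar>Z 1 \<omega>\<bar> \<partial>M)"
      by (rule martingale_quadratic_variation_tail[OF Z e d])
    also have "\<dots> < \<delta> / 2"
    proof -
      have "0 < 1 + 4 / \<delta>" using d by (intro add_pos_pos) auto
      with N(2) have "(\<integral>\<omega>. \<bar>X 1 \<omega> - N 1 \<omega>\<bar> \<partial>M) * (1 + 4 / \<delta>) < \<delta> / 2"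
        by (simp only: pos_less_divide_eq)
      then show ?thesis by (simp only: Z_def mult.commute[of "1 + 4 / \<delta>"])
    qed
    finally show ?thesis using n by simp
  qed
  with N(1) show ?thesis unfolding Y_def by blast
qed

text \<open>
Boundedness in probability of the approximate quadratic variation as \<open>\<epsilon>\<close> tends to 0; unlike the
existence of \<open>[X,X]\<close>, it can be checked for local martingales in advance.
\<close>

definition tight_quadratic_variation :: "(real \<Rightarrow> 'a \<Rightarrow> real) \<Rightarrow> bool" where
  "tight_quadratic_variation X \<longleftrightarrow> (\<forall>\<eta>>0. \<exists>K. \<forall>\<^sub>F \<epsilon> in at_right 0.
     prob {\<omega>\<in>space M. covariation_approx X X \<epsilon> 1 \<omega> > K} < \<eta>)"

lemma tight_finite_quadratic_variation:
  assumes "finite_quadratic_variation M X"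
  shows "tight_quadratic_variation X"
  unfolding tight_quadratic_variation_def
proof (intro allI impI)
  fix \<eta> :: real assume "0 < \<eta>"
  then have h: "0 < \<eta> / 2" by simp
  obtain A where A: "has_covariation M X X A" using assms by (auto simp: finite_quadratic_variation_def)
  then have c: "continuous_process M X" "continuous_process M A" and u: "ucp_limit M (covariation_approx X X) A"
    by (auto simp: has_covariation_def)
  have [measurable]: "A 1 \<in> borel_measurable M" by (rule continuous_processD(1)[OF c(2)]) simp
  have "(\<lambda>k. prob {\<omega>\<in>space M. A 1 \<omega> > real k}) \<longlonglongrightarrow> 0"
  proof (rule tendsto_prob_eventually_avoided_seq)
    show "AE \<omega> in M. \<forall>\<^sub>F k in sequentially. \<omega> \<notin> {\<omega>\<in>space M. A 1 \<omega> > real k}"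
    proof (rule AE_I2)
      fix \<omega>
      obtain k0 :: nat where "A 1 \<omega> < real k0" using reals_Archimedean2 by blast
      then show "\<forall>\<^sub>F k in sequentially. \<omega> \<notin> {\<omega>\<in>space M. A 1 \<omega> > real k}"
        by (intro eventually_sequentiallyI[of k0]) auto
    qed
  qed measurable
  from order_tendstoD(2)[OF this h] obtain k :: nat where k: "prob {\<omega>\<in>space M. A 1 \<omega> > real k} < \<eta> / 2"
    by (auto simp: eventually_sequentially)
  have "\<forall>\<^sub>F \<epsilon> in at_right 0. prob {\<omega>\<in>space M. covariation_approx X X \<epsilon> 1 \<omega> > real k + 1} < \<eta>"
    using ucp_limitD[OF u zero_less_one h]
  proof eventually_elim
    case (elim \<epsilon>)
    let ?E = "exceed M (\<lambda>t \<omega>. covariation_approx X X \<epsilon> t \<omega> - A t \<omega>) 1"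
    have E: "?E \<in> events"
      by (intro exceed_sets continuous_process_diff continuous_process_covariation_approx c)
    have "{\<omega>\<in>space M. covariation_approx X X \<epsilon> 1 \<omega> > real k + 1} \<subseteq> ?E \<union> {\<omega>\<in>space M. A 1 \<omega> > real k}"
    proof
      fix \<omega> assume w: "\<omega> \<in> {\<omega>\<in>space M. covariation_approx X X \<epsilon> 1 \<omega> > real k + 1}"
      show "\<omega> \<in> ?E \<union> {\<omega>\<in>space M. A 1 \<omega> > real k}"
      proof (cases "A 1 \<omega> > real k")
        case False
        then have "\<bar>covariation_approx X X \<epsilon> 1 \<omega> - A 1 \<omega>\<bar> > 1" using w by simp
        then show ?thesis using w by (auto simp: exceed_def intro!: bexI[of _ 1])
      qed (use w in simp)
    qed
    then have "prob {\<omega>\<in>space M. covariation_approx X X \<epsilon> 1 \<omega> > real k + 1} \<le> prob (?E \<union> {\<omega>\<in>space M. A 1 \<omega> > real k})"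
      using E by (intro finite_measure_mono) auto
    also have "\<dots> \<le> prob ?E + prob {\<omega>\<in>space M. A 1 \<omega> > real k}" using E by (intro measure_Un_le) auto
    finally show ?case using elim k by simp
  qed
  then show "\<exists>K. \<forall>\<^sub>F \<epsilon> in at_right 0. prob {\<omega>\<in>space M. covariation_approx X X \<epsilon> 1 \<omega> > K} < \<eta>" by blast
qed

lemma tight_simple_process: "simple_process N \<Longrightarrow> tight_quadratic_variation N"
  using covariation_simple_processes_exists[of N N]
  by (intro tight_finite_quadratic_variation) (auto simp: finite_quadratic_variation_def)

text \<open>
Compare \<open>L\<close> with a single simple process.
\<close>

lemma tight_local_martingale:
  assumes L: "continuous_local_martingale M H L"
  shows "tight_quadratic_variation L"
  unfolding tight_quadratic_variation_def
proof (intro allI impI)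
  have cL: "continuous_process M L" using L by (simp add: continuous_local_martingale_def)
  fix \<eta> :: real assume "0 < \<eta>"
  then have h: "0 < \<eta> / 2" by simp
  obtain N where N: "simple_process N" and LN: "\<And>\<epsilon>. 0 < \<epsilon> \<Longrightarrow>
    prob {\<omega>\<in>space M. covariation_approx (\<lambda>t \<omega>. L t \<omega> - N t \<omega>) (\<lambda>t \<omega>. L t \<omega> - N t \<omega>) \<epsilon> 1 \<omega> > \<eta> / 2} < \<eta> / 2"
    using local_martingale_approximation[OF L h] by blast
  obtain K where K: "\<forall>\<^sub>F \<epsilon> in at_right 0. prob {\<omega>\<in>space M. covariation_approx N N \<epsilon> 1 \<omega> > K} < \<eta> / 2"
    using tight_simple_process[OF N] h unfolding tight_quadratic_variation_def by blast
  have cN: "continuous_process M N" by (rule simple_process_continuous[OF N])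
  define Y where "Y = (\<lambda>t \<omega>. L t \<omega> - N t \<omega>)"
  have cY: "continuous_process M Y" unfolding Y_def by (intro continuous_process_diff cL cN)
  have "\<forall>\<^sub>F \<epsilon> in at_right 0. prob {\<omega>\<in>space M. covariation_approx L L \<epsilon> 1 \<omega> > \<eta> + 2 * K} < \<eta>"
    using K eventually_at_right_0_01
  proof eventually_elim
    case (elim \<epsilon>)
    note [measurable] = measurable_covariation_approx[OF cN cN, of \<epsilon>] measurable_covariation_approx[OF cY cY, of \<epsilon>]
    have "{\<omega>\<in>space M. covariation_approx L L \<epsilon> 1 \<omega> > \<eta> + 2 * K} \<subseteq>
      {\<omega>\<in>space M. covariation_approx Y Y \<epsilon> 1 \<omega> > \<eta> / 2} \<union> {\<omega>\<in>space M. covariation_approx N N \<epsilon> 1 \<omega> > K}"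
    proof
      fix \<omega> assume w: "\<omega> \<in> {\<omega>\<in>space M. covariation_approx L L \<epsilon> 1 \<omega> > \<eta> + 2 * K}"
      then have ws: "\<omega> \<in> space M" by simp
      have LYN: "(\<lambda>s. extend L s \<omega>) = (\<lambda>s. extend Y s \<omega> + extend N s \<omega>)" by (simp add: extend_def Y_def)
      have "covariation_approx L L \<epsilon> 1 \<omega> \<le> 2 * covariation_approx Y Y \<epsilon> 1 \<omega> + 2 * covariation_approx N N \<epsilon> 1 \<omega>"
        unfolding covariation_approx_eq_path_cov[OF cL cL ws] covariation_approx_eq_path_cov[OF cY cY ws]
          covariation_approx_eq_path_cov[OF cN cN ws] LYN
        using elim by (intro path_cov_add_square_le continuous_on_extend[OF _ ws] cY cN) auto
      then have "covariation_approx Y Y \<epsilon> 1 \<omega> > \<eta> / 2 \<or> covariation_approx N N \<epsilon> 1 \<omega> > K"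
        using w by auto
      then show "\<omega> \<in> {\<omega>\<in>space M. covariation_approx Y Y \<epsilon> 1 \<omega> > \<eta> / 2} \<union> {\<omega>\<in>space M. covariation_approx N N \<epsilon> 1 \<omega> > K}"
        using ws by auto
    qed
    then have "prob {\<omega>\<in>space M. covariation_approx L L \<epsilon> 1 \<omega> > \<eta> + 2 * K} \<le>
      prob ({\<omega>\<in>space M. covariation_approx Y Y \<epsilon> 1 \<omega> > \<eta> / 2} \<union> {\<omega>\<in>space M. covariation_approx N N \<epsilon> 1 \<omega> > K})"
      by (intro finite_measure_mono) auto
    also have "\<dots> \<le> prob {\<omega>\<in>space M. covariation_approx Y Y \<epsilon> 1 \<omega> > \<eta> / 2} + prob {\<omega>\<in>space M. covariation_approx N N \<epsilon> 1 \<omega> > K}"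
      by (intro measure_Un_le) auto
    finally show ?case using elim LN[of \<epsilon>] unfolding Y_def by linarith
  qed
  then show "\<exists>K. \<forall>\<^sub>F \<epsilon> in at_right 0. prob {\<omega>\<in>space M. covariation_approx L L \<epsilon> 1 \<omega> > K} < \<eta>" by blast
qed

text \<open>
Write \<open>[X,L] = [X,N] + [X,L - N]\<close> at the level of the approximations and estimate the last term by
\<open>abs_path_cov_le\<close>.
\<close>

lemma covariation_local_martingale_approximation:
  assumes cX: "continuous_process M X" and X: "tight_quadratic_variation X"
    and L: "continuous_local_martingale M H L" and d: "0 < \<delta>"
  shows "\<exists>N. simple_process N \<and> (\<forall>B. has_covariation M X N B \<longrightarrow>
    (\<forall>\<^sub>F \<epsilon> in at_right 0. prob (exceed M (\<lambda>t \<omega>. covariation_approx X L \<epsilon> t \<omega> - B t \<omega>) \<delta>) < \<delta>))"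
proof -
  have cL: "continuous_process M L" using L by (simp add: continuous_local_martingale_def)
  have d3: "0 < \<delta> / 3" and d2: "0 < \<delta> / 2" using d by auto
  obtain K0 where K0: "\<forall>\<^sub>F \<epsilon> in at_right 0. prob {\<omega>\<in>space M. covariation_approx X X \<epsilon> 1 \<omega> > K0} < \<delta> / 3"
    using X d3 unfolding tight_quadratic_variation_def by blast
  define K where "K = max K0 1"
  have K: "0 < K" "K0 \<le> K" by (auto simp: K_def)
  \<comment> \<open>chosen so that, when \<open>QV\<^sub>\<epsilon>(X) \<le> K\<close> and \<open>QV\<^sub>\<epsilon>(L - N) \<le> r\<close>, both terms of the inequality are at most \<open>\<delta> / 4\<close>\<close>
  define \<kappa> where "\<kappa> = \<delta> / (4 * K)"
  have kap: "0 < \<kappa>" "\<kappa> * K = \<delta> / 4" using d K by (auto simp: \<kappa>_def)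
  define r where "r = min (\<delta> / 3) (\<delta> * \<kappa> / 4)"
  have r: "0 < r" "r \<le> \<delta> / 3" "r / \<kappa> \<le> \<delta> / 4" using d kap by (auto simp: r_def pos_divide_le_eq)
  obtain N where N: "simple_process N" and LN: "\<And>\<epsilon>. 0 < \<epsilon> \<Longrightarrow>
    prob {\<omega>\<in>space M. covariation_approx (\<lambda>t \<omega>. L t \<omega> - N t \<omega>) (\<lambda>t \<omega>. L t \<omega> - N t \<omega>) \<epsilon> 1 \<omega> > r} < r"
    using local_martingale_approximation[OF L r(1)] by blast
  have cN: "continuous_process M N" by (rule simple_process_continuous[OF N])
  define Y where "Y = (\<lambda>t \<omega>. L t \<omega> - N t \<omega>)"
  have cY: "continuous_process M Y" unfolding Y_def by (intro continuous_process_diff cL cN)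
  have "\<forall>\<^sub>F \<epsilon> in at_right 0. prob (exceed M (\<lambda>t \<omega>. covariation_approx X L \<epsilon> t \<omega> - B t \<omega>) \<delta>) < \<delta>"
    if B: "has_covariation M X N B" for B
  proof -
    have cB: "continuous_process M B" and u: "ucp_limit M (covariation_approx X N) B"
      using B by (auto simp: has_covariation_def)
    show ?thesis using K0 ucp_limitD[OF u d2 d3] eventually_at_right_0_01
    proof eventually_elim
      case (elim \<epsilon>)
      note [measurable] = measurable_covariation_approx[OF cX cX, of \<epsilon>] measurable_covariation_approx[OF cY cY, of \<epsilon>]
      define E1 where "E1 = {\<omega>\<in>space M. covariation_approx X X \<epsilon> 1 \<omega> > K0}"
      define E2 where "E2 = {\<omega>\<in>space M. covariation_approx Y Y \<epsilon> 1 \<omega> > r}"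
      define E3 where "E3 = exceed M (\<lambda>t \<omega>. covariation_approx X N \<epsilon> t \<omega> - B t \<omega>) (\<delta> / 2)"
      have E: "E1 \<in> events" "E2 \<in> events" "E3 \<in> events"
        unfolding E1_def E2_def E3_def
        by (measurable, measurable, intro exceed_sets continuous_process_diff continuous_process_covariation_approx cX cN cB)
      have "exceed M (\<lambda>t \<omega>. covariation_approx X L \<epsilon> t \<omega> - B t \<omega>) \<delta> \<subseteq> E1 \<union> E2 \<union> E3"
      proof
        fix \<omega> assume "\<omega> \<in> exceed M (\<lambda>t \<omega>. covariation_approx X L \<epsilon> t \<omega> - B t \<omega>) \<delta>"
        then obtain t where w: "\<omega> \<in> space M" and t: "t \<in> {0..1}" "\<bar>covariation_approx X L \<epsilon> t \<omega> - B t \<omega>\<bar> > \<delta>"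
          by (auto simp: exceed_def)
        show "\<omega> \<in> E1 \<union> E2 \<union> E3"
        proof (rule ccontr)
          assume no: "\<omega> \<notin> E1 \<union> E2 \<union> E3"
          then have b: "covariation_approx X X \<epsilon> 1 \<omega> \<le> K" "covariation_approx Y Y \<epsilon> 1 \<omega> \<le> r"
            "\<bar>covariation_approx X N \<epsilon> t \<omega> - B t \<omega>\<bar> \<le> \<delta> / 2"
            using w t(1) K(2) by (auto simp: E1_def E2_def E3_def exceed_def not_less)
          note ext = continuous_on_extend[OF cX w] continuous_on_extend[OF cY w] continuous_on_extend[OF cL w] continuous_on_extend[OF cN w]
          have Yext: "(\<lambda>s. extend Y s \<omega>) = (\<lambda>s. extend L s \<omega> - extend N s \<omega>)" by (simp add: extend_def Y_def)
          have "covariation_approx X L \<epsilon> t \<omega> - covariation_approx X N \<epsilon> t \<omega> = covariation_approx X Y \<epsilon> t \<omega>"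
            unfolding covariation_approx_eq_path_cov[OF cX cL w] covariation_approx_eq_path_cov[OF cX cN w]
              covariation_approx_eq_path_cov[OF cX cY w] Yext path_cov_commute[of "\<lambda>s. extend X s \<omega>"]
            by (rule path_cov_diff[OF ext(3,4,1), symmetric])
          moreover have "\<bar>covariation_approx X Y \<epsilon> t \<omega>\<bar> \<le> \<kappa> * covariation_approx X X \<epsilon> 1 \<omega> + covariation_approx Y Y \<epsilon> 1 \<omega> / \<kappa>"
            unfolding covariation_approx_eq_path_cov[OF cX cX w] covariation_approx_eq_path_cov[OF cY cY w]
              covariation_approx_eq_path_cov[OF cX cY w]
            using elim t kap by (intro abs_path_cov_le ext) auto
          moreover have "\<kappa> * covariation_approx X X \<epsilon> 1 \<omega> \<le> \<kappa> * K" using b kap by (intro mult_left_mono) auto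
          moreover have "covariation_approx Y Y \<epsilon> 1 \<omega> / \<kappa> \<le> r / \<kappa>" using b kap by (intro divide_right_mono) auto
          ultimately show False using t b r kap by linarith
        qed
      qed
      then have "prob (exceed M (\<lambda>t \<omega>. covariation_approx X L \<epsilon> t \<omega> - B t \<omega>) \<delta>) \<le> prob (E1 \<union> E2 \<union> E3)"
        using E by (intro finite_measure_mono) auto
      also have "\<dots> \<le> prob (E1 \<union> E2) + prob E3" using E by (intro measure_Un_le) auto
      also have "\<dots> \<le> prob E1 + prob E2 + prob E3" using E by (intro add_right_mono measure_Un_le) auto
      finally show ?case using elim LN[of \<epsilon>] r(2) unfolding E1_def E2_def E3_def Y_def by linarith
    qed
  qed
  with N show ?thesis by blast
qed

lemma covariation_local_martingale_exists:
  assumes cX: "continuous_process M X" and X: "tight_quadratic_variation X"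
    and L: "continuous_local_martingale M H L"
    and simple: "\<And>N. simple_process N \<Longrightarrow> \<exists>B. has_covariation M X N B"
  shows "\<exists>A. has_covariation M X L A"
proof -
  have cL: "continuous_process M L" using L by (simp add: continuous_local_martingale_def)
  have "\<exists>A. continuous_process M A \<and> ucp_limit M (covariation_approx X L) A"
  proof (rule ucp_limit_exists_of_approximations)
    fix \<delta> :: real assume "0 < \<delta>"
    from covariation_local_martingale_approximation[OF cX X L this] simple
    show "\<exists>B. continuous_process M B \<and>
      (\<forall>\<^sub>F \<epsilon> in at_right 0. prob (exceed M (\<lambda>t \<omega>. covariation_approx X L \<epsilon> t \<omega> - B t \<omega>) \<delta>) < \<delta>)"
      unfolding has_covariation_def by blast
  qed (rule continuous_process_covariation_approx[OF cX cL])
  then show ?thesis using cX cL by (auto simp: has_covariation_def)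
qed

lemma covariation_local_martingale_zero:
  assumes cX: "continuous_process M X" and X: "tight_quadratic_variation X"
    and L: "continuous_local_martingale M H L"
    and simple: "\<And>N. simple_process N \<Longrightarrow> has_covariation M X N (\<lambda>_ _. 0)"
  shows "has_covariation M X L (\<lambda>_ _. 0)"
proof -
  have cL: "continuous_process M L" using L by (simp add: continuous_local_martingale_def)
  have c0: "continuous_process M (\<lambda>_ _. 0)" by (rule continuous_process_const) simp
  have "ucp_limit M (covariation_approx X L) (\<lambda>_ _. 0)"
  proof (rule ucp_limitI[OF _ continuous_process_covariation_approx[OF cX cL] c0])
    fix \<delta> :: real assume "0 < \<delta>"
    from covariation_local_martingale_approximation[OF cX X L this] simple
    show "\<forall>\<^sub>F \<epsilon> in at_right 0. prob (exceed M (\<lambda>t \<omega>. covariation_approx X L \<epsilon> t \<omega> - 0) \<delta>) < \<delta>"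
      by blast
  qed
  then show ?thesis using cX cL c0 by (simp add: has_covariation_def)
qed

text \<open>
The approximation is applied twice: first to \<open>[N,L]\<close> with \<open>N\<close> simple, then to \<open>[L,L]\<close>.
\<close>

lemma local_martingale_quadratic_variation:
  assumes L: "continuous_local_martingale M H L"
  shows "\<exists>A. has_covariation M L L A"
proof (rule covariation_local_martingale_exists[OF _ tight_local_martingale[OF L] L])
  show "continuous_process M L" using L by (simp add: continuous_local_martingale_def)
  fix N assume N: "simple_process N"
  have "\<exists>A. has_covariation M N L A"
    by (rule covariation_local_martingale_exists[OF simple_process_continuous[OF N] tight_simple_process[OF N] L
      covariation_simple_processes_exists[OF N]])
  then show "\<exists>A. has_covariation M L N A" using has_covariation_commute by blast
qed

text \<open>
On the unit interval \<open>W - W\<^sub>0\<close> is itself a simple process.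
\<close>

lemma W_local_martingale: "continuous_local_martingale M H W"
proof -
  have "simple_process (\<lambda>t \<omega>. 1 * (W (min t 1) \<omega> - W (min t 0) \<omega>))"
    by (rule simple_process.increment[where K=1]) auto
  from simple_process_martingale[OF this]
  have "martingale M H (\<lambda>t \<omega>. W (min t 1) \<omega> - W (min t 0) \<omega>)" by simp
  then have "martingale M H (\<lambda>t \<omega>. W (min t 1) \<omega> - W 0 \<omega>)"
    by (auto simp: martingale_def adapted_def)
  moreover have "adapted H W" unfolding adapted_def by (auto intro: W_adapted)
  ultimately show ?thesis
    unfolding continuous_local_martingale_def
    by (intro conjI continuous_W exI[of _ "\<lambda>_ _. 1"]) (auto simp: stopping_time_const)
qed

end

theorem corollary3p15:
  fixes M :: "'a measure" and W D :: "real \<Rightarrow> 'a \<Rightarrow> real" and H :: "real \<Rightarrow> 'a measure"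
  assumes "prob_space M"
    and "brownian_motion M W"
    and "H = augmented_filtration M W"
    and "continuous_process M D"
    and "adapted H D"
    and "finite_quadratic_variation M D"
  shows "weak_dirichlet M H D \<longleftrightarrow>
    (\<exists>L Q. continuous_local_martingale M H L \<and>
       finite_quadratic_variation M Q \<and> continuous_process M Q \<and> adapted H Q \<and>
       has_covariation M Q W (\<lambda>_ _. 0) \<and>
       process_sum M D L Q)"
proof -
  interpret brownian M W
    using assms(1,2) by (simp add: brownian_def brownian_axioms_def)
  show ?thesis
  proof
    assume "weak_dirichlet M H D"
    then obtain L Q where L: "continuous_local_martingale M H L" and Q: "continuous_process M Q"
      and orth: "\<And>N. continuous_local_martingale M H N \<Longrightarrow> has_covariation M Q N (\<lambda>_ _. 0)"
      and sum: "process_sum M D L Q"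
      unfolding weak_dirichlet_def by blast
    have cL: "continuous_process M L" and aL: "adapted H L"
      using L by (auto simp: continuous_local_martingale_def)
    have Q_eq: "D t \<omega> - L t \<omega> = Q t \<omega>" if "t \<in> {0..1}" "\<omega> \<in> space M" for t \<omega>
      using sum that by (simp add: process_sum_def)
    have "adapted H Q" unfolding adapted_def
    proof
      fix t :: real assume t: "t \<in> {0..1}"
      have "(\<lambda>\<omega>. D t \<omega> - L t \<omega>) \<in> borel_measurable (H t)"
        using t aL assms(5) by (intro borel_measurable_diff) (auto simp: adapted_def)
      then show "Q t \<in> borel_measurable (H t)"
        using Q_eq[OF t] by (subst measurable_cong[of _ _ "\<lambda>\<omega>. D t \<omega> - L t \<omega>"]) (auto simp: assms(3) space_F)
    qed
    obtain A where DD: "has_covariation M D D A" using assms(6) by (auto simp: finite_quadratic_variation_def)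
    obtain B where LL: "has_covariation M L L B" using local_martingale_quadratic_variation L assms(3) by blast
    have QL: "has_covariation M Q L (\<lambda>_ _. 0)" by (rule orth[OF L])
    \<comment> \<open>\<open>[D,L] = [L,L] + [Q,L] = [L,L]\<close>, from which \<open>[D - L, D - L]\<close> is assembled by bilinearity\<close>
    have DL: "has_covariation M D L (\<lambda>t \<omega>. B t \<omega> + 0)"
      by (rule has_covariation_cong[OF has_covariation_add[OF LL QL] assms(4)])
        (use sum in \<open>simp add: process_sum_def\<close>)
    let ?Q = "\<lambda>t \<omega>. D t \<omega> - L t \<omega>"
    have "has_covariation M ?Q D (\<lambda>t \<omega>. A t \<omega> - (B t \<omega> + 0))"
      by (rule has_covariation_diff[OF DD has_covariation_commute[OF DL]])
    moreover have "has_covariation M ?Q L (\<lambda>t \<omega>. (B t \<omega> + 0) - B t \<omega>)"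
      by (rule has_covariation_diff[OF DL LL])
    ultimately obtain C where "has_covariation M ?Q ?Q C"
      using has_covariation_diff has_covariation_commute by blast
    then have "has_covariation M ?Q Q C"
      using has_covariation_commute has_covariation_cong[OF _ Q Q_eq] by blast
    then have "has_covariation M Q Q C"
      by (rule has_covariation_cong[OF _ Q Q_eq])
    then have "finite_quadratic_variation M Q" by (auto simp: finite_quadratic_variation_def)
    moreover have "has_covariation M Q W (\<lambda>_ _. 0)"
      using orth W_local_martingale assms(3) by blast
    ultimately show "\<exists>L Q. continuous_local_martingale M H L \<and>
       finite_quadratic_variation M Q \<and> continuous_process M Q \<and> adapted H Q \<and>
       has_covariation M Q W (\<lambda>_ _. 0) \<and> process_sum M D L Q"
      using L Q \<open>adapted H Q\<close> sum by blast
  next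
    assume "\<exists>L Q. continuous_local_martingale M H L \<and>
       finite_quadratic_variation M Q \<and> continuous_process M Q \<and> adapted H Q \<and>
       has_covariation M Q W (\<lambda>_ _. 0) \<and> process_sum M D L Q"
    then obtain L Q where L: "continuous_local_martingale M H L" and fQ: "finite_quadratic_variation M Q"
      and Q: "continuous_process M Q" and QW: "has_covariation M Q W (\<lambda>_ _. 0)" and sum: "process_sum M D L Q"
      by blast
    have "has_covariation M Q N (\<lambda>_ _. 0)" if N: "continuous_local_martingale M H N" for N
    proof (rule covariation_local_martingale_zero[OF Q tight_finite_quadratic_variation[OF fQ]])
      show "continuous_local_martingale M (augmented_filtration M W) N" using N assms(3) by simp
      fix S assume "simple_process S"
      from covariation_simple_process[OF QW this] show "has_covariation M Q S (\<lambda>_ _. 0)" by auto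
    qed
    then show "weak_dirichlet M H D" unfolding weak_dirichlet_def using L Q sum by blast
  qed
qed

end
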